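(* Let $\Phi$ be a Markoff map such that $\Phi(R_{p/q})>2$ for all $\frac pq\in\mathbb{P}^1\mathbb{Q}$ and $K:=A^2+B^2+C^2-ABC-2<2$, where $A=\Phi(R_\infty)$, $B=\Phi(R_0)$, $C=\Phi(R_1)$; put also $D=\Phi(R_2)=AC-B$. Let $a,b,c,d>1$ be such that $A=a+a^{-1}$, $B=b+b^{-1}$, $C=c+c^{-1}$, $D=d+d^{-1}$. In the projective plane $\mathbb{P}^2\mathbb{R}$ with homogeneous coordinates $[A':B':C']=[\Phi'(R_\infty):\Phi'(R_0):\Phi'(R_1)]$ on the space of infinitesimal deformations $\Phi'$ of $\Phi$, consider the following segments, each contained in the projectivized nonnegative octant: - $\boldsymbol{\alpha}$ from $[0:1:a]$ to $[0:a:1]$; - $\boldsymbol{\beta}$ from $[1:0:b]$ to $[b:0:1]$; - $\boldsymbol{\gamma}$ from $[1:c:0]$ to $[c:1:0]$; - $\boldsymbol{\delta}$ from $[1:C+dA:d]$ to $[d:A+dC:1]$; and let $Q$ be the convex quadrilateral in the projectivized nonnegative octant with vertices $[0:0:1]$, $[1:0:0]$, $[1:C:0]$, $[0:A:1]$. Then the cone of lengthening deformations of $\Phi$ projectivizes to a projective polygon $\Pi$ contained in $Q$ and containing the convex hull of $\boldsymbol{\alpha}\cup\boldsymbol{\beta}\cup\boldsymbol{\gamma}\cup\boldsymbol{\delta}$. Moreover, $\Pi$ has one nondegenerate side for each rational slope; for example the sides $\boldsymbol{\alpha},\boldsymbol{\beta},\boldsymbol{\gamma},\boldsymbol{\delta}$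 correspond to the slopes attached to the regions carrying $A,B,C,D$ (namely $\infty,0,1,2$).
   Context: Farey neighbors: two rationals $\frac pq,\frac{p'}{q'}\in\mathbb{P}^1\mathbb{Q}=\mathbb{Q}\cup\{\infty\}$ in reduced form (with $\infty=\frac10$) are Farey neighbors if $|pq'-qp'|=1$. Let $\mathcal{R}=\{R_{p/q}\}$ be the set of complementary regions of the trivalent tree in $\mathbb{H}^2$ dual to the Farey triangulation, indexed by $\mathbb{P}^1\mathbb{Q}$; two regions are adjacent iff their indices are Farey neighbors. A Markoff map is a map $\Phi:\mathcal{R}\to\mathbb{R}$ such that whenever $R,R',R'',R'''$ are distinct regions with every pair among them adjacent except $\{R,R'''\}$, one has $\Phi(R)+\Phi(R''')=\Phi(R')\Phi(R'')$. The Markoff maps satisfying the two inequalities in the claim are called geometric; they are exactly those recording the traces $2\cosh(\ell_s/2)$ of the simple closed curves of slope $s\in\mathbb{P}^1\mathbb{Q}$, of length $\ell_s$, for hyperbolic metrics on the one-holed torus with geodesic boundary, a cusp, or a cone singularity of angle in $(0,2\pi)$ at the hole. An infinitesimal deformation of $\Phi$ is a map $\Phi':\mathcal{R}\to\mathbb{R}$ satisfying the linearized relation $\Phi'(R)+\Phi'(R''')=\Phi'(R')\Phi(R'')+\Phi(R')\Phi'(R'')$ for all distinct regions $R,R',R'',R'''$ with every pair among them adjacent except $\{R,R'''\}$; it is determined by $(A',B',C')=(\Phi'(R_\infty),\Phi'(R_0),\Phi'(R_1))\in\mathbb{R}^3$, which is arbitrary. It corresponds to an infinitesimal deformation of the hyperbolic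 metric, and is called lengthening if it lengthens all measured laminations on the one-holed torus to first order (in particular all simple closed curves, i.e. $\Phi'(R_s)>0$ for all $s\in\mathbb{P}^1\mathbb{Q}$). A "polygon" here is a convex region in an affine chart of $\mathbb{P}^2\mathbb{R}$, possibly with infinitely many sides; a side of $\Pi$ is a maximal segment of $\partial\Pi$ not reduced to a point. The side of slope $s$ is the one on which $\Phi'(R_s)=0$.
   Formalization: Lengthening is strict, so the cone's projectivization is open and cannot contain the segments (on α, Φ'(R_∞)=0); Π is taken to be its closure, and the projectivized cone of lengthening deformations is shown to be the interior of Π. *)

theory Defs
  imports "HOL-Analysis.Analysis"
begin

subsection \<open>Slopes and Markoff maps\<close>

text \<open>
  The slope \<^term>\<open>None\<close> is \<open>\<infinity> = 1/0\<close>.  The complementary region \<open>R_s\<close> of the dual tree is identified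
  with its index \<open>s\<close>; adjacency of regions is the Farey neighbor relation.
\<close>

type_synonym slope = "rat option"

fun reduced_form :: "slope \<Rightarrow> int \<times> int" where
  "reduced_form None = (1, 0)"
| "reduced_form (Some r) = quotient_of r"

definition farey_neighbors :: "slope \<Rightarrow> slope \<Rightarrow> bool" where
  "farey_neighbors s s' \<longleftrightarrow>
     (case (reduced_form s, reduced_form s') of ((p, q), (p', q')) \<Rightarrow> \<bar>p * q' - q * p'\<bar> = 1)"

definition adjacent_but_ends :: "slope \<Rightarrow> slope \<Rightarrow> slope \<Rightarrow> slope \<Rightarrow> bool" where
  "adjacent_but_ends R R' R'' R''' \<longleftrightarrow>
     distinct [R, R', R'', R'''] \<and>
     farey_neighbors R R' \<and> farey_neighbors R R'' \<and> farey_neighbors R' R'' \<and>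
     farey_neighbors R' R''' \<and> farey_neighbors R'' R''' \<and> \<not> farey_neighbors R R'''"

definition markoff_map :: "(slope \<Rightarrow> real) \<Rightarrow> bool" where
  "markoff_map \<Phi> \<longleftrightarrow>
     (\<forall>R R' R'' R'''. adjacent_but_ends R R' R'' R''' \<longrightarrow> \<Phi> R + \<Phi> R''' = \<Phi> R' * \<Phi> R'')"

definition infinitesimal_deformation :: "(slope \<Rightarrow> real) \<Rightarrow> (slope \<Rightarrow> real) \<Rightarrow> bool" where
  "infinitesimal_deformation \<Phi> \<Phi>' \<longleftrightarrow>
     (\<forall>R R' R'' R'''. adjacent_but_ends R R' R'' R''' \<longrightarrow>
        \<Phi>' R + \<Phi>' R''' = \<Phi>' R' * \<Phi> R'' + \<Phi> R' * \<Phi>' R'')"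

definition deformation_coords :: "(slope \<Rightarrow> real) \<Rightarrow> real ^ 3" where
  "deformation_coords \<Phi>' = vector [\<Phi>' None, \<Phi>' (Some 0), \<Phi>' (Some 1)]"


subsection \<open>Lengths of measured laminations, and lengthening deformations\<close>

text \<open>From \<open>\<Phi> s = 2 cosh (\<ell>\<^sub>s / 2)\<close>.\<close>

definition curve_length :: "(slope \<Rightarrow> real) \<Rightarrow> slope \<Rightarrow> real" where
  "curve_length \<Phi> s = 2 * arcosh (\<Phi> s / 2)"

definition slope_vec :: "slope \<Rightarrow> real \<times> real" where
  "slope_vec s = (case reduced_form s of (p, q) \<Rightarrow> (of_int p, of_int q))"

text \<open>
  The space of measured laminations of the one-holed torus (without peripheral leaves, the empty
  lamination included) is the quotient of the plane \<open>\<real>\<^sup>2\<close> by \<open>\<plusminus>1\<close>, where the simple closed curve of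
  slope \<open>p/q\<close> with transverse weight \<open>\<bar>t\<bar>\<close> is the class of \<open>t (p, q)\<close>.  The length of a measured
  lamination is the continuous extension of the weighted length of weighted simple closed curves;
  it is unique because these are dense.
\<close>

definition lamination_length :: "(slope \<Rightarrow> real) \<Rightarrow> real \<times> real \<Rightarrow> real" where
  "lamination_length \<Phi> =
     (THE L. continuous_on UNIV L \<and>
             (\<forall>s t. L (t *\<^sub>R slope_vec s) = \<bar>t\<bar> * curve_length \<Phi> s))"

text \<open>
  A deformation \<open>\<Psi>\<close> of \<open>\<Phi>\<close> with velocity \<open>\<Phi>'\<close>.  Every infinitesimal deformation has such paths,
  for instance the one that is affine in the values at \<open>\<infinity>\<close>, \<open>0\<close>, \<open>1\<close>.
\<close>

definition deformation_path ::
  "(slope \<Rightarrow> real) \<Rightarrow> (slope \<Rightarrow> real) \<Rightarrow> (real \<Rightarrow> slope \<Rightarrow> real) \<Rightarrow> bool" where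
  "deformation_path \<Phi> \<Phi>' \<Psi> \<longleftrightarrow>
     (\<forall>t. markoff_map (\<Psi> t)) \<and> \<Psi> 0 = \<Phi> \<and>
     (\<forall>s. ((\<lambda>t. \<Psi> t s) has_real_derivative \<Phi>' s) (at 0))"

definition lengthening :: "(slope \<Rightarrow> real) \<Rightarrow> (slope \<Rightarrow> real) \<Rightarrow> bool" where
  "lengthening \<Phi> \<Phi>' \<longleftrightarrow>
     infinitesimal_deformation \<Phi> \<Phi>' \<and>
     (\<forall>\<Psi>. deformation_path \<Phi> \<Phi>' \<Psi> \<longrightarrow>
        (\<forall>\<mu>. \<mu> \<noteq> 0 \<longrightarrow>
           (\<exists>D>0. ((\<lambda>t. lamination_length (\<Psi> t) \<mu>) has_real_derivative D) (at 0))))"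

definition lengthening_cone :: "(slope \<Rightarrow> real) \<Rightarrow> (real ^ 3) set" where
  "lengthening_cone \<Phi> = {deformation_coords \<Phi>' |\<Phi>'. lengthening \<Phi> \<Phi>'}"


subsection \<open>The real projective plane\<close>

text \<open>
  Points of the projective plane are the lines \<open>span {v}\<close> of \<open>\<real>\<^sup>3\<close> with \<open>v \<noteq> 0\<close>.
\<close>

type_synonym proj_point = "(real ^ 3) set"

definition proj :: "real ^ 3 \<Rightarrow> proj_point" where
  "proj v = span {v}"

abbreviation hom_pt :: "real \<Rightarrow> real \<Rightarrow> real \<Rightarrow> proj_point" where
  "hom_pt x y z \<equiv> proj (vector [x, y, z])"

definition projectivization :: "(real ^ 3) set \<Rightarrow> proj_point set" where
  "projectivization S = proj ` (S - {0})"

text \<open>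
  Closure, interior and boundary for the quotient topology, read off on the union of lines in \<open>\<real>\<^sup>3\<close>
  (the projection from \<open>\<real>\<^sup>3 - {0}\<close> is open and continuous).
\<close>

definition proj_closure :: "proj_point set \<Rightarrow> proj_point set" where
  "proj_closure P = projectivization (closure (\<Union>P))"

definition proj_interior :: "proj_point set \<Rightarrow> proj_point set" where
  "proj_interior P = projectivization (interior (\<Union>P))"

definition proj_boundary :: "proj_point set \<Rightarrow> proj_point set" where
  "proj_boundary P = projectivization (frontier (\<Union>P))"

text \<open>
  Convex hull inside the projectivized nonnegative octant (which is convex in the affine chart
  given by \<open>x + y + z \<noteq> 0\<close>), for sets of points of that octant.
\<close>

definition octant_hull :: "proj_point set \<Rightarrow> proj_point set" where
  "octant_hull P = proj ` (convex hull {v. v \<noteq> 0 \<and> (\<forall>i. 0 \<le> v $ i) \<and> proj v \<in> P})"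

text \<open>
  An affine chart of the projective plane is given by \<open>w \<noteq> 0\<close>: it is the set of lines not orthogonal
  to \<open>w\<close>, each of which meets the affine plane \<open>{v. w \<bullet> v = 1}\<close> in exactly one point.
\<close>

definition projective_polygon :: "proj_point set \<Rightarrow> bool" where
  "projective_polygon P \<longleftrightarrow>
     (\<exists>w. w \<noteq> 0 \<and> P \<subseteq> proj ` {v. w \<bullet> v = 1} \<and> convex {v. w \<bullet> v = 1 \<and> proj v \<in> P}) \<and>
     proj_interior P \<noteq> {}"

text \<open>
  Changing the sign of one of \<open>u\<close>, \<open>v\<close> gives the other projective segment with the same endpoints.
\<close>

definition nondegenerate_segment :: "proj_point set \<Rightarrow> bool" where
  "nondegenerate_segment S \<longleftrightarrow>
     (\<exists>u v. u \<noteq> v \<and> independent {u, v} \<and> S = proj ` closed_segment u v)"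

definition is_side :: "proj_point set \<Rightarrow> proj_point set \<Rightarrow> bool" where
  "is_side P S \<longleftrightarrow>
     nondegenerate_segment S \<and> S \<subseteq> proj_boundary P \<and>
     (\<forall>T. nondegenerate_segment T \<and> T \<subseteq> proj_boundary P \<and> S \<subseteq> T \<longrightarrow> T = S)"

definition side_of_slope ::
  "(slope \<Rightarrow> real) \<Rightarrow> proj_point set \<Rightarrow> slope \<Rightarrow> proj_point set \<Rightarrow> bool" where
  "side_of_slope \<Phi> P s S \<longleftrightarrow>
     is_side P S \<and>
     (\<forall>\<Phi>'. infinitesimal_deformation \<Phi> \<Phi>' \<and> deformation_coords \<Phi>' \<noteq> 0 \<and>
           proj (deformation_coords \<Phi>') \<in> S \<longrightarrow> \<Phi>' s = 0)"

end

theory Submission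
  imports Defs
begin

text \<open>
  Index the regions by primitive integer vectors up to sign, so that a Markoff map is an even function
  \<open>\<phi>\<close> with \<open>\<phi> (u + v) + \<phi> (u - v) = \<phi> u * \<phi> v\<close> on bases.  Because \<open>K < 2\<close>, the half-lengths
  \<open>arcosh (\<phi> / 2)\<close> extend to a norm on the plane, which is half the length of laminations.  In an
  irrational direction \<open>\<mu>\<close> this norm is the limit of \<open>p arcosh (\<phi> X / 2) + q arcosh (\<phi> Y / 2)\<close> over
  the edges \<open>{X, Y}\<close>, with \<open>\<mu> = p X + q Y\<close>, of the path of the Farey tree towards \<open>\<mu>\<close>.  Far out on
  the path the logarithmic derivatives of \<open>\<phi>\<close> are almost additive, so the derivatives converge
  locally uniformly and the norm is differentiable in \<open>\<phi>\<close>.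

  Let \<open>\<Gamma>\<close> be the closed cone of deformations \<open>f\<close> that are nonnegative at all slopes.  If
  \<open>f (u + v) > f u, f v > 0\<close> on an edge, then \<open>f\<close> is positive beyond that edge, and this is an open
  condition.  By compactness of the circle of directions, an \<open>f \<in> \<Gamma>\<close> that vanishes at no slope and is
  not interior to \<open>\<Gamma>\<close> stays bounded along some irrational path; then it does not change the length of
  the corresponding lamination to first order.  Hence the lengthening cone is the interior of \<open>\<Gamma>\<close>.
  A determinant estimate shows that the elements of \<open>\<Gamma>\<close> bounded along a given irrational path are
  pairwise proportional, so the only segments in the boundary of \<open>\<Gamma>\<close> are those in which \<open>f\<close> vanishes
  at a slope \<open>X\<close>.  There the recursion gives \<open>f (V + n X) = P a\<^sup>n + R a\<^sup>-\<^sup>n\<close>, where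
  \<open>\<phi> X = a + 1 / a\<close>, and \<open>f \<in> \<Gamma>\<close> means \<open>P, R \<ge> 0\<close>: these are the sides.
\<close>

text \<open>Lengthening is tested on irrational laminations and along arbitrary deformation paths.
  Lengths of irrational laminations are limits, so differentiating them needs derivatives that
  converge uniformly near \<open>\<phi>\<close>. Therefore Markoff functions are parametrized by
  three real values (\<open>markoff_on\<close>), and deformations are derivatives of this
  parametrization (\<open>deform_on\<close>); the chain rule then handles every path.

  The norm is the support function of a convex set of functionals (\<open>dual_ball\<close>), so
  that sublinearity is free and only its values at primitive vectors need an argument, which uses
  \<open>K < 2\<close>.

  The uniform estimates hold only for deformations that increase in a controlled way
  (\<open>tame\<close>). Far out on a path there are three linearly independent ones, and all
  deformations are combinations of these with bounded coefficients (\<open>tame_entry\<close>,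
  \<open>uniform_Cauchy\<close>). The same three are the test functions in the determinant estimate:
  the absolute value of the determinant is constant along a path, while bounded deformations are
  small at its turning points.\<close>

declare split_paired_Ex [simp del] split_paired_All [simp del]

section \<open>Bases of the integer lattice\<close>

definition wedge :: "int \<times> int \<Rightarrow> int \<times> int \<Rightarrow> int" where
  "wedge u v = fst u * snd v - snd u * fst v"

definition scale :: "int \<Rightarrow> int \<times> int \<Rightarrow> int \<times> int" where
  "scale k u = (k * fst u, k * snd u)"

definition basis :: "int \<times> int \<Rightarrow> int \<times> int \<Rightarrow> bool" where
  "basis u v \<longleftrightarrow> \<bar>wedge u v\<bar> = 1"

definition prim :: "int \<times> int \<Rightarrow> bool" where
  "prim u \<longleftrightarrow> coprime (fst u) (snd u)"

lemma wedge_simps [simp]: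
  "wedge u u = 0" "wedge (u + v) w = wedge u w + wedge v w"
  "wedge w (u + v) = wedge w u + wedge w v"
  "wedge (u - v) w = wedge u w - wedge v w" "wedge w (u - v) = wedge w u - wedge w v"
  "wedge (- u) v = - wedge u v" "wedge u (- v) = - wedge u v"
  "wedge (scale k u) v = k * wedge u v" "wedge u (scale k v) = k * wedge u v"
  by (simp_all add: wedge_def scale_def algebra_simps)

lemma wedge_commute: "wedge u v = - wedge v u"
  by (simp add: wedge_def algebra_simps)

lemma scale_simps [simp]:
  "scale 0 u = 0" "scale 1 u = u" "scale (- k) u = - scale k u" "scale k (- u) = - scale k u"
  "scale k 0 = 0"
  by (simp_all add: scale_def prod_eq_iff)

lemma scale_add: "scale (j + k) u = scale j u + scale k u"
  by (simp add: scale_def algebra_simps)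

lemma scale_diff: "scale (j - k) u = scale j u - scale k u"
  by (simp add: scale_def algebra_simps)

lemma scale_add_right: "scale k (u + v) = scale k u + scale k v"
  by (simp add: scale_def algebra_simps)

lemma basis_commute: "basis u v \<longleftrightarrow> basis v u"
  by (simp add: basis_def wedge_commute[of u v])

lemma basis_simps [simp]:
  "basis (- u) v \<longleftrightarrow> basis u v" "basis u (- v) \<longleftrightarrow> basis u v"
  "basis u (u + v) \<longleftrightarrow> basis u v" "basis (u + v) v \<longleftrightarrow> basis u v"
  "basis u (v + u) \<longleftrightarrow> basis u v" "basis (v + u) v \<longleftrightarrow> basis u v"
  "basis u (v - u) \<longleftrightarrow> basis u v" "basis (u - v) v \<longleftrightarrow> basis u v"
  "basis u (v + scale k u) \<longleftrightarrow> basis u v"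
  "basis (1, 0) (0, 1)" "\<not> basis u u"
  by (simp_all add: basis_def) (simp_all add: wedge_def)

lemma basis_squared: "basis u v \<Longrightarrow> wedge u v * wedge u v = 1"
  by (simp add: basis_def abs_eq_iff') auto

lemma basis_prim: "basis u v \<Longrightarrow> prim u" "basis u v \<Longrightarrow> prim v"
proof -
  have *: "prim u" if "basis u v" for u v
    unfolding prim_def
  proof (rule coprimeI)
    fix c assume "c dvd fst u" "c dvd snd u"
    then have "c dvd wedge u v"
      by (simp add: wedge_def)
    then have "c dvd wedge u v * wedge u v"
      by simp
    then show "is_unit c"
      using basis_squared[OF that] by simp
  qed
  show "basis u v \<Longrightarrow> prim u" "basis u v \<Longrightarrow> prim v"
    using * basis_commute by blast+
qed

lemma prim_basis: assumes "prim u" obtains v where "basis u v"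
proof -
  obtain s t where "fst u * s + snd u * t = 1"
    using assms bezout_int[of "fst u" "snd u"] unfolding prim_def coprime_iff_gcd_eq_1
    by (metis mult.commute)
  then have "basis u (- t, s)"
    by (simp add: basis_def wedge_def algebra_simps)
  then show ?thesis
    using that by blast
qed

lemma prim_uminus [simp]: "prim (- u) \<longleftrightarrow> prim u"
  by (simp add: prim_def)

lemma prim_nonzero: "prim u \<Longrightarrow> u \<noteq> 0"
  by (auto simp: prim_def)

text \<open>Cramer's rule. The determinant \<open>wedge u v\<close> is \<open>1\<close> or
  \<open>- 1\<close>, hence its own inverse, so multiplying by it replaces division and keeps the
  coefficients integral.\<close>

lemma basis_expand:
  assumes "basis u v"
  shows "w = scale (wedge w v * wedge u v) u + scale (wedge u w * wedge u v) v"
proof -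
  have "fst w * (wedge u v * wedge u v) = fst (scale (wedge w v * wedge u v) u + scale (wedge u w * wedge u v) v)"
    "snd w * (wedge u v * wedge u v) = snd (scale (wedge w v * wedge u v) u + scale (wedge u w * wedge u v) v)"
    by (simp_all add: wedge_def scale_def algebra_simps)
  then show ?thesis
    by (simp add: basis_squared[OF assms] prod_eq_iff)
qed

lemma basis_combination:
  assumes "basis u v" obtains p q where "w = scale p u + scale q v"
  using basis_expand[OF assms] by blast

lemma prim_combination:
  assumes "basis u v" shows "prim (scale p u + scale q v) \<longleftrightarrow> coprime p q"
proof
  assume pr: "prim (scale p u + scale q v)"
  show "coprime p q"
  proof (rule coprimeI)
    fix c assume "c dvd p" "c dvd q"
    then have "c dvd fst (scale p u + scale q v)" "c dvd snd (scale p u + scale q v)"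
      by (auto simp: scale_def)
    then show "is_unit c"
      using pr unfolding prim_def by (meson coprime_common_divisor)
  qed
next
  assume co: "coprime p q"
  let ?w = "scale p u + scale q v"
  show "prim ?w"
    unfolding prim_def
  proof (rule coprimeI)
    fix c assume c: "c dvd fst ?w" "c dvd snd ?w"
    then have "c dvd wedge ?w v * wedge u v" "c dvd wedge u ?w * wedge u v"
      unfolding wedge_def[of ?w] wedge_def[of _ ?w] by (auto intro!: dvd_mult2 dvd_diff)
    moreover have "wedge ?w v * wedge u v = p" "wedge u ?w * wedge u v = q"
      using basis_squared[OF assms] by (simp_all add: mult.assoc)
    ultimately show "is_unit c"
      using co by (metis coprime_common_divisor)
  qed
qed

lemma basis_partner:
  assumes "basis u v" "basis u w"
  obtains n where "w = v + scale n u" | n where "w = - (v + scale n u)"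
proof -
  obtain p q where w: "w = scale p u + scale q v"
    using basis_combination[OF assms(1)] by blast
  have "\<bar>q\<bar> = 1"
    using assms by (simp add: w basis_def abs_mult)
  then consider "q = 1" | "q = - 1" by linarith
  then show ?thesis
  proof cases
    case 1 then show ?thesis using that(1)[of p] w by (simp add: add.commute)
  next
    case 2 then show ?thesis using that(2)[of "- p"] w by (simp add: add.commute)
  qed
qed

text \<open>Euclid's subtractive algorithm on \<open>(p, q)\<close>.\<close>

lemma cone_induct:
  fixes p q :: int
  assumes step: "\<And>u v. E u v \<Longrightarrow> E u (u + v) \<and> E (u + v) v"
    and "E U V" "coprime p q" "p \<ge> 1" "q \<ge> 1"
  obtains u v where "E u v" "scale p U + scale q V = u + v"
proof -
  have "\<exists>u v. E u v \<and> scale p U + scale q V = u + v"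
    using assms(2-)
  proof (induction "nat (p + q)" arbitrary: p q U V rule: less_induct)
    case less
    consider "p = q" | "p > q" | "p < q" by linarith
    then show ?case
    proof cases
      case 1
      then have "p = 1" "q = 1"
        using less.prems by auto
      then show ?thesis using less.prems by auto
    next
      case 2
      have "coprime (p - q) q"
        using less.prems(2) by (metis coprime_iff_gcd_eq_1 gcd_diff1)
      then have "\<exists>u v. E u v \<and> scale (p - q) U + scale q (U + V) = u + v"
        using less.hyps[of "p - q" q U "U + V"] less.prems 2 step by auto
      then show ?thesis
        by (simp add: scale_diff scale_add_right)
    next
      case 3
      have "coprime p (q - p)"
        using less.prems(2) by (metis coprime_commute coprime_iff_gcd_eq_1 gcd_diff1)
      then have "\<exists>u v. E u v \<and> scale p (U + V) + scale (q - p) V = u + v"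
        using less.hyps[of p "q - p" "U + V" V] less.prems 3 step by auto
      then show ?thesis
        by (simp add: scale_diff scale_add_right algebra_simps)
    qed
  qed
  then show ?thesis using that by blast
qed

text \<open>The edge between \<open>U\<close> and \<open>V\<close> cuts the Farey tree into the
  cones of \<open>(U, V)\<close> and \<open>(U, - V)\<close>. Every primitive vector other than
  \<open>U\<close> and \<open>V\<close> is, up to sign, the sum of an edge reached inside one of
  them. \<open>E\<close> is a property of edges that is inherited outward, \<open>Q\<close> a
  property of regions.\<close>

lemma tree_induct:
  assumes step: "\<And>u v. E u v \<Longrightarrow> E u (u + v) \<and> E (u + v) v"
    and B: "basis U V" "E U V" "E U (- V)"
    and Q: "Q U" "Q V" "\<And>w. Q w \<Longrightarrow> Q (- w)" "\<And>u v. E u v \<Longrightarrow> Q (u + v)"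
    and w: "prim w"
  shows "Q w"
proof -
  obtain p q where pq: "w = scale p U + scale q V"
    using basis_combination[OF B(1)] by blast
  have co: "coprime p q"
    using prim_combination[OF B(1)] w pq by simp
  have *: "Q (scale p U + scale q V)" if co: "coprime p q" and p0: "p \<ge> 0" for p q
  proof -
    consider "q = 0" | "p = 0" | "p \<ge> 1" "q \<ge> 1" | "p \<ge> 1" "q \<le> - 1"
      using p0 by linarith
    then show ?thesis
    proof cases
      case 1 then show ?thesis using that Q by auto
    next
      case 2
      then have "q = 1 \<or> q = - 1" using that by auto
      then show ?thesis using Q(2) Q(3)[OF Q(2)] 2 by (elim disjE) simp_all
    next
      case 3
      then obtain u v where "E u v" "scale p U + scale q V = u + v"
        using cone_induct[where E=E, OF step B(2) co] by blast
      then show ?thesis using Q(4) by simp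
    next
      case 4
      have "\<exists>u v. E u v \<and> scale p U + scale (- q) (- V) = u + v"
        by (rule cone_induct[where E=E and U=U and V="- V" and p=p and q="- q"], erule step,
            rule B(3), use co in simp, rule 4(1), use 4 in simp, blast)
      then obtain u v where "E u v" "scale p U + scale (- q) (- V) = u + v"
        by blast
      then show ?thesis using Q(4)[of u v] by simp
    qed
  qed
  show ?thesis
  proof (cases "p \<ge> 0")
    case True then show ?thesis using * co pq by simp
  next
    case False
    then have "Q (- (scale (- p) U + scale (- q) V))"
      using *[of "- p" "- q"] co Q(3)[of "scale (- p) U + scale (- q) V"] by simp
    moreover have "- (scale (- p) U + scale (- q) V) = w"
      unfolding pq by (simp add: scale_def prod_eq_iff)
    ultimately show ?thesis by simp
  qed
qed

text \<open>The variant that starts at all edges around the region \<open>U\<close> at once: the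
  neighbours of \<open>U\<close> are the vectors \<open>V + n U\<close>, and the rest of the tree
  grows from pairs of consecutive ones. It serves functions that vanish at \<open>U\<close>, for
  which growth can be checked on these edges.\<close>

lemma pivot_induct:
  assumes step: "\<And>u v. E u v \<Longrightarrow> E u (u + v) \<and> E (u + v) v"
    and B: "basis U V" "\<And>n. E (V + scale n U) (V + scale (n + 1) U)"
    and Q: "Q U" "\<And>n. Q (V + scale n U)" "\<And>w. Q w \<Longrightarrow> Q (- w)" "\<And>u v. E u v \<Longrightarrow> Q (u + v)"
    and w: "prim w"
  shows "Q w"
proof -
  obtain p q where pq: "w = scale p U + scale q V"
    using basis_combination[OF B(1)] by blast
  have co: "coprime p q"
    using prim_combination[OF B(1)] w pq by simp
  have *: "Q (scale p U + scale q V)" if co: "coprime p q" and q0: "q \<ge> 0" for p q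
  proof -
    consider "q = 0" | "q = 1" | "q \<ge> 2"
      using q0 by linarith
    then show ?thesis
    proof cases
      case 1
      then have "p = 1 \<or> p = - 1" using that by auto
      then show ?thesis using Q(1) Q(3)[OF Q(1)] 1 by (elim disjE) simp_all
    next
      case 2
      then show ?thesis using Q(2)[of p] by (simp add: add.commute)
    next
      case 3
      \<comment> \<open>Division with remainder puts the vector into the cone of two consecutive
        neighbours of \<open>U\<close>, with weights \<open>q - r\<close> and
        \<open>r\<close>.\<close>
      define n r where "n = p div q" and "r = p mod q"
      have p: "p = n * q + r" by (simp add: n_def r_def)
      have "r \<noteq> 0"
        using co 3 p by auto
      then have r: "1 \<le> r" "r < q"
        using 3 by (auto simp: r_def) (smt (verit) pos_mod_sign)
      have "coprime r q"
        using co by (metis coprime_iff_gcd_eq_1 gcd_red_int gcd.commute r_def)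
      then have "coprime (q - r) r"
        by (metis coprime_commute coprime_iff_gcd_eq_1 gcd_diff1)
      then obtain u v where uv: "E u v"
        "scale (q - r) (V + scale n U) + scale r (V + scale (n + 1) U) = u + v"
        using cone_induct[where E=E, OF step B(2)[of n], of "q - r" r] r by (smt (verit))
      have "scale p U + scale q V = scale (q - r) (V + scale n U) + scale r (V + scale (n + 1) U)"
        unfolding p by (simp add: scale_def algebra_simps)
      then show ?thesis using Q(4) uv by simp
    qed
  qed
  show ?thesis
  proof (cases "q \<ge> 0")
    case True then show ?thesis using * co pq by simp
  next
    case False
    then have "Q (- (scale (- p) U + scale (- q) V))"
      using *[of "- p" "- q"] co Q(3)[of "scale (- p) U + scale (- q) V"] by simp
    moreover have "- (scale (- p) U + scale (- q) V) = w"
      unfolding pq by (simp add: scale_def prod_eq_iff)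
    ultimately show ?thesis by simp
  qed
qed

text \<open>Swapping, changing a sign and adding one vector to the other generate
  \<open>GL(2, Z)\<close>, which acts transitively on bases. \<open>tree_induct\<close> supplies
  some partner of \<open>u\<close> with the property; the other partners differ from it by a
  multiple of \<open>u\<close> and a sign.\<close>

lemma basis_induct:
  assumes B: "basis U V" "P U V"
    and swap: "\<And>u v. basis u v \<Longrightarrow> P u v \<Longrightarrow> P v u"
    and neg: "\<And>u v. basis u v \<Longrightarrow> P u v \<Longrightarrow> P u (- v)"
    and add: "\<And>u v. basis u v \<Longrightarrow> P u v \<Longrightarrow> P u (u + v)"
    and b: "basis u v"
  shows "P u v"
proof -
  define Q where "Q x = (\<exists>y. basis x y \<and> P x y)" for x
  define E where "E x y = (basis x y \<and> P x y)" for x y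
  have add': "P (u + v) v" if "basis u v" "P u v" for u v
    using swap[of v "v + u"] add[of v u] swap[of u v] that by (simp add: basis_commute add.commute)
  have neg': "P (- u) v" if "basis u v" "P u v" for u v
    using swap[of v "- u"] neg[of v u] swap[of u v] that by (simp add: basis_commute)
  have "Q u"
  proof (rule tree_induct[of E])
    show "\<And>u v. E u v \<Longrightarrow> E u (u + v) \<and> E (u + v) v"
      unfolding E_def using add add' by auto
    show "basis U V" "E U V" "E U (- V)" "Q U" using B neg unfolding E_def Q_def by auto
    show "Q V" using B swap basis_commute unfolding Q_def by blast
    show "prim u" using basis_prim b by blast
    show "\<And>u v. E u v \<Longrightarrow> Q (u + v)" unfolding E_def Q_def
      using add' by (metis basis_simps(4))
    show "\<And>w. Q w \<Longrightarrow> Q (- w)"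
      unfolding Q_def using neg' by (metis basis_simps(1))
  qed
  then obtain y where y: "basis u y" "P u y"
    unfolding Q_def by blast
  have S: "P u (y + scale n u)" for n
  proof (induction n rule: int_induct[where k=0])
    case base then show ?case using y by simp
  next
    case (step1 i)
    then show ?case using add[of u "y + scale i u"] y by (simp add: scale_add algebra_simps)
  next
    case (step2 i)
    then have "P u (- (y + scale i u))" using neg[of u "y + scale i u"] y by simp
    then have "P u (u + - (y + scale i u))" using add[of u "- (y + scale i u)"] y by (metis basis_simps(2,9))
    then have "P u (- (u + - (y + scale i u)))"
      using neg[of u "u + - (y + scale i u)"] y by (metis basis_simps(2,3,9))
    then show ?case by (simp add: scale_diff algebra_simps)
  qed
  from y(1) b show ?thesis
  proof (cases rule: basis_partner)
    case (1 n) then show ?thesis using S by simp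
  next
    case (2 n) then show ?thesis using S neg[of u "y + scale n u"] y by simp
  qed
qed

section \<open>Slopes and primitive vectors\<close>

definition slope_of :: "int \<times> int \<Rightarrow> slope" where
  "slope_of w = (if snd w = 0 then None else Some (Fract (fst w) (snd w)))"

lemma slope_of_uminus [simp]: "slope_of (- w) = slope_of w"
  by (simp add: slope_of_def)

lemma reduced_form_slope_of:
  assumes "prim w" shows "reduced_form (slope_of w) = w \<or> reduced_form (slope_of w) = - w"
proof (cases w)
  case (Pair p q)
  have co: "coprime p q" using assms Pair by (simp add: prim_def)
  consider "q = 0" | "q > 0" | "q < 0" by linarith
  then show ?thesis
  proof cases
    case 1 then show ?thesis using co Pair by (auto simp: slope_of_def)
  next
    case 2 then show ?thesis using co Pair
      by (auto simp: slope_of_def quotient_of_Fract normalize_stable)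
  next
    case 3
    have "Fract p q = Fract (- p) (- q)" by simp
    then have "quotient_of (Fract p q) = (- p, - q)"
      using co 3 by (simp only: quotient_of_Fract) (subst normalize_stable; simp)
    then show ?thesis using Pair 3 by (auto simp: slope_of_def)
  qed
qed

lemma prim_reduced_form: "prim (reduced_form s)"
  by (cases s) (auto simp: prim_def quotient_of_coprime prod_eq_iff)

lemma slope_of_reduced_form [simp]: "slope_of (reduced_form s) = s"
proof (cases s)
  case (Some r)
  then show ?thesis using quotient_of_denom_pos'[of r] by (simp add: slope_of_def)
qed (simp add: slope_of_def)

lemma slope_of_eq_iff:
  assumes "prim u" "prim v" shows "slope_of u = slope_of v \<longleftrightarrow> u = v \<or> u = - v"
  using reduced_form_slope_of[OF assms(1)] reduced_form_slope_of[OF assms(2)]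
  by (metis minus_equation_iff slope_of_uminus)

lemma farey_neighbors_iff: "farey_neighbors s t \<longleftrightarrow> basis (reduced_form s) (reduced_form t)"
  by (simp add: farey_neighbors_def basis_def wedge_def split: prod.splits)

lemma farey_neighbors_slope_of:
  assumes "prim u" "prim v" shows "farey_neighbors (slope_of u) (slope_of v) \<longleftrightarrow> basis u v"
  using reduced_form_slope_of[OF assms(1)] reduced_form_slope_of[OF assms(2)]
  unfolding farey_neighbors_iff by (elim disjE) simp_all

text \<open>Two Farey neighbours \<open>u\<close>, \<open>v\<close> have exactly two common
  neighbours, \<open>u + v\<close> and \<open>u - v\<close> up to sign. A quadruple may list these
  in either order, which is absorbed by replacing \<open>v\<close> by \<open>- v\<close>.\<close>

lemma adjacent_but_ends_iff:
  "adjacent_but_ends R R' R'' R''' \<longleftrightarrow>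
    (\<exists>u v. basis u v \<and> R = slope_of (u + v) \<and> R' = slope_of u \<and> R'' = slope_of v \<and> R''' = slope_of (u - v))"
proof
  assume adj: "adjacent_but_ends R R' R'' R'''"
  define r u v t where "r = reduced_form R" "u = reduced_form R'" "v = reduced_form R''" "t = reduced_form R'''"
  have b: "basis r u" "basis r v" "basis u v" "basis u t" "basis v t"
    using adj unfolding adjacent_but_ends_def farey_neighbors_iff r_u_v_t_def by auto
  have R: "R = slope_of r" "R' = slope_of u" "R'' = slope_of v" "R''' = slope_of t"
    by (simp_all add: r_u_v_t_def)
  have *: "slope_of x = slope_of (u + v) \<or> slope_of x = slope_of (u - v)"
    if x: "basis u x" "basis v x" for x
  proof -
    have "x = u + v \<or> x = - (u + v) \<or> x = u - v \<or> x = - (u - v)"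
      using b(3) x(1)
    proof (cases rule: basis_partner)
      case (1 n)
      then have "\<bar>n\<bar> = 1" using x(2) b(3) by (simp add: basis_def abs_mult wedge_commute[of v u])
      then have "n = 1 \<or> n = - 1" by linarith
      then show ?thesis using 1 by auto
    next
      case (2 n)
      then have "\<bar>n\<bar> = 1" using x(2) b(3) by (simp add: basis_def abs_mult wedge_commute[of v u])
      then have "n = 1 \<or> n = - 1" by linarith
      then show ?thesis using 2 by auto
    qed
    then show ?thesis by (metis slope_of_uminus)
  qed
  have "R \<noteq> R'''" using adj by (simp add: adjacent_but_ends_def)
  moreover have "R = slope_of (u + v) \<or> R = slope_of (u - v)" "R''' = slope_of (u + v) \<or> R''' = slope_of (u - v)"
    using * b R basis_commute by blast+
  ultimately consider "R = slope_of (u + v)" "R''' = slope_of (u - v)" |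
    "R = slope_of (u - v)" "R''' = slope_of (u + v)" by auto
  then show "\<exists>u v. basis u v \<and> R = slope_of (u + v) \<and> R' = slope_of u \<and> R'' = slope_of v \<and> R''' = slope_of (u - v)"
  proof cases
    case 1 then show ?thesis using R b by blast
  next
    case 2
    then show ?thesis using R b
      by (intro exI[of _ u] exI[of _ "- v"]) auto
  qed
next
  assume "\<exists>u v. basis u v \<and> R = slope_of (u + v) \<and> R' = slope_of u \<and> R'' = slope_of v \<and> R''' = slope_of (u - v)"
  then obtain u v where b: "basis u v" and R: "R = slope_of (u + v)" "R' = slope_of u"
    "R'' = slope_of v" "R''' = slope_of (u - v)" by blast
  have p: "prim u" "prim v" "prim (u + v)" "prim (u - v)"
    using b basis_prim(1)[of "u + v" v] basis_prim(1)[of "u - v" v] basis_prim[of u v] by simp_all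
  have w: "\<bar>wedge u v\<bar> = 1" "wedge v u = - wedge u v"
    using b wedge_commute[of v u] by (simp_all add: basis_def)
  have nb: "\<not> basis (u + v) (u - v)" "basis (u + v) u" "basis (u + v) v" "basis u (u - v)" "basis v (u - v)"
    using w by (simp_all add: basis_def)
  have eq: "slope_of x \<noteq> slope_of y" if "prim x" "prim y" "wedge x y \<noteq> 0" for x y
    using that by (metis slope_of_eq_iff wedge_simps(1,6) minus_zero)
  have "distinct [R, R', R'', R''']"
    unfolding R using p w by (simp add: eq)
  then show "adjacent_but_ends R R' R'' R'''"
    unfolding adjacent_but_ends_def R using p nb b by (simp add: farey_neighbors_slope_of)
qed

section \<open>Markoff functions on primitive vectors\<close>

text \<open>Evenness lets the function descend to slopes. At non-primitive vectors nothing else is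
  required, so two such functions are compared at primitive vectors only.\<close>

definition markoff_fun :: "(int \<times> int \<Rightarrow> real) \<Rightarrow> bool" where
  "markoff_fun \<phi> \<longleftrightarrow> (\<forall>u. \<phi> (- u) = \<phi> u) \<and> (\<forall>u v. basis u v \<longrightarrow> \<phi> (u + v) + \<phi> (u - v) = \<phi> u * \<phi> v)"

definition deform_fun :: "(int \<times> int \<Rightarrow> real) \<Rightarrow> (int \<times> int \<Rightarrow> real) \<Rightarrow> bool" where
  "deform_fun \<phi> f \<longleftrightarrow> (\<forall>u. f (- u) = f u) \<and>
     (\<forall>u v. basis u v \<longrightarrow> f (u + v) + f (u - v) = f u * \<phi> v + \<phi> u * f v)"

lemma markoff_even [simp]: "markoff_fun \<phi> \<Longrightarrow> \<phi> (- u) = \<phi> u"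
  by (simp add: markoff_fun_def)

lemma markoff_add: "markoff_fun \<phi> \<Longrightarrow> basis u v \<Longrightarrow> \<phi> (u + v) = \<phi> u * \<phi> v - \<phi> (u - v)"
  unfolding markoff_fun_def by (metis add_diff_cancel_right')

lemma deform_even [simp]: "deform_fun \<phi> f \<Longrightarrow> f (- u) = f u"
  by (simp add: deform_fun_def)

lemma deform_add: "deform_fun \<phi> f \<Longrightarrow> basis u v \<Longrightarrow> f (u + v) = f u * \<phi> v + \<phi> u * f v - f (u - v)"
  unfolding deform_fun_def by (metis add_diff_cancel_right')

lemma even_diff_commute: fixes \<phi> :: "int \<times> int \<Rightarrow> real"
  assumes "\<And>u. \<phi> (- u) = \<phi> u" shows "\<phi> (v - u) = \<phi> (u - v)"
  using assms[of "u - v"] by simp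

lemma markoff_map_iff: "markoff_map \<Phi> \<longleftrightarrow> markoff_fun (\<lambda>w. \<Phi> (slope_of w))"
  unfolding markoff_map_def markoff_fun_def adjacent_but_ends_iff slope_of_uminus
  by (rule iffI, (intro conjI allI impI refl, fast)) (elim conjE, intro allI impI, elim exE conjE, simp)

lemma infinitesimal_deformation_iff:
  "infinitesimal_deformation \<Phi> \<Phi>' \<longleftrightarrow> deform_fun (\<lambda>w. \<Phi> (slope_of w)) (\<lambda>w. \<Phi>' (slope_of w))"
  unfolding infinitesimal_deformation_def deform_fun_def adjacent_but_ends_iff slope_of_uminus
  by (rule iffI, (intro conjI allI impI refl, fast)) (elim conjE, intro allI impI, elim exE conjE, simp)

lemma deform_unique:
  assumes f: "deform_fun \<phi> f" and g: "deform_fun \<phi> g" and b: "basis U V"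
    and eq: "f U = g U" "f V = g V" "f (U - V) = g (U - V)" and w: "prim w"
  shows "f w = g w"
proof -
  define E where "E u v = (basis u v \<and> f u = g u \<and> f v = g v \<and> f (u - v) = g (u - v))" for u v
  have add: "f (u + v) = g (u + v)" if "E u v" for u v
    using that deform_add[OF f, of u v] deform_add[OF g, of u v] unfolding E_def by simp
  show ?thesis
  proof (rule tree_induct[of E, OF _ b _ _ _ _ _ _ w])
    show "E u (u + v) \<and> E (u + v) v" if "E u v" for u v
      using that add[OF that] deform_even[OF f, of v] deform_even[OF g, of v] unfolding E_def by simp
    show "E U V" using b eq by (simp add: E_def)
    then show "E U (- V)" using add[of U V] f g by (simp add: E_def)
    show "f (- w) = g (- w)" if "f w = g w" for w using that f g by simp
  qed (use eq add in auto)
qed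

lemma markoff_unique:
  assumes f: "markoff_fun f" and g: "markoff_fun g" and b: "basis U V"
    and eq: "f U = g U" "f V = g V" "f (U - V) = g (U - V)" and w: "prim w"
  shows "f w = g w"
proof -
  define E where "E u v = (basis u v \<and> f u = g u \<and> f v = g v \<and> f (u - v) = g (u - v))" for u v
  have add: "f (u + v) = g (u + v)" if "E u v" for u v
    using that markoff_add[OF f, of u v] markoff_add[OF g, of u v] unfolding E_def by simp
  show ?thesis
  proof (rule tree_induct[of E, OF _ b _ _ _ _ _ _ w])
    show "E u (u + v) \<and> E (u + v) v" if "E u v" for u v
      using that add[OF that] markoff_even[OF f, of v] markoff_even[OF g, of v] unfolding E_def by simp
    show "E U V" using b eq by (simp add: E_def)
    then show "E U (- V)" using add[of U V] f g by (simp add: E_def)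
    show "f (- w) = g (- w)" if "f w = g w" for w using that f g by simp
  qed (use eq add in auto)
qed

lemma deform_combination:
  assumes "deform_fun \<phi> f" "deform_fun \<phi> g"
  shows "deform_fun \<phi> (\<lambda>w. a * f w + b * g w)"
  unfolding deform_fun_def
proof (intro conjI allI impI)
  fix u v :: "int \<times> int" assume b: "basis u v"
  show "a * f (u + v) + b * g (u + v) + (a * f (u - v) + b * g (u - v)) =
      (a * f u + b * g u) * \<phi> v + \<phi> u * (a * f v + b * g v)"
    unfolding deform_add[OF assms(1) b] deform_add[OF assms(2) b] by (simp add: algebra_simps)
qed (use assms in simp)

section \<open>The Markoff function with given values on a triple\<close>

text \<open>Euclid's subtractive algorithm on \<open>(p, q)\<close>: \<open>x\<close>,
  \<open>y\<close>, \<open>z\<close> are the values at the current basis \<open>u\<close>,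
  \<open>v\<close> and at \<open>u - v\<close>, so \<open>x * y - z\<close> is the value at
  \<open>u + v\<close>. Only finitely many ring operations are performed, which makes the result
  differentiable in the initial triple.\<close>

function markoff_rec :: "real \<Rightarrow> real \<Rightarrow> real \<Rightarrow> nat \<Rightarrow> nat \<Rightarrow> real" where
  "markoff_rec x y z p q =
    (if q = 0 then x else if p = 0 then y
     else if q \<le> p then markoff_rec x (x * y - z) y (p - q) q
     else markoff_rec (x * y - z) y x p (q - p))"
  by pat_completeness auto
termination by (relation "Wellfounded.measure (\<lambda>(x, y, z, p, q). p + q)") simp_all

declare markoff_rec.simps [simp del]

text \<open>Coordinates of opposite signs belong to the cone of \<open>u\<close> and
  \<open>- v\<close>; there the difference is \<open>u + v\<close>, whose value
  \<open>x * y - z\<close> replaces \<open>z\<close>.\<close>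

definition markoff_std :: "real \<times> real \<times> real \<Rightarrow> int \<times> int \<Rightarrow> real" where
  "markoff_std \<tau> w = (case \<tau> of (x, y, z) \<Rightarrow>
     markoff_rec x y (if fst w * snd w \<ge> 0 then z else x * y - z) (nat \<bar>fst w\<bar>) (nat \<bar>snd w\<bar>))"

lemma markoff_rec_0 [simp]: "markoff_rec x y z p 0 = x"
  by (subst markoff_rec.simps) simp

lemma markoff_rec_0' [simp]: "q > 0 \<Longrightarrow> markoff_rec x y z 0 q = y"
  by (subst markoff_rec.simps) simp

lemma markoff_rec_ge: "p > 0 \<Longrightarrow> q \<le> p \<Longrightarrow> markoff_rec x y z p q = markoff_rec x (x * y - z) y (p - q) q"
  by (subst markoff_rec.simps) simp

lemma markoff_rec_less: "p < q \<Longrightarrow> markoff_rec x y z p q = markoff_rec (x * y - z) y x p (q - p)"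
  by (subst markoff_rec.simps) simp

text \<open>The recursion resolves the tie \<open>p = q\<close> in favour of its first branch. For
  coprime arguments a tie means \<open>p = q = 1\<close>, where both orders return
  \<open>x * y - z\<close>.\<close>

lemma markoff_rec_swap: "coprime p q \<Longrightarrow> markoff_rec x y z p q = markoff_rec y x z q p"
proof (induction "p + q" arbitrary: x y z p q rule: less_induct)
  case less
  consider "q = 0" | "p = 0" | "p = q" "p > 0" | "q < p" "q > 0" | "p < q" "p > 0" by linarith
  then show ?case
  proof cases
    case 3
    then have "p = 1" using less.prems by simp
    then show ?thesis using 3 by (simp add: markoff_rec_ge mult.commute)
  next
    case 4
    have "coprime (p - q) q" using less.prems 4 by (metis coprime_commute coprime_iff_gcd_eq_1 gcd_diff1_nat less_imp_le)
    then show ?thesis using less.hyps[of "p - q" q] 4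
      by (simp add: markoff_rec_ge markoff_rec_less mult.commute)
  next
    case 5
    have "coprime p (q - p)" using less.prems 5 by (metis coprime_commute coprime_iff_gcd_eq_1 gcd_diff1_nat less_imp_le)
    then show ?thesis using less.hyps[of p "q - p"] 5
      by (simp add: markoff_rec_ge markoff_rec_less mult.commute)
  qed (use less.prems in auto)
qed

lemma markoff_std_uminus: "markoff_std \<tau> (- w) = markoff_std \<tau> w"
  by (simp add: markoff_std_def)

lemma markoff_std_base [simp]:
  "markoff_std (x, y, z) (1, 0) = x" "markoff_std (x, y, z) (0, 1) = y"
  "markoff_std (x, y, z) (1, 1) = x * y - z" "markoff_std (x, y, z) (1, - 1) = z"
  by (simp_all add: markoff_std_def markoff_rec_ge)

lemma markoff_std_swap:
  "coprime p q \<Longrightarrow> markoff_std (x, y, z) (q, p) = markoff_std (y, x, z) (p, q)"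
  unfolding markoff_std_def
  by (simp add: markoff_rec_swap[of "nat \<bar>p\<bar>"] mult.commute coprime_nat_abs_left_iff)

lemma markoff_std_reflect:
  assumes "coprime p q" shows "markoff_std (x, y, z) (p, - q) = markoff_std (x, y, x * y - z) (p, q)"
proof (cases "p * q = 0")
  case True
  then consider "q = 0" "\<bar>p\<bar> = 1" | "p = 0" "\<bar>q\<bar> = 1" using assms by auto
  then show ?thesis by cases (simp_all add: markoff_std_def)
next
  case False
  then show ?thesis by (auto simp: markoff_std_def)
qed

text \<open>Both sides compute the value at one vector, in the bases \<open>(u, v)\<close> and
  \<open>(u, u + v)\<close>. Since \<open>markoff_std\<close> branches on signs, the cases depend on
  the signs of \<open>p\<close> and \<open>p + q\<close>; in the mixed case the two computations
  meet with their arguments interchanged.\<close>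

lemma markoff_std_shift:
  assumes co: "coprime p q"
  shows "markoff_std (x, y, z) (p + q, q) = markoff_std (x, x * y - z, y) (p, q)"
proof -
  have *: "markoff_std (x, y, z) (p + q, q) = markoff_std (x, x * y - z, y) (p, q)"
    if co: "coprime p q" and q: "q > 0" for p q
  proof -
    consider "p \<ge> 0" | "p < 0" "p + q \<ge> 0" | "p + q < 0" by linarith
    then show ?thesis
    proof cases
      case 1
      have "nat (p + q) = nat p + nat q" using 1 q by (simp add: nat_add_distrib)
      then show ?thesis using 1 q
        by (simp add: markoff_std_def markoff_rec_ge)
    next
      case 2
      have co': "coprime (nat (- p)) (nat (p + q))"
      proof -
        have "coprime (- p) (p + q)" using co by (metis add.commute coprime_iff_gcd_eq_1 coprime_minus_left_iff gcd_add2)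
        then show ?thesis using 2 by (simp add: coprime_int_iff[symmetric])
      qed
      have n: "nat q = nat (p + q) + nat (- p)" "nat (p + q) < nat q" "nat (- p) \<le> nat q" "nat q > 0"
        using 2 q by auto
      have m: "\<bar>p\<bar> = - p" "\<bar>p + q\<bar> = p + q" "\<bar>q\<bar> = q" "0 \<le> (p + q) * q" "\<not> 0 \<le> p * q"
        using 2 q by (auto simp: not_le mult_neg_pos)
      have "markoff_std (x, y, z) (p + q, q) = markoff_rec (x * y - z) y x (nat (p + q)) (nat (- p))"
        unfolding markoff_std_def using m n by (simp add: markoff_rec_less)
      moreover have "markoff_std (x, x * y - z, y) (p, q)
          = markoff_rec x (x * y - z) (x * (x * y - z) - y) (nat (- p)) (nat q)"
        unfolding markoff_std_def using m by simp
      moreover have "\<dots> = markoff_rec y (x * y - z) x (nat (- p)) (nat (p + q))"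
      proof (cases "p + q = 0")
        case True
        then have "q = 1" "p = - 1" using co q by (auto simp: add_eq_0_iff)
        then have "nat q = 1" "nat (- p) = 1" by simp_all
        then show ?thesis using True by (simp add: markoff_rec_ge)
      next
        case False
        then have "nat (- p) < nat q" using 2 by auto
        then show ?thesis using n by (simp add: markoff_rec_less)
      qed
      ultimately show ?thesis using markoff_rec_swap[OF co', of y "x * y - z" x] by simp
    next
      case 3
      have m: "\<bar>p\<bar> = - p" "\<bar>p + q\<bar> = - (p + q)" "\<bar>q\<bar> = q" "\<not> 0 \<le> (p + q) * q" "\<not> 0 \<le> p * q"
        using 3 q by (auto simp: not_le mult_neg_pos)
      have n: "nat (- p) = nat (- (p + q)) + nat q"
        using 3 q by auto
      have "markoff_std (x, x * y - z, y) (p, q)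
          = markoff_rec x (x * y - z) (x * (x * y - z) - y) (nat (- (p + q)) + nat q) (nat q)"
        unfolding markoff_std_def using m n by simp
      also have "\<dots> = markoff_rec x y (x * y - z) (nat (- (p + q))) (nat q)"
        using q by (simp add: markoff_rec_ge)
      also have "\<dots> = markoff_std (x, y, z) (p + q, q)"
        unfolding markoff_std_def using m by simp
      finally show ?thesis by simp
    qed
  qed
  consider "q > 0" | "q = 0" | "q < 0" by linarith
  then show ?thesis
  proof cases
    case 1 then show ?thesis using * co by simp
  next
    case 2 then show ?thesis by (simp add: markoff_std_def)
  next
    case 3
    then have "markoff_std (x, y, z) (- p + - q, - q) = markoff_std (x, x * y - z, y) (- p, - q)"
      using *[of "- p" "- q"] co by simp
    then show ?thesis
      using markoff_std_uminus[of "(x, y, z)" "(p + q, q)"] markoff_std_uminus[of "(x, x * y - z, y)" "(p, q)"]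
      by simp
  qed
qed

text \<open>Swap, reflection and shift show that \<open>markoff_std\<close> read in any basis is
  again a \<open>markoff_std\<close>, for another triple. This reduces the Markoff relation for an
  arbitrary basis to the standard one.\<close>

lemma markoff_std_basis:
  assumes "basis u v"
  shows "\<exists>\<tau>'. \<forall>p q. coprime p q \<longrightarrow> markoff_std \<tau> (scale p u + scale q v) = markoff_std \<tau>' (p, q)"
  using _ _ _ _ _ assms
proof (rule basis_induct[where U="(1, 0)" and V="(0, 1)"])
  show "basis (1, 0) (0, 1)" by simp
  show "\<exists>\<tau>'. \<forall>p q. coprime p q \<longrightarrow> markoff_std \<tau> (scale p (1, 0) + scale q (0, 1)) = markoff_std \<tau>' (p, q)"
    by (auto simp: scale_def)
  show "\<exists>\<tau>'. \<forall>p q. coprime p q \<longrightarrow> markoff_std \<tau> (scale p v + scale q u) = markoff_std \<tau>' (p, q)"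
    if "\<exists>\<tau>'. \<forall>p q. coprime p q \<longrightarrow> markoff_std \<tau> (scale p u + scale q v) = markoff_std \<tau>' (p, q)" for u v
  proof -
    from that obtain x y z where *: "coprime p q \<Longrightarrow> markoff_std \<tau> (scale p u + scale q v) = markoff_std (x, y, z) (p, q)" for p q
      by (metis prod_cases3)
    have "markoff_std \<tau> (scale p v + scale q u) = markoff_std (y, x, z) (p, q)" if "coprime p q" for p q
      using *[of q p] that by (simp add: coprime_commute add.commute markoff_std_swap)
    then show ?thesis by blast
  qed
  show "\<exists>\<tau>'. \<forall>p q. coprime p q \<longrightarrow> markoff_std \<tau> (scale p u + scale q (- v)) = markoff_std \<tau>' (p, q)"
    if "\<exists>\<tau>'. \<forall>p q. coprime p q \<longrightarrow> markoff_std \<tau> (scale p u + scale q v) = markoff_std \<tau>' (p, q)" for u v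
  proof -
    from that obtain x y z where *: "coprime p q \<Longrightarrow> markoff_std \<tau> (scale p u + scale q v) = markoff_std (x, y, z) (p, q)" for p q
      by (metis prod_cases3)
    have "markoff_std \<tau> (scale p u + scale q (- v)) = markoff_std (x, y, x * y - z) (p, q)" if "coprime p q" for p q
      using *[of p "- q"] that by (simp add: markoff_std_reflect)
    then show ?thesis by blast
  qed
  show "\<exists>\<tau>'. \<forall>p q. coprime p q \<longrightarrow> markoff_std \<tau> (scale p u + scale q (u + v)) = markoff_std \<tau>' (p, q)"
    if "\<exists>\<tau>'. \<forall>p q. coprime p q \<longrightarrow> markoff_std \<tau> (scale p u + scale q v) = markoff_std \<tau>' (p, q)" for u v
  proof -
    from that obtain x y z where *: "coprime p q \<Longrightarrow> markoff_std \<tau> (scale p u + scale q v) = markoff_std (x, y, z) (p, q)" for p q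
      by (metis prod_cases3)
    have "markoff_std \<tau> (scale p u + scale q (u + v)) = markoff_std (x, x * y - z, y) (p, q)" if "coprime p q" for p q
    proof -
      have "coprime (p + q) q" using that by (metis coprime_iff_gcd_eq_1 gcd_add1)
      then have "markoff_std \<tau> (scale (p + q) u + scale q v) = markoff_std (x, y, z) (p + q, q)" using * by blast
      moreover have "scale (p + q) u + scale q v = scale p u + scale q (u + v)"
        by (simp add: scale_def algebra_simps)
      ultimately show ?thesis using markoff_std_shift that by simp
    qed
    then show ?thesis by blast
  qed
qed

lemma markoff_std_markoff: "markoff_fun (markoff_std \<tau>)"
  unfolding markoff_fun_def
proof (intro conjI allI impI)
  fix u v :: "int \<times> int" assume "basis u v"
  then obtain x y z where *: "coprime p q \<Longrightarrow> markoff_std \<tau> (scale p u + scale q v) = markoff_std (x, y, z) (p, q)" for p q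
    using markoff_std_basis[of u v \<tau>] by (metis prod_cases3)
  show "markoff_std \<tau> (u + v) + markoff_std \<tau> (u - v) = markoff_std \<tau> u * markoff_std \<tau> v"
    using *[of 1 1] *[of 1 "- 1"] *[of 1 0] *[of 0 1] by simp
qed (rule markoff_std_uminus)

text \<open>For a basis \<open>U\<close>, \<open>V\<close> this is the Markoff function with values
  \<open>\<tau>\<close> at \<open>U\<close>, \<open>V\<close>, \<open>U - V\<close>:
  \<open>markoff_std\<close> in the coordinates given by Cramer's rule.\<close>

definition markoff_on :: "int \<times> int \<Rightarrow> int \<times> int \<Rightarrow> real \<times> real \<times> real \<Rightarrow> int \<times> int \<Rightarrow> real" where
  "markoff_on U V \<tau> w = markoff_std \<tau> (wedge w V * wedge U V, wedge U w * wedge U V)"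

lemma markoff_on_markoff:
  assumes b: "basis U V" shows "markoff_fun (markoff_on U V \<tau>)"
  unfolding markoff_fun_def
proof (intro conjI allI impI)
  let ?c = "\<lambda>w. (wedge w V * wedge U V, wedge U w * wedge U V)"
  fix u v
  show "markoff_on U V \<tau> (- u) = markoff_on U V \<tau> u"
    using markoff_std_uminus[of \<tau> "?c u"] by (simp add: markoff_on_def)
  assume uv: "basis u v"
  have "wedge u v = wedge (?c u) (?c v) * wedge U V"
  proof -
    have "wedge u v = wedge (scale (fst (?c u)) U + scale (snd (?c u)) V) (scale (fst (?c v)) U + scale (snd (?c v)) V)"
      using basis_expand[OF b, of u] basis_expand[OF b, of v] by simp
    also have "\<dots> = wedge (?c u) (?c v) * wedge U V"
      by (simp only: wedge_simps wedge_commute[of V U]) (simp add: wedge_def algebra_simps)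
    finally show ?thesis .
  qed
  then have "basis (?c u) (?c v)"
    using uv b by (simp add: basis_def abs_mult)
  moreover have "?c (u + v) = ?c u + ?c v" "?c (u - v) = ?c u - ?c v"
    by (simp_all add: algebra_simps)
  ultimately show "markoff_on U V \<tau> (u + v) + markoff_on U V \<tau> (u - v) = markoff_on U V \<tau> u * markoff_on U V \<tau> v"
    using markoff_std_markoff[of \<tau>] unfolding markoff_fun_def markoff_on_def by metis
qed

lemma markoff_on_base:
  assumes "basis U V"
  shows "markoff_on U V (x, y, z) U = x" "markoff_on U V (x, y, z) V = y" "markoff_on U V (x, y, z) (U - V) = z"
  using basis_squared[OF assms] by (simp_all add: markoff_on_def)

lemma markoff_eq_on:
  assumes "markoff_fun \<phi>" "basis U V" "prim w"
  shows "\<phi> w = markoff_on U V (\<phi> U, \<phi> V, \<phi> (U - V)) w"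
  by (rule markoff_unique[OF assms(1) markoff_on_markoff[OF assms(2)] assms(2) _ _ _ assms(3)])
    (simp_all add: markoff_on_base[OF assms(2)])

section \<open>Dependence on the initial triple, and deformations as derivatives\<close>

lemma markoff_rec_differentiable:
  fixes x y z :: "'a::real_normed_vector \<Rightarrow> real"
  assumes "x differentiable at t" "y differentiable at t" "z differentiable at t"
  shows "(\<lambda>t. markoff_rec (x t) (y t) (z t) p q) differentiable at t"
  using assms
proof (induction "p + q" arbitrary: x y z p q rule: less_induct)
  case less
  note d = less.prems
  have d': "(\<lambda>t. x t * y t - z t) differentiable at t" using d by simp
  consider "q = 0" | "p = 0" "q > 0" | "q \<le> p" "q > 0" | "p < q" "p > 0" by linarith
  then show ?case
  proof cases
    case 3
    then have "(\<lambda>t. markoff_rec (x t) (x t * y t - z t) (y t) (p - q) q) differentiable at t"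
      using less.hyps[of "p - q" q x "\<lambda>t. x t * y t - z t" y] d d' by simp
    then show ?thesis using 3 by (simp add: markoff_rec_ge)
  next
    case 4
    then have "(\<lambda>t. markoff_rec (x t * y t - z t) (y t) (x t) p (q - p)) differentiable at t"
      using less.hyps[of p "q - p" "\<lambda>t. x t * y t - z t" y x] d d' by simp
    then show ?thesis using 4 by (simp add: markoff_rec_less)
  qed (use d in auto)
qed

lemma markoff_on_differentiable: "(\<lambda>\<tau>. markoff_on U V \<tau> w) differentiable at \<tau>"
proof -
  have "(\<lambda>\<tau>. fst \<tau>) differentiable at \<tau>" "(\<lambda>\<tau>. fst (snd \<tau>)) differentiable at \<tau>"
    "(\<lambda>\<tau>. snd (snd \<tau>)) differentiable at \<tau>" for \<tau> :: "real \<times> real \<times> real"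
    by (rule bounded_linear_imp_differentiable,
        simp add: bounded_linear_fst bounded_linear_fst_comp bounded_linear_snd_comp bounded_linear_snd)+
  then have "(\<lambda>\<tau>. markoff_rec (fst \<tau>) (fst (snd \<tau>)) (if s then snd (snd \<tau>) else fst \<tau> * fst (snd \<tau>) - snd (snd \<tau>)) p q)
      differentiable at \<tau>" for s p q
    by (intro markoff_rec_differentiable) (cases s; simp)+
  then show ?thesis
    unfolding markoff_on_def markoff_std_def by (simp add: case_prod_beta)
qed

text \<open>Taking the Frechet derivative of the parametrization as the definition gives linearity
  in \<open>h\<close> at once, and the linearized relation by differentiating the Markoff
  relation.\<close>

definition deform_on :: "int \<times> int \<Rightarrow> int \<times> int \<Rightarrow> real \<times> real \<times> real \<Rightarrow> real \<times> real \<times> real \<Rightarrow> int \<times> int \<Rightarrow> real" where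
  "deform_on U V \<tau> h w = frechet_derivative (\<lambda>\<tau>. markoff_on U V \<tau> w) (at \<tau>) h"

lemma markoff_on_has_derivative:
  "((\<lambda>\<tau>. markoff_on U V \<tau> w) has_derivative (\<lambda>h. deform_on U V \<tau> h w)) (at \<tau>)"
  unfolding deform_on_def using markoff_on_differentiable[of U V w \<tau>] by (simp add: frechet_derivative_works)

lemma deform_on_linear: "linear (\<lambda>h. deform_on U V \<tau> h w)"
  using has_derivative_linear[OF markoff_on_has_derivative] .

lemma deform_on_deform:
  assumes b: "basis U V" shows "deform_fun (markoff_on U V \<tau>) (deform_on U V \<tau> h)"
  unfolding deform_fun_def
proof (intro conjI allI impI)
  note m = markoff_on_markoff[OF b]
  fix u v
  show "deform_on U V \<tau> h (- u) = deform_on U V \<tau> h u"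
    using markoff_even[OF m] unfolding deform_on_def by simp
  assume uv: "basis u v"
  have 1: "((\<lambda>\<tau>. markoff_on U V \<tau> (u + v) + markoff_on U V \<tau> (u - v)) has_derivative
      (\<lambda>h. deform_on U V \<tau> h (u + v) + deform_on U V \<tau> h (u - v))) (at \<tau>)"
    by (intro has_derivative_add markoff_on_has_derivative)
  have 2: "((\<lambda>\<tau>. markoff_on U V \<tau> u * markoff_on U V \<tau> v) has_derivative
      (\<lambda>h. markoff_on U V \<tau> u * deform_on U V \<tau> h v + deform_on U V \<tau> h u * markoff_on U V \<tau> v)) (at \<tau>)"
    by (intro has_derivative_mult markoff_on_has_derivative)
  have eq: "(\<lambda>\<tau>. markoff_on U V \<tau> (u + v) + markoff_on U V \<tau> (u - v)) = (\<lambda>\<tau>. markoff_on U V \<tau> u * markoff_on U V \<tau> v)"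
    using m uv unfolding markoff_fun_def by auto
  show "deform_on U V \<tau> h (u + v) + deform_on U V \<tau> h (u - v)
      = deform_on U V \<tau> h u * markoff_on U V \<tau> v + markoff_on U V \<tau> u * deform_on U V \<tau> h v"
    using has_derivative_unique[OF 1[unfolded eq] 2] by (simp add: fun_eq_iff add.commute)
qed

lemma deform_on_base:
  assumes b: "basis U V"
  shows "deform_on U V \<tau> (h, k, l) U = h" "deform_on U V \<tau> (h, k, l) V = k" "deform_on U V \<tau> (h, k, l) (U - V) = l"
proof -
  have base: "(\<lambda>\<tau>. markoff_on U V \<tau> U) = fst" "(\<lambda>\<tau>. markoff_on U V \<tau> V) = (\<lambda>\<tau>. fst (snd \<tau>))"
    "(\<lambda>\<tau>. markoff_on U V \<tau> (U - V)) = (\<lambda>\<tau>. snd (snd \<tau>))"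
    using markoff_on_base[OF b] by (auto simp: fun_eq_iff)
  have "(\<lambda>h. deform_on U V \<tau> h U) = fst"
    by (rule has_derivative_unique[OF markoff_on_has_derivative])
      (simp add: base bounded_linear_imp_has_derivative bounded_linear_fst)
  moreover have "(\<lambda>h. deform_on U V \<tau> h V) = (\<lambda>\<tau>. fst (snd \<tau>))"
    by (rule has_derivative_unique[OF markoff_on_has_derivative])
      (simp add: base bounded_linear_imp_has_derivative bounded_linear_fst_comp bounded_linear_snd)
  moreover have "(\<lambda>h. deform_on U V \<tau> h (U - V)) = (\<lambda>\<tau>. snd (snd \<tau>))"
    by (rule has_derivative_unique[OF markoff_on_has_derivative])
      (simp add: base bounded_linear_imp_has_derivative bounded_linear_snd_comp bounded_linear_snd)
  ultimately show "deform_on U V \<tau> (h, k, l) U = h" "deform_on U V \<tau> (h, k, l) V = k" "deform_on U V \<tau> (h, k, l) (U - V) = l"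
    by (simp_all add: fun_eq_iff)
qed

lemma deform_eq_on:
  assumes "deform_fun \<phi> f" "markoff_fun \<phi>" "basis U V" "prim w"
  shows "f w = deform_on U V (\<phi> U, \<phi> V, \<phi> (U - V)) (f U, f V, f (U - V)) w"
proof -
  let ?\<psi> = "markoff_on U V (\<phi> U, \<phi> V, \<phi> (U - V))"
  have "deform_fun ?\<psi> f"
    unfolding deform_fun_def
  proof (intro conjI allI impI)
    fix u v :: "int \<times> int" assume b: "basis u v"
    show "f (u + v) + f (u - v) = f u * ?\<psi> v + ?\<psi> u * f v"
      unfolding markoff_eq_on[OF assms(2,3) basis_prim(1)[OF b], symmetric]
        markoff_eq_on[OF assms(2,3) basis_prim(2)[OF b], symmetric]
      using deform_add[OF assms(1) b] by simp
  qed (use assms in simp)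
  then show ?thesis
    by (rule deform_unique[OF _ deform_on_deform[OF assms(3)] assms(3) _ _ _ assms(4)])
      (simp_all add: deform_on_base[OF assms(3)])
qed

section \<open>Geometric Markoff functions\<close>

text \<open>Fricke's formula for the trace of the commutator of two elements of \<open>SL(2)\<close>
  with traces \<open>\<phi> u\<close>, \<open>\<phi> v\<close> and product of trace
  \<open>\<phi> (u - v)\<close>. For Markoff functions it is the same on all edges.\<close>

definition kappa :: "(int \<times> int \<Rightarrow> real) \<Rightarrow> int \<times> int \<Rightarrow> int \<times> int \<Rightarrow> real" where
  "kappa \<phi> u v = (\<phi> u)\<^sup>2 + (\<phi> v)\<^sup>2 + (\<phi> (u - v))\<^sup>2 - \<phi> u * \<phi> v * \<phi> (u - v) - 2"

lemma kappa_eq: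
  assumes m: "markoff_fun \<phi>" and b: "basis U V" "basis u v"
  shows "kappa \<phi> u v = kappa \<phi> U V"
  using b(1) _ _ _ _ b(2)
proof (rule basis_induct[where U=U and V=V])
  fix u v assume b: "basis u v" and eq: "kappa \<phi> u v = kappa \<phi> U V"
  show "kappa \<phi> v u = kappa \<phi> U V"
    using eq even_diff_commute[of \<phi> v u] m by (simp add: kappa_def mult.commute)
  show "kappa \<phi> u (- v) = kappa \<phi> U V" "kappa \<phi> u (u + v) = kappa \<phi> U V"
    using eq m by (simp_all add: kappa_def markoff_add[OF m b] power2_eq_square algebra_simps)
qed simp

definition geometric :: "(int \<times> int \<Rightarrow> real) \<Rightarrow> bool" where
  "geometric \<phi> \<longleftrightarrow> markoff_fun \<phi> \<and> (\<forall>w. prim w \<longrightarrow> \<phi> w > 2) \<and> (\<forall>u v. basis u v \<longrightarrow> kappa \<phi> u v < 2)"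

text \<open>The new value \<open>n\<close> is the other root of the quadratic equation for the third
  value, so the left side of \<open>K\<close> does not change. If \<open>n \<le> 2\<close>, the sum
  of squares minus the product is \<open>4\<close> plus nonnegative terms, against
  \<open>K\<close>.\<close>

lemma markoff_greater_2:
  fixes x y z :: real
  assumes "x > 2" "y > 2" "z > 2" and K: "x\<^sup>2 + y\<^sup>2 + z\<^sup>2 - x * y * z - 2 < 2"
  shows "x * y - z > 2"
proof (rule ccontr)
  define n where "n = x * y - z"
  assume "\<not> x * y - z > 2"
  then have n: "n \<le> 2" by (simp add: n_def)
  have "x\<^sup>2 + y\<^sup>2 + n\<^sup>2 - x * y * n - 2 < 2"
    using K by (simp add: n_def power2_eq_square algebra_simps)
  moreover have "x\<^sup>2 + y\<^sup>2 + n\<^sup>2 - x * y * n = (x - y)\<^sup>2 + (2 - n) * (x * y - 4) + (n - 2)\<^sup>2 + 4"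
    by (simp add: power2_eq_square algebra_simps)
  moreover have "x * y \<ge> 2 * 2"
    using assms by (intro mult_mono) auto
  then have "(2 - n) * (x * y - 4) \<ge> 0"
    using n by (intro mult_nonneg_nonneg) auto
  ultimately show False
    by (smt (verit) zero_le_power2)
qed

lemma geometric_of_triple:
  assumes m: "markoff_fun \<phi>" and b: "basis U V"
    and gt: "\<phi> U > 2" "\<phi> V > 2" "\<phi> (U - V) > 2" and K: "kappa \<phi> U V < 2"
  shows "geometric \<phi>"
proof -
  define E where "E u v = (basis u v \<and> \<phi> u > 2 \<and> \<phi> v > 2 \<and> \<phi> (u - v) > 2)" for u v
  have k: "kappa \<phi> u v < 2" if "basis u v" for u v
    using kappa_eq[OF m b that] K by simp
  have add: "\<phi> (u + v) > 2" if "E u v" for u v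
    using that k[of u v] markoff_greater_2[of "\<phi> u" "\<phi> v" "\<phi> (u - v)"] markoff_add[OF m, of u v]
    unfolding E_def kappa_def by simp
  have "\<phi> w > 2" if w: "prim w" for w
  proof (rule tree_induct[of E, OF _ b _ _ _ _ _ _ w])
    show "E u (u + v) \<and> E (u + v) v" if "E u v" for u v
      using that add[OF that] markoff_even[OF m, of v] unfolding E_def by simp
    show "E U V" using b gt by (simp add: E_def)
    then show "E U (- V)" using add[of U V] m by (simp add: E_def)
    show "\<phi> (- w) > 2" if "\<phi> w > 2" for w using that m by simp
    show "\<phi> (u + v) > 2" if "E u v" for u v using add that .
  qed (use gt in simp_all)
  then show ?thesis
    using m k unfolding geometric_def by blast
qed

text \<open>Growth along the Farey tree; \<open>f\<close> is a deformation (with \<open>\<alpha> = \<beta> = \<phi>\<close>) or a difference of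
  two Markoff functions \<open>\<alpha>\<close>, \<open>\<beta>\<close>.\<close>

definition grows :: "(int \<times> int \<Rightarrow> real) \<Rightarrow> int \<times> int \<Rightarrow> int \<times> int \<Rightarrow> bool" where
  "grows f u v \<longleftrightarrow> basis u v \<and> 0 \<le> f u \<and> 0 \<le> f v \<and> f u \<le> f (u + v) \<and> f v \<le> f (u + v)"

text \<open>The factors are at least \<open>2\<close>, so the next value is at least
  \<open>2 * f (u + v)\<close> minus an old value, which is at most \<open>f (u + v)\<close>. Two
  factors \<open>\<alpha>\<close>, \<open>\<beta>\<close> occur because a difference of products
  splits asymmetrically.\<close>

lemma grows_step:
  assumes even: "\<And>u. f (- u) = f u"
    and rec: "\<And>u v. basis u v \<Longrightarrow> f (u + v) = f u * \<alpha> v + \<beta> u * f v - f (u - v)"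
    and ge: "\<And>w. prim w \<Longrightarrow> \<alpha> w \<ge> 2" "\<And>w. prim w \<Longrightarrow> \<beta> w \<ge> 2"
    and g: "grows f u v"
  shows "grows f u (u + v) \<and> grows f (u + v) v"
proof -
  have b: "basis u v" and f: "0 \<le> f u" "0 \<le> f v" "f u \<le> f (u + v)" "f v \<le> f (u + v)"
    using g by (auto simp: grows_def)
  have p: "prim u" "prim v" "prim (u + v)"
    using basis_prim[OF b] basis_prim(1)[of "u + v" v] b by simp_all
  have 1: "f (u + (u + v)) = f u * \<alpha> (u + v) + \<beta> u * f (u + v) - f v"
    using rec[of u "u + v"] b even[of v] by simp
  have 2: "f (u + v + v) = f (u + v) * \<alpha> v + \<beta> (u + v) * f v - f u"
    using rec[of "u + v" v] b by simp
  have "f u * \<alpha> (u + v) \<ge> 0" "\<beta> (u + v) * f v \<ge> 0"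
    using f ge(1)[OF p(3)] ge(2)[OF p(3)] by (intro mult_nonneg_nonneg; linarith)+
  moreover have "\<beta> u * f (u + v) \<ge> 2 * f (u + v)" "f (u + v) * \<alpha> v \<ge> f (u + v) * 2"
    using f ge(1)[OF p(2)] ge(2)[OF p(1)] by (intro mult_right_mono mult_left_mono; linarith)+
  ultimately show ?thesis
    unfolding grows_def using b f 1 2 by simp
qed

lemma int_recurrence_unique:
  fixes f g :: "int \<Rightarrow> real"
  assumes "\<And>n. f (n + 1) + f (n - 1) = c * f n" "\<And>n. g (n + 1) + g (n - 1) = c * g n"
    and "f 0 = g 0" "f 1 = g 1"
  shows "f n = g n"
proof -
  have "f n = g n \<and> f (n + 1) = g (n + 1)"
  proof (induction n rule: int_induct[where k=0])
    case base then show ?case using assms by simp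
  next
    case (step1 i)
    then show ?case using assms(1,2)[of "i + 1"] by simp
  next
    case (step2 i)
    then show ?case using assms(1,2)[of i] by simp
  qed
  then show ?thesis ..
qed

section \<open>The stable norm as a support function\<close>

definition rvec :: "int \<times> int \<Rightarrow> real \<times> real" where
  "rvec w = (of_int (fst w), of_int (snd w))"

lemma rvec_simps [simp]:
  "rvec (u + v) = rvec u + rvec v" "rvec (u - v) = rvec u - rvec v" "rvec (- u) = - rvec u"
  "rvec (scale k u) = of_int k *\<^sub>R rvec u"
  by (simp_all add: rvec_def scale_def)

definition hlen :: "(int \<times> int \<Rightarrow> real) \<Rightarrow> int \<times> int \<Rightarrow> real" where
  "hlen \<phi> w = arcosh (\<phi> w / 2)"

definition dual_ball :: "(int \<times> int \<Rightarrow> real) \<Rightarrow> (real \<times> real) set" where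
  "dual_ball \<phi> = {\<xi>. \<forall>w. prim w \<longrightarrow> \<xi> \<bullet> rvec w \<le> hlen \<phi> w}"

text \<open>The support function of \<open>dual_ball \<phi>\<close>, that is, the largest sublinear
  function not exceeding \<open>hlen \<phi>\<close> at primitive vectors. The point is that it
  attains these bounds, see \<open>stable_norm_rvec\<close>.\<close>

definition stable_norm :: "(int \<times> int \<Rightarrow> real) \<Rightarrow> real \<times> real \<Rightarrow> real" where
  "stable_norm \<phi> \<mu> = Sup ((\<lambda>\<xi>. \<xi> \<bullet> \<mu>) ` dual_ball \<phi>)"

lemma linear_functional_on_basis:
  assumes "basis u v" obtains \<xi> :: "real \<times> real" where "\<xi> \<bullet> rvec u = s" "\<xi> \<bullet> rvec v = t"
proof -
  define d where "d = real_of_int (wedge u v)"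
  have d: "d * d = 1" using basis_squared[OF assms] unfolding d_def by (metis of_int_1 of_int_mult)
  have dd: "d = of_int (fst u) * of_int (snd v) - of_int (snd u) * of_int (fst v)"
    by (simp add: d_def wedge_def)
  define \<xi> where "\<xi> = (d * (s * snd (rvec v) - t * snd (rvec u)), d * (t * fst (rvec u) - s * fst (rvec v)))"
  have "\<xi> \<bullet> rvec u = s * (d * d)" "\<xi> \<bullet> rvec v = t * (d * d)"
    by (simp_all add: \<xi>_def rvec_def dd algebra_simps)
  then show ?thesis using that d by simp
qed

locale geometric_markoff =
  fixes \<phi> :: "int \<times> int \<Rightarrow> real"
  assumes geometric: "geometric \<phi>"
begin

lemma markoff: "markoff_fun \<phi>"
  using geometric by (simp add: geometric_def)

lemma greater_2: "prim w \<Longrightarrow> \<phi> w > 2"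
  using geometric by (simp add: geometric_def)

lemma kappa_less: "basis u v \<Longrightarrow> kappa \<phi> u v < 2"
  using geometric by (simp add: geometric_def)

lemma even [simp]: "\<phi> (- w) = \<phi> w"
  using markoff by simp

lemma hlen_even [simp]: "hlen \<phi> (- w) = hlen \<phi> w"
  by (simp add: hlen_def)

lemma phi_cosh: "prim w \<Longrightarrow> \<phi> w = 2 * cosh (hlen \<phi> w)"
  using greater_2[of w] by (simp add: hlen_def cosh_arcosh_real)

lemma phi_exp: "prim w \<Longrightarrow> \<phi> w = exp (hlen \<phi> w) + exp (- hlen \<phi> w)"
  by (simp add: phi_cosh cosh_def)

lemma hlen_pos: "prim w \<Longrightarrow> hlen \<phi> w > 0"
  using greater_2[of w] by (simp add: hlen_def)

lemma line_recurrence: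
  assumes "basis X V"
  shows "\<phi> (V + scale (n + 1) X) + \<phi> (V + scale (n - 1) X) = \<phi> X * \<phi> (V + scale n X)"
proof -
  have b: "basis (V + scale n X) X" using assms by (subst basis_commute) simp
  show ?thesis
    using markoff_add[OF markoff b] by (simp add: scale_add scale_diff algebra_simps)
qed

text \<open>Along the neighbours \<open>V + n X\<close> the relation is a linear recurrence with
  characteristic roots \<open>a\<close> and \<open>1 / a\<close>, where
  \<open>\<phi> X = a + 1 / a\<close>. The product of its two coefficients exceeds \<open>1\<close>
  because \<open>kappa < 2\<close>; as their sum is positive, both are positive and have logarithms
  \<open>s\<close>, \<open>t\<close>.\<close>

lemma line_formula:
  assumes b: "basis X V"
  obtains s t where "s + t \<ge> 0"
    "\<And>n. \<phi> (V + scale n X) = exp (s + of_int n * hlen \<phi> X) + exp (t - of_int n * hlen \<phi> X)"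
proof -
  note p = basis_prim[OF b]
  define a where "a = exp (hlen \<phi> X)"
  have a: "a > 1" using hlen_pos[OF p(1)] by (simp add: a_def)
  define x where "x = \<phi> X"
  define y where "y = \<phi> V"
  define z where "z = \<phi> (V + X)"
  have x: "x = a + 1 / a" using phi_exp[OF p(1)] by (simp add: x_def a_def exp_minus inverse_eq_divide)
  have a2: "a * a > 1" using a by (simp add: less_1_mult)
  \<comment> \<open>The solution of \<open>u + w = y\<close> and
    \<open>u * a + w / a = z\<close>.\<close>
  define u where "u = (a * z - y) / (a * a - 1)"
  define w where "w = a * (a * y - z) / (a * a - 1)"
  have ne: "a * a - 1 \<noteq> 0" "a \<noteq> 0" using a a2 by auto
  have uw: "u + w = y"
    using ne by (simp add: u_def w_def divide_simps) (simp add: algebra_simps)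
  have uz: "u * a + w / a = z"
    using ne by (simp add: u_def w_def divide_simps) (simp add: algebra_simps)
  have k: "x\<^sup>2 + y\<^sup>2 + z\<^sup>2 - x * y * z < 4"
  proof -
    have "basis V (V + X)" using b by (simp add: basis_commute)
    then have "kappa \<phi> V (V + X) < 2" by (rule kappa_less)
    then show ?thesis by (simp add: kappa_def x_def y_def z_def algebra_simps)
  qed
  have id: "y\<^sup>2 + z\<^sup>2 - x * y * z = - (u * w) * (a - 1 / a)\<^sup>2"
    unfolding uw[symmetric] uz[symmetric] x using ne by (simp add: field_simps power2_eq_square)
  have x4: "x\<^sup>2 - 4 = (a - 1 / a)\<^sup>2"
    unfolding x using ne by (simp add: field_simps power2_eq_square)
  have "(a - 1 / a)\<^sup>2 * (1 - u * w) < 0"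
    using k id x4 by (simp add: algebra_simps)
  then have uw1: "u * w > 1"
    by (smt (verit) mult_nonneg_nonneg zero_le_power2)
  have y: "y > 2" unfolding y_def using greater_2 p by simp
  have uwpos: "u > 0" "w > 0"
  proof -
    have "\<not> (u \<le> 0 \<and> w \<le> 0)" using uw y by linarith
    then show "u > 0" "w > 0" using uw1 by (smt (verit) mult_nonneg_nonpos mult_nonpos_nonneg)+
  qed
  have *: "\<phi> (V + scale n X) = exp (ln u + of_int n * hlen \<phi> X) + exp (ln w - of_int n * hlen \<phi> X)" for n
  proof (rule int_recurrence_unique[where c="\<phi> X"])
    show "\<phi> (V + scale (n + 1) X) + \<phi> (V + scale (n - 1) X) = \<phi> X * \<phi> (V + scale n X)" for n
      by (rule line_recurrence[OF b])
    show "exp (ln u + of_int (n + 1) * hlen \<phi> X) + exp (ln w - of_int (n + 1) * hlen \<phi> X) +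
        (exp (ln u + of_int (n - 1) * hlen \<phi> X) + exp (ln w - of_int (n - 1) * hlen \<phi> X)) =
        \<phi> X * (exp (ln u + of_int n * hlen \<phi> X) + exp (ln w - of_int n * hlen \<phi> X))" for n :: int
      unfolding phi_exp[OF p(1)]
      by (simp add: ring_distribs exp_add exp_diff exp_minus field_simps)
    show "\<phi> (V + scale 0 X) = exp (ln u + of_int 0 * hlen \<phi> X) + exp (ln w - of_int 0 * hlen \<phi> X)"
      using uw uwpos by (simp add: y_def)
    show "\<phi> (V + scale 1 X) = exp (ln u + of_int 1 * hlen \<phi> X) + exp (ln w - of_int 1 * hlen \<phi> X)"
      using uz uwpos by (simp add: z_def a_def exp_add exp_diff)
  qed
  have "ln (u * w) \<ge> 0" using uw1 by simp
  then have "ln u + ln w \<ge> 0" using uwpos by (simp add: ln_mult)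
  with * show ?thesis using that by blast
qed

text \<open>A supporting functional \<open>\<xi>\<close> of the stable norm at \<open>X\<close>: \<open>2 cosh \<xi>\<close> is a Markoff function, and
  \<open>\<phi>\<close> minus it vanishes at \<open>X\<close> and grows away from \<open>X\<close>.\<close>

lemma support:
  assumes b: "basis X V"
  obtains \<xi> s t where "\<xi> \<in> dual_ball \<phi>" "\<xi> \<bullet> rvec X = hlen \<phi> X" "\<xi> \<bullet> rvec V = s"
    "\<And>n. \<phi> (V + scale n X) = exp (s + of_int n * hlen \<phi> X) + exp (t - of_int n * hlen \<phi> X)"
proof -
  obtain s t where st: "s + t \<ge> 0" and
    line: "\<And>n. \<phi> (V + scale n X) = exp (s + of_int n * hlen \<phi> X) + exp (t - of_int n * hlen \<phi> X)"
    using line_formula[OF b] by blast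
  obtain \<xi> :: "real \<times> real" where \<xi>: "\<xi> \<bullet> rvec X = hlen \<phi> X" "\<xi> \<bullet> rvec V = s"
    using linear_functional_on_basis[OF b] .
  define \<psi> where "\<psi> w = 2 * cosh (\<xi> \<bullet> rvec w)" for w
  define g where "g w = \<phi> w - \<psi> w" for w
  have ge: "\<psi> w \<ge> 2" for w using cosh_real_ge_1[of "\<xi> \<bullet> rvec w"] by (simp add: \<psi>_def)
  have rec: "g (u + v) = g u * \<phi> v + \<psi> u * g v - g (u - v)" if "basis u v" for u v
  proof -
    have "\<psi> (u + v) = \<psi> u * \<psi> v - \<psi> (u - v)"
      by (simp add: \<psi>_def inner_add_right inner_diff_right cosh_add cosh_diff)
    then show ?thesis using markoff_add[OF markoff that] by (simp add: g_def algebra_simps)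
  qed
  have geven: "g (- w) = g w" for w by (simp add: g_def \<psi>_def)
  have gX: "g X = 0" using phi_cosh basis_prim[OF b] \<xi> by (simp add: g_def \<psi>_def)
  have gV: "g (V + scale n X) \<ge> 0" for n
  proof -
    \<comment> \<open>\<open>s\<close> is the exponent of the term that increases with
      \<open>n\<close>, so this term cancels and a difference of two decaying ones remains; its sign
      is that of \<open>s + t\<close>.\<close>
    have "g (V + scale n X) = exp (t - of_int n * hlen \<phi> X) - exp (- (s + of_int n * hlen \<phi> X))"
      using \<xi> by (simp add: g_def line \<psi>_def inner_add_right cosh_def field_simps)
    then show ?thesis using st by simp
  qed
  have grow: "grows g (V + scale n X) (V + scale (n + 1) X)" for n
  proof -
    let ?u = "V + scale n X" and ?v = "V + scale (n + 1) X"
    have bas: "basis ?u ?v"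
      using b by (metis add.assoc basis_commute basis_simps(3,9) scale_add scale_simps(2))
    \<comment> \<open>\<open>g\<close> vanishes at the difference of consecutive neighbours, so the
      recursion has no negative term here.\<close>
    have "?u - ?v = - X" by (simp add: scale_add)
    then have r: "g (?u + ?v) = g ?u * \<phi> ?v + \<psi> ?u * g ?v"
      using rec[OF bas] gX geven[of X] by simp
    have "g ?u * \<phi> ?v \<ge> g ?u * 2" "\<psi> ?u * g ?v \<ge> 2 * g ?v"
      using gV[of n] gV[of "n + 1"] ge[of ?u] greater_2[OF basis_prim(2)[OF bas]]
      by (intro mult_left_mono mult_right_mono; simp)+
    then show ?thesis
      unfolding grows_def using r bas gV[of n] gV[of "n + 1"] by linarith
  qed
  have g0: "g w \<ge> 0" if "prim w" for w
    using _ b grow _ gV _ _ that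
  proof (rule pivot_induct)
    show "grows g u v \<Longrightarrow> grows g u (u + v) \<and> grows g (u + v) v" for u v
      by (rule grows_step[OF geven rec _ ge]) (auto intro: less_imp_le greater_2)
    show "grows g u v \<Longrightarrow> 0 \<le> g (u + v)" for u v unfolding grows_def by linarith
  qed (use gX geven in simp_all)
  have "\<xi> \<in> dual_ball \<phi>"
    unfolding dual_ball_def
  proof safe
    fix w assume w: "prim w"
    have "cosh \<bar>\<xi> \<bullet> rvec w\<bar> \<le> cosh (hlen \<phi> w)"
      using g0[OF w] phi_cosh[OF w] by (simp add: g_def \<psi>_def cosh_real_abs)
    then show "\<xi> \<bullet> rvec w \<le> hlen \<phi> w"
      using hlen_pos[OF w] cosh_real_nonneg_le_iff[of "\<bar>\<xi> \<bullet> rvec w\<bar>" "hlen \<phi> w"] by simp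
  qed
  then show ?thesis using that \<xi> line by blast
qed

lemma dual_ball_abs: assumes "\<xi> \<in> dual_ball \<phi>" "prim w" shows "\<bar>\<xi> \<bullet> rvec w\<bar> \<le> hlen \<phi> w"
proof -
  have "\<xi> \<bullet> rvec w \<le> hlen \<phi> w" "\<xi> \<bullet> rvec (- w) \<le> hlen \<phi> (- w)"
    using assms prim_uminus[of w] unfolding dual_ball_def mem_Collect_eq by blast+
  then show ?thesis by simp
qed

lemma dual_ball_bound:
  assumes "\<xi> \<in> dual_ball \<phi>"
  shows "\<xi> \<bullet> \<mu> \<le> (hlen \<phi> (1, 0) + hlen \<phi> (0, 1)) * norm \<mu>"
proof -
  have p: "prim (1, 0)" "prim (0, 1)" by (simp_all add: prim_def)
  have "\<bar>fst \<xi>\<bar> \<le> hlen \<phi> (1, 0)" "\<bar>snd \<xi>\<bar> \<le> hlen \<phi> (0, 1)"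
    using dual_ball_abs[OF assms p(1)] dual_ball_abs[OF assms p(2)]
    by (cases \<xi>; simp add: rvec_def)+
  moreover have "\<bar>fst \<mu>\<bar> \<le> norm \<mu>" "\<bar>snd \<mu>\<bar> \<le> norm \<mu>"
    using norm_fst_le[of "fst \<mu>" "snd \<mu>"] norm_snd_le[of "snd \<mu>" "fst \<mu>"] by simp_all
  ultimately have "\<bar>fst \<xi> * fst \<mu>\<bar> \<le> hlen \<phi> (1, 0) * norm \<mu>" "\<bar>snd \<xi> * snd \<mu>\<bar> \<le> hlen \<phi> (0, 1) * norm \<mu>"
    unfolding abs_mult by (intro mult_mono; simp)+
  moreover have "\<xi> \<bullet> \<mu> = fst \<xi> * fst \<mu> + snd \<xi> * snd \<mu>" by (cases \<xi>; cases \<mu>) simp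
  ultimately show ?thesis by (simp add: distrib_right)
qed

lemma dual_ball_nonempty: "dual_ball \<phi> \<noteq> {}"
  using support[of "(1, 0)" "(0, 1)"] by auto

lemma stable_norm_upper: "\<xi> \<in> dual_ball \<phi> \<Longrightarrow> \<xi> \<bullet> \<mu> \<le> stable_norm \<phi> \<mu>"
  unfolding stable_norm_def using dual_ball_bound[of _ \<mu>] by (intro cSup_upper imageI bdd_aboveI2) simp_all

lemma stable_norm_least: "(\<And>\<xi>. \<xi> \<in> dual_ball \<phi> \<Longrightarrow> \<xi> \<bullet> \<mu> \<le> c) \<Longrightarrow> stable_norm \<phi> \<mu> \<le> c"
  unfolding stable_norm_def using dual_ball_nonempty by (intro cSup_least) auto

lemma stable_norm_triangle: "stable_norm \<phi> (\<mu> + \<nu>) \<le> stable_norm \<phi> \<mu> + stable_norm \<phi> \<nu>"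
  by (rule stable_norm_least) (simp add: inner_add_right add_mono stable_norm_upper)

lemma stable_norm_0: "stable_norm \<phi> 0 = 0"
proof -
  obtain \<xi> where "\<xi> \<in> dual_ball \<phi>" using dual_ball_nonempty by blast
  then show ?thesis
    using stable_norm_least[of 0 0] stable_norm_upper[of \<xi> 0] by simp
qed

lemma stable_norm_scale_nonneg: assumes "t \<ge> 0" shows "stable_norm \<phi> (t *\<^sub>R \<mu>) = t * stable_norm \<phi> \<mu>"
proof -
  have le: "stable_norm \<phi> (t *\<^sub>R \<mu>) \<le> t * stable_norm \<phi> \<mu>" if "t \<ge> 0" for t \<mu>
    using that by (intro stable_norm_least) (simp add: mult_left_mono stable_norm_upper)
  show ?thesis
  proof (cases "t = 0")
    case False
    then have "stable_norm \<phi> ((1 / t) *\<^sub>R (t *\<^sub>R \<mu>)) \<le> (1 / t) * stable_norm \<phi> (t *\<^sub>R \<mu>)"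
      using assms by (intro le) simp
    then show ?thesis using le[of t \<mu>] False assms by (simp add: field_simps)
  qed (simp add: stable_norm_0)
qed

lemma stable_norm_uminus: "stable_norm \<phi> (- \<mu>) = stable_norm \<phi> \<mu>"
proof -
  have neg: "- \<xi> \<in> dual_ball \<phi>" if "\<xi> \<in> dual_ball \<phi>" for \<xi>
    unfolding dual_ball_def
  proof safe
    fix w assume "prim w"
    then show "- \<xi> \<bullet> rvec w \<le> hlen \<phi> w" using dual_ball_abs[OF that, of w] by simp
  qed
  have "stable_norm \<phi> (- \<mu>) \<le> stable_norm \<phi> \<mu>" for \<mu>
    using stable_norm_upper[OF neg] by (intro stable_norm_least) fastforce
  from this[of \<mu>] this[of "- \<mu>"] show ?thesis by simp
qed

lemma stable_norm_scale: "stable_norm \<phi> (t *\<^sub>R \<mu>) = \<bar>t\<bar> * stable_norm \<phi> \<mu>"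
  using stable_norm_scale_nonneg[of t \<mu>] stable_norm_scale_nonneg[of "- t" \<mu>] stable_norm_uminus[of "t *\<^sub>R \<mu>"]
  by (cases "t \<ge> 0") auto

lemma stable_norm_rvec: assumes "prim w" shows "stable_norm \<phi> (rvec w) = hlen \<phi> w"
proof -
  obtain v where b: "basis w v" using prim_basis[OF assms] .
  obtain \<xi> where "\<xi> \<in> dual_ball \<phi>" "\<xi> \<bullet> rvec w = hlen \<phi> w" using support[OF b] by metis
  then have "hlen \<phi> w \<le> stable_norm \<phi> (rvec w)" using stable_norm_upper by metis
  moreover have "stable_norm \<phi> (rvec w) \<le> hlen \<phi> w"
    using assms by (intro stable_norm_least) (simp add: dual_ball_def)
  ultimately show ?thesis by simp
qed

lemma continuous_stable_norm: "continuous_on UNIV (stable_norm \<phi>)"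
proof -
  define C where "C = hlen \<phi> (1, 0) + hlen \<phi> (0, 1)"
  have C: "C > 0" unfolding C_def by (intro add_pos_pos hlen_pos) (simp_all add: prim_def)
  have le: "stable_norm \<phi> \<mu> \<le> C * norm \<mu>" for \<mu>
    unfolding C_def by (rule stable_norm_least) (rule dual_ball_bound)
  have 1: "stable_norm \<phi> \<mu> - stable_norm \<phi> \<nu> \<le> C * norm (\<mu> - \<nu>)" for \<mu> \<nu>
    using stable_norm_triangle[of "\<mu> - \<nu>" \<nu>] le[of "\<mu> - \<nu>"] by simp
  have "dist (stable_norm \<phi> \<mu>) (stable_norm \<phi> \<nu>) \<le> C * dist \<mu> \<nu>" for \<mu> \<nu>
    using 1[of \<mu> \<nu>] 1[of \<nu> \<mu>] by (simp add: dist_norm norm_minus_commute abs_if)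
  then have "C-lipschitz_on UNIV (stable_norm \<phi>)" using C by (intro lipschitz_onI) auto
  then show ?thesis by (rule lipschitz_on_continuous_on)
qed

lemma stable_norm_upper_cone:
  assumes "prim X" "prim Y" "p \<ge> 0" "q \<ge> 0"
  shows "stable_norm \<phi> (p *\<^sub>R rvec X + q *\<^sub>R rvec Y) \<le> p * hlen \<phi> X + q * hlen \<phi> Y"
  using stable_norm_triangle[of "p *\<^sub>R rvec X" "q *\<^sub>R rvec Y"] assms
  by (simp add: stable_norm_scale stable_norm_rvec)

text \<open>The functional supporting the norm at \<open>X\<close> takes the value \<open>s\<close>
  at \<open>Y\<close>. On an outward edge \<open>exp t \<le> exp s\<close>, so
  \<open>\<phi> Y \<le> 2 * exp s\<close>, and at most \<open>ln 2\<close> is lost at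
  \<open>Y\<close>, nothing at \<open>X\<close>. With \<open>stable_norm_upper_cone\<close> this
  encloses the norm on the cone of the edge up to \<open>q * ln 2\<close>.\<close>

lemma stable_norm_lower_cone:
  assumes b: "basis X Y" and out: "\<phi> (X - Y) \<le> \<phi> (X + Y)" and q: "q \<ge> 0"
  shows "p * hlen \<phi> X + q * hlen \<phi> Y - q * ln 2 \<le> stable_norm \<phi> (p *\<^sub>R rvec X + q *\<^sub>R rvec Y)"
proof -
  obtain \<xi> s t where \<xi>: "\<xi> \<in> dual_ball \<phi>" "\<xi> \<bullet> rvec X = hlen \<phi> X" "\<xi> \<bullet> rvec Y = s"
    and line: "\<And>n. \<phi> (Y + scale n X) = exp (s + of_int n * hlen \<phi> X) + exp (t - of_int n * hlen \<phi> X)"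
    using support[OF b] by blast
  note p = basis_prim[OF b]
  let ?h = "hlen \<phi> X"
  have "exp (s - ?h) + exp (t + ?h) \<le> exp (s + ?h) + exp (t - ?h)"
    using out line[of 1] line[of "- 1"] even_diff_commute[of \<phi> Y X] by (simp add: add.commute)
  then have "(exp s - exp t) * (exp ?h - exp (- ?h)) \<ge> 0"
    by (simp add: exp_add exp_diff exp_minus algebra_simps divide_inverse)
  moreover have "exp ?h - exp (- ?h) > 0" using hlen_pos[OF p(1)] by simp
  ultimately have "exp t \<le> exp s" by (simp add: zero_le_mult_iff)
  moreover have "exp (hlen \<phi> Y) \<le> \<phi> Y" using phi_exp[OF p(2)] by simp
  ultimately have "exp (hlen \<phi> Y) \<le> 2 * exp s" using line[of 0] by (simp del: exp_le_cancel_iff)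
  also have "2 * exp s = exp (ln 2 + s)" by (simp add: exp_add)
  finally have "hlen \<phi> Y - ln 2 \<le> s" by simp
  then have "q * (hlen \<phi> Y - ln 2) \<le> q * s" using q by (rule mult_left_mono)
  moreover have "\<xi> \<bullet> (p *\<^sub>R rvec X + q *\<^sub>R rvec Y) = p * ?h + q * s" using \<xi> by (simp add: inner_add_right)
  ultimately show ?thesis
    using stable_norm_upper[OF \<xi>(1), of "p *\<^sub>R rvec X + q *\<^sub>R rvec Y"] by (simp add: algebra_simps)
qed

end

section \<open>Lamination length is twice the stable norm\<close>

lemma slope_vec_eq: "slope_vec s = rvec (reduced_form s)"
  by (simp add: slope_vec_def rvec_def split: prod.splits)

lemma rational_direction:
  assumes "a \<in> \<rat>" "b \<in> \<rat>" obtains t s where "(a, b) = t *\<^sub>R slope_vec s"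
proof (cases "(a, b) = (0, 0)")
  case True then show ?thesis using that[of 0] by (simp add: zero_prod_def)
next
  case False
  obtain i n where a: "a = of_int i / of_int n" "n > 0"
    using assms(1) by (metis Rats_cases')
  obtain j m where b: "b = of_int j / of_int m" "m > 0"
    using assms(2) by (metis Rats_cases')
  define g where "g = gcd (i * m) (j * n)"
  have ne: "i * m \<noteq> 0 \<or> j * n \<noteq> 0" using False a b by auto
  then have g: "g \<noteq> 0" by (simp add: g_def)
  define w where "w = (i * m div g, j * n div g)"
  have w: "prim w" unfolding prim_def w_def g_def fst_conv snd_conv using div_gcd_coprime[OF ne] .
  have gw: "i * m = g * fst w" "j * n = g * snd w" by (simp_all add: w_def g_def)
  have "a = of_int (i * m) / of_int (n * m)" "b = of_int (j * n) / of_int (n * m)" using a b by simp_all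
  then have ab: "(a, b) = (of_int g / of_int (n * m)) *\<^sub>R rvec w"
    unfolding gw by (simp add: rvec_def)
  show ?thesis
  proof (cases "reduced_form (slope_of w) = w")
    case True
    then show ?thesis using that ab slope_vec_eq by metis
  next
    case False
    then have "rvec w = - slope_vec (slope_of w)" using reduced_form_slope_of[OF w] by (auto simp: slope_vec_eq)
    then show ?thesis using that[of "- (of_int g / of_int (n * m))" "slope_of w"] ab by simp
  qed
qed

text \<open>Rational vectors are multiples of slope vectors and are dense in the plane, so a
  continuous function with the prescribed values is unique; the norm provides one.\<close>

lemma lamination_length_eq:
  assumes "geometric (\<lambda>w. \<Phi> (slope_of w))"
  shows "lamination_length \<Phi> = (\<lambda>\<mu>. 2 * stable_norm (\<lambda>w. \<Phi> (slope_of w)) \<mu>)"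
proof -
  interpret geometric_markoff "\<lambda>w. \<Phi> (slope_of w)" by unfold_locales fact
  let ?L = "\<lambda>\<mu>. 2 * stable_norm (\<lambda>w. \<Phi> (slope_of w)) \<mu>"
  have c: "continuous_on UNIV ?L" using continuous_stable_norm by (intro continuous_intros)
  have v: "?L (t *\<^sub>R slope_vec s) = \<bar>t\<bar> * curve_length \<Phi> s" for s t
    using stable_norm_rvec[OF prim_reduced_form[of s]]
    by (simp add: stable_norm_scale slope_vec_eq curve_length_def hlen_def)
  show ?thesis
    unfolding lamination_length_def
  proof (rule the_equality)
    show "continuous_on UNIV ?L \<and> (\<forall>s t. ?L (t *\<^sub>R slope_vec s) = \<bar>t\<bar> * curve_length \<Phi> s)"
      using c v by blast
    fix L assume L: "continuous_on UNIV L \<and> (\<forall>s t. L (t *\<^sub>R slope_vec s) = \<bar>t\<bar> * curve_length \<Phi> s)"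
    have "closed {\<mu>. L \<mu> = ?L \<mu>}"
      using L c by (intro closed_Collect_eq) auto
    moreover have "\<rat> \<times> \<rat> \<subseteq> {\<mu>. L \<mu> = ?L \<mu>}"
    proof
      fix \<mu> :: "real \<times> real" assume "\<mu> \<in> \<rat> \<times> \<rat>"
      then obtain t s where "\<mu> = t *\<^sub>R slope_vec s" using rational_direction[of "fst \<mu>" "snd \<mu>"] by (metis mem_Times_iff prod.collapse)
      then show "\<mu> \<in> {\<mu>. L \<mu> = ?L \<mu>}" using L v by simp
    qed
    ultimately have "closure (\<rat> \<times> \<rat>) \<subseteq> {\<mu>. L \<mu> = ?L \<mu>}" by (rule closure_minimal[rotated])
    then show "L = ?L" by (auto simp: closure_Times Rats_closure_real)
  qed
qed

section \<open>Paths in the Farey tree\<close>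

definition cross :: "real \<times> real \<Rightarrow> real \<times> real \<Rightarrow> real" where
  "cross \<mu> \<nu> = fst \<mu> * snd \<nu> - snd \<mu> * fst \<nu>"

lemma cross_simps [simp]:
  "cross (\<mu> + \<nu>) \<omega> = cross \<mu> \<omega> + cross \<nu> \<omega>" "cross \<omega> (\<mu> + \<nu>) = cross \<omega> \<mu> + cross \<omega> \<nu>"
  "cross (t *\<^sub>R \<mu>) \<omega> = t * cross \<mu> \<omega>" "cross \<omega> (t *\<^sub>R \<mu>) = t * cross \<omega> \<mu>"
  "cross (rvec u) (rvec v) = of_int (wedge u v)"
  by (simp_all add: cross_def rvec_def wedge_def algebra_simps)

definition irrational :: "real \<times> real \<Rightarrow> bool" where
  "irrational \<mu> \<longleftrightarrow> (\<forall>w. w \<noteq> 0 \<longrightarrow> cross \<mu> (rvec w) \<noteq> 0)"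

lemma not_irrational:
  assumes "\<not> irrational \<mu>" obtains t w where "prim w" "\<mu> = t *\<^sub>R rvec w"
proof -
  obtain w where w: "w \<noteq> 0" "cross \<mu> (rvec w) = 0" using assms by (auto simp: irrational_def)
  define g where "g = gcd (fst w) (snd w)"
  have ne: "fst w \<noteq> 0 \<or> snd w \<noteq> 0" using w by (auto simp: prod_eq_iff)
  then have g: "g \<noteq> 0" by (simp add: g_def)
  define v where "v = (fst w div g, snd w div g)"
  have v: "prim v" unfolding prim_def v_def g_def fst_conv snd_conv using div_gcd_coprime[OF ne] .
  have "w = scale g v" by (simp add: v_def scale_def g_def)
  then have c: "cross \<mu> (rvec v) = 0" using w g by simp
  obtain u where b: "basis v u" using prim_basis[OF v] .
  define d where "d = real_of_int (wedge v u)"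
  have d: "d * d = 1" using basis_squared[OF b] unfolding d_def by (metis of_int_1 of_int_mult)
  have "fst \<mu> * (d * d) = d * (cross \<mu> (rvec u) * of_int (fst v) - cross \<mu> (rvec v) * of_int (fst u))"
    "snd \<mu> * (d * d) = d * (cross \<mu> (rvec u) * of_int (snd v) - cross \<mu> (rvec v) * of_int (snd u))"
    unfolding d_def wedge_def cross_def rvec_def by (simp_all add: algebra_simps)
  then have "\<mu> = (d * cross \<mu> (rvec u)) *\<^sub>R rvec v"
    unfolding c d by (simp add: rvec_def prod_eq_iff)
  then show ?thesis using that v by blast
qed

text \<open>The path of the Farey tree in the direction \<open>\<mu>\<close>, as the subtractive
  Euclidean algorithm on the coordinates \<open>p\<close>, \<open>q\<close> of \<open>\<mu>\<close>.
  Positivity of all weights forces the branch at each step and rules out ties.\<close>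

locale farey_path =
  fixes \<mu> :: "real \<times> real" and X Y :: "nat \<Rightarrow> int \<times> int" and p q :: "nat \<Rightarrow> real"
  assumes basis: "basis (X n) (Y n)"
    and pos: "p n > 0" "q n > 0"
    and combination: "\<mu> = p n *\<^sub>R rvec (X n) + q n *\<^sub>R rvec (Y n)"
    and step: "X (Suc n) = X n \<and> Y (Suc n) = X n + Y n \<and> p (Suc n) = p n - q n \<and> q (Suc n) = q n \<or>
      X (Suc n) = X n + Y n \<and> Y (Suc n) = Y n \<and> p (Suc n) = p n \<and> q (Suc n) = q n - p n"

lemma farey_path_exists:
  assumes irr: "irrational \<mu>" obtains X Y p q where "farey_path \<mu> X Y p q"
proof -
  define P where "P s = (case s of (u, v, a, b) \<Rightarrow>
      basis u v \<and> a > 0 \<and> b > 0 \<and> \<mu> = a *\<^sub>R rvec u + b *\<^sub>R rvec v)" for s :: "(int \<times> int) \<times> (int \<times> int) \<times> real \<times> real"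
  define R where "R s s' = (case s of (u, v, a, b) \<Rightarrow> s' = (u, u + v, a - b, b) \<or> s' = (u + v, v, a, b - a))"
    for s s' :: "(int \<times> int) \<times> (int \<times> int) \<times> real \<times> real"
  define \<sigma> :: "real \<Rightarrow> int" where "\<sigma> x = (if x > 0 then 1 else - 1)" for x
  have \<sigma>: "of_int (\<sigma> x) * \<bar>x\<bar> = x" if "x \<noteq> 0" for x using that by (simp add: \<sigma>_def)
  have "cross \<mu> (rvec (0, 1)) \<noteq> 0" "cross \<mu> (rvec (1, 0)) \<noteq> 0"
    using irr unfolding irrational_def by (auto simp: prod_eq_iff)
  then have nz: "fst \<mu> \<noteq> 0" "snd \<mu> \<noteq> 0" by (simp_all add: cross_def rvec_def)
  \<comment> \<open>The first edge consists of the two coordinate vectors, with signs such that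
    \<open>\<mu>\<close> lies in the quadrant between them.\<close>
  have "P ((\<sigma> (fst \<mu>), 0), (0, \<sigma> (snd \<mu>)), \<bar>fst \<mu>\<bar>, \<bar>snd \<mu>\<bar>)"
    using nz \<sigma>[of "fst \<mu>"] \<sigma>[of "snd \<mu>"] unfolding P_def
    by (simp add: basis_def wedge_def rvec_def prod_eq_iff mult.commute) (simp add: \<sigma>_def)
  then have base: "\<exists>s. P s" ..
  have stp: "\<exists>s'. P s' \<and> R s s'" if "P s" for s
  proof -
    obtain u v a b where s: "s = (u, v, a, b)" by (metis prod_cases4)
    have b: "basis u v" and ab: "a > 0" "b > 0" and \<mu>: "\<mu> = a *\<^sub>R rvec u + b *\<^sub>R rvec v"
      using that by (auto simp: P_def s)
    have "prim (u + v)" using basis_prim(1)[of "u + v" v] b by simp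
    \<comment> \<open>Equal weights would make \<open>\<mu>\<close> parallel to
      \<open>u + v\<close>.\<close>
    then have "cross \<mu> (rvec (u + v)) \<noteq> 0" using irr prim_nonzero unfolding irrational_def by blast
    then have "a \<noteq> b" unfolding \<mu> by (simp add: wedge_commute[of v u])
    then consider "a > b" | "a < b" by linarith
    then show ?thesis
    proof cases
      case 1
      then have "P (u, u + v, a - b, b)" using b ab \<mu> by (simp add: P_def algebra_simps)
      then show ?thesis by (intro exI[of _ "(u, u + v, a - b, b)"]) (simp add: R_def s)
    next
      case 2
      then have "P (u + v, v, a, b - a)" using b ab \<mu> by (simp add: P_def algebra_simps)
      then show ?thesis by (intro exI[of _ "(u + v, v, a, b - a)"]) (simp add: R_def s)
    qed
  qed
  obtain s where s: "\<And>n::nat. P (s n)" "\<And>n. R (s n) (s (Suc n))"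
    using dependent_nat_choice[of "\<lambda>_. P" "\<lambda>_. R"] base stp by blast
  have "farey_path \<mu> (\<lambda>n. fst (s n)) (\<lambda>n. fst (snd (s n))) (\<lambda>n. fst (snd (snd (s n)))) (\<lambda>n. snd (snd (snd (s n))))"
  proof
    fix n
    show "basis (fst (s n)) (fst (snd (s n)))" "fst (snd (snd (s n))) > 0" "snd (snd (snd (s n))) > 0"
      "\<mu> = fst (snd (snd (s n))) *\<^sub>R rvec (fst (s n)) + snd (snd (snd (s n))) *\<^sub>R rvec (fst (snd (s n)))"
      using s(1)[of n] unfolding P_def case_prod_beta by blast+
    have "R (s n) (s (Suc n))" by (rule s(2))
    then have "s (Suc n) = (fst (s n), fst (s n) + fst (snd (s n)), fst (snd (snd (s n))) - snd (snd (snd (s n))), snd (snd (snd (s n)))) \<or>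
      s (Suc n) = (fst (s n) + fst (snd (s n)), fst (snd (s n)), fst (snd (snd (s n))), snd (snd (snd (s n))) - fst (snd (snd (s n))))"
      unfolding R_def case_prod_beta .
    then show "fst (s (Suc n)) = fst (s n) \<and> fst (snd (s (Suc n))) = fst (s n) + fst (snd (s n)) \<and>
        fst (snd (snd (s (Suc n)))) = fst (snd (snd (s n))) - snd (snd (snd (s n))) \<and>
        snd (snd (snd (s (Suc n)))) = snd (snd (snd (s n))) \<or>
        fst (s (Suc n)) = fst (s n) + fst (snd (s n)) \<and> fst (snd (s (Suc n))) = fst (snd (s n)) \<and>
        fst (snd (snd (s (Suc n)))) = fst (snd (snd (s n))) \<and>
        snd (snd (snd (s (Suc n)))) = snd (snd (snd (s n))) - fst (snd (snd (s n)))"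
      by (elim disjE) simp_all
  qed
  then show ?thesis using that by blast
qed

section \<open>Growth of the values along a path\<close>

definition outward :: "(int \<times> int \<Rightarrow> real) \<Rightarrow> int \<times> int \<Rightarrow> int \<times> int \<Rightarrow> bool" where
  "outward \<phi> u v \<longleftrightarrow> \<phi> (u - v) \<le> \<phi> (u + v)"

context geometric_markoff
begin

lemma outward_commute: "outward \<phi> u v \<longleftrightarrow> outward \<phi> v u"
  using even_diff_commute[of \<phi> v u] by (simp add: outward_def add.commute)

lemma outward_ge: "basis u v \<Longrightarrow> outward \<phi> u v \<Longrightarrow> \<phi> (u + v) \<ge> \<phi> u * \<phi> v / 2"
  using markoff_add[OF markoff, of u v] by (simp add: outward_def)

lemma outward_greater:
  assumes "basis u v" "outward \<phi> u v" shows "\<phi> (u + v) > \<phi> u" "\<phi> (u + v) > \<phi> v"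
proof -
  have "\<phi> u > 2" "\<phi> v > 2" using greater_2 basis_prim[OF assms(1)] by auto
  then have "\<phi> u * \<phi> v > \<phi> u * 2" "\<phi> u * \<phi> v > 2 * \<phi> v"
    by (intro mult_strict_left_mono mult_strict_right_mono; simp)+
  then show "\<phi> (u + v) > \<phi> u" "\<phi> (u + v) > \<phi> v" using outward_ge[OF assms] by simp_all
qed

text \<open>The next value is more than \<open>2 * \<phi> (u + v)\<close> minus an old value, and
  old values are smaller than \<open>\<phi> (u + v)\<close>. So values that increase across an edge
  keep increasing beyond it.\<close>

lemma outward_step: assumes "basis u v" "outward \<phi> u v" shows "outward \<phi> u (u + v)" "outward \<phi> (u + v) v"
proof -
  have *: "outward \<phi> u (u + v)" if b: "basis u v" and o: "outward \<phi> u v" for u v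
  proof -
    have "\<phi> u > 2" using greater_2 basis_prim[OF b] by auto
    moreover have "\<phi> (u + v) > 2" using greater_2 basis_prim(1)[of "u + v" v] b by simp
    ultimately have "\<phi> u * \<phi> (u + v) > 2 * \<phi> (u + v)" by simp
    then show ?thesis
      using outward_greater[OF b o] markoff_add[OF markoff, of u "u + v"] b by (simp add: outward_def)
  qed
  show "outward \<phi> u (u + v)" using * assms .
  have "outward \<phi> v (v + u)" using * assms basis_commute outward_commute by blast
  then show "outward \<phi> (u + v) v" using outward_commute by (simp add: add.commute)
qed

end

context farey_path
begin

lemma prim_X: "prim (X n)" and prim_Y: "prim (Y n)"
  using basis_prim[OF basis] by auto

lemma shift: "farey_path \<mu> (\<lambda>n. X (n + k)) (\<lambda>n. Y (n + k)) (\<lambda>n. p (n + k)) (\<lambda>n. q (n + k))"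
  using basis pos combination step by unfold_locales auto

text \<open>If the same branch were taken from some step on, one weight would decrease by a fixed
  positive amount at every step and become negative.\<close>

lemma turns:
  shows "\<exists>m\<ge>n. X (Suc m) = X m + Y m \<and> Y (Suc m) = Y m"
    and "\<exists>m\<ge>n. X (Suc m) = X m \<and> Y (Suc m) = X m + Y m"
proof -
  show "\<exists>m\<ge>n. X (Suc m) = X m + Y m \<and> Y (Suc m) = Y m"
  proof (rule ccontr)
    assume "\<not> ?thesis"
    then have s: "p (Suc m) = p m - q m \<and> q (Suc m) = q m" if "m \<ge> n" for m
      using step[of m] that by blast
    have "q (n + k) = q n \<and> p (n + k) = p n - real k * q n" for k
    proof (induction k)
      case (Suc k)
      then show ?case using s[of "n + k"] by (simp add: algebra_simps)
    qed simp
    then have "real k * q n < p n" for k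
      using pos(1)[of "n + k"] by (metis diff_gt_0_iff_gt)
    then show False using reals_Archimedean3[OF pos(2)[of n]] by (metis less_asym)
  qed
  show "\<exists>m\<ge>n. X (Suc m) = X m \<and> Y (Suc m) = X m + Y m"
  proof (rule ccontr)
    assume "\<not> ?thesis"
    then have s: "p (Suc m) = p m \<and> q (Suc m) = q m - p m" if "m \<ge> n" for m
      using step[of m] that by blast
    have "p (n + k) = p n \<and> q (n + k) = q n - real k * p n" for k
    proof (induction k)
      case (Suc k)
      then show ?case using s[of "n + k"] by (simp add: algebra_simps)
    qed simp
    then have "real k * p n < q n" for k
      using pos(2)[of "n + k"] by (metis diff_gt_0_iff_gt)
    then show False using reals_Archimedean3[OF pos(1)[of n]] by (metis less_asym)
  qed
qed

lemma weights_antimono: assumes "m \<le> n" shows "p n \<le> p m" "q n \<le> q m"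
proof -
  have "p (Suc n) \<le> p n" "q (Suc n) \<le> q n" for n
    using step[of n] pos[of n] by auto
  then show "p n \<le> p m" "q n \<le> q m"
    using assms lift_Suc_antimono_le[of p] lift_Suc_antimono_le[of q] by blast+
qed

lemma path_invariant:
  assumes "E (X 0) (Y 0)" "\<And>u v. E u v \<Longrightarrow> E u (u + v) \<and> E (u + v) v"
  shows "E (X n) (Y n)"
proof (induction n)
  case (Suc n)
  then show ?case using step[of n] assms(2)[OF Suc] by auto
qed (use assms in simp)

lemma outward_path:
  assumes "geometric \<phi>" "outward \<phi> (X 0) (Y 0)" shows "outward \<phi> (X n) (Y n)"
proof -
  interpret geometric_markoff \<phi> by unfold_locales fact
  have "basis (X n) (Y n) \<and> outward \<phi> (X n) (Y n)"
    by (rule path_invariant) (use assms basis outward_step in auto)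
  then show ?thesis ..
qed

lemma outward_mono:
  assumes "geometric \<phi>" "outward \<phi> (X 0) (Y 0)" "m \<le> n"
  shows "\<phi> (X m) \<le> \<phi> (X n)" "\<phi> (Y m) \<le> \<phi> (Y n)"
proof -
  interpret geometric_markoff \<phi> by unfold_locales fact
  have "\<phi> (X n) \<le> \<phi> (X (Suc n))" "\<phi> (Y n) \<le> \<phi> (Y (Suc n))" for n
    using step[of n] outward_greater[OF basis outward_path[OF assms(1,2)], of n] by auto
  then show "\<phi> (X m) \<le> \<phi> (X n)" "\<phi> (Y m) \<le> \<phi> (Y n)"
    using assms(3) lift_Suc_mono_le[of "\<lambda>n. \<phi> (X n)"] lift_Suc_mono_le[of "\<lambda>n. \<phi> (Y n)"] by blast+
qed

text \<open>The index \<open>n\<close> depends on the path, on \<open>c\<close> and on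
  \<open>B\<close>, but not on \<open>\<phi>\<close>; this is the source of the uniformity in
  \<open>\<phi>\<close> below. Each time the path has taken both branches, both lower bounds gain a
  factor \<open>c\<close>, since a new value is at least half the product of the two old
  ones.\<close>

lemma growth_uniform:
  assumes "c > 1"
  obtains n where "\<And>\<phi> m. geometric \<phi> \<Longrightarrow> outward \<phi> (X 0) (Y 0) \<Longrightarrow> \<phi> (X 0) \<ge> 2 * c \<Longrightarrow> \<phi> (Y 0) \<ge> 2 * c
    \<Longrightarrow> m \<ge> n \<Longrightarrow> \<phi> (X m) \<ge> B \<and> \<phi> (Y m) \<ge> B"
proof -
  have "\<exists>n. \<forall>\<phi>. geometric \<phi> \<longrightarrow> outward \<phi> (X 0) (Y 0) \<longrightarrow> \<phi> (X 0) \<ge> 2 * c \<longrightarrow> \<phi> (Y 0) \<ge> 2 * c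
    \<longrightarrow> \<phi> (X n) \<ge> c ^ k \<and> \<phi> (Y n) \<ge> c ^ k" for k
  proof (induction k)
    case 0
    then show ?case using assms by (intro exI[of _ 0]) auto
  next
    case (Suc k)
    then obtain n where n: "\<And>\<phi>. geometric \<phi> \<Longrightarrow> outward \<phi> (X 0) (Y 0) \<Longrightarrow> \<phi> (X 0) \<ge> 2 * c \<Longrightarrow> \<phi> (Y 0) \<ge> 2 * c
      \<Longrightarrow> \<phi> (X n) \<ge> c ^ k \<and> \<phi> (Y n) \<ge> c ^ k" by blast
    obtain m where m: "m \<ge> n" "X (Suc m) = X m + Y m" using turns(1) by blast
    obtain l where l: "l \<ge> Suc m" "Y (Suc l) = X l + Y l" using turns(2) by blast
    have "\<phi> (X (Suc l)) \<ge> c ^ Suc k \<and> \<phi> (Y (Suc l)) \<ge> c ^ Suc k"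
      if g: "geometric \<phi>" and o: "outward \<phi> (X 0) (Y 0)" and xy: "\<phi> (X 0) \<ge> 2 * c" "\<phi> (Y 0) \<ge> 2 * c" for \<phi>
    proof -
      interpret geometric_markoff \<phi> by unfold_locales fact
      note mono = outward_mono[OF g o]
      \<comment> \<open>One factor is at least \<open>c ^ k\<close>, the other still at least
        \<open>2 * c\<close>; the half in \<open>outward_ge\<close> cancels the
        \<open>2\<close>.\<close>
      have new: "\<phi> (X i + Y i) \<ge> c ^ Suc k" if "i \<ge> n" for i
      proof -
        have "\<phi> (X i) \<ge> c ^ k" using n[OF g o xy] mono(1)[OF that] by simp
        moreover have "\<phi> (Y i) \<ge> 2 * c" using mono(2)[of 0 i] xy by simp
        moreover have "c ^ k \<ge> 0" using assms by simp
        ultimately have "c ^ k * (2 * c) \<le> \<phi> (X i) * \<phi> (Y i)"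
          using assms by (intro mult_mono; linarith)
        then show ?thesis using outward_ge[OF basis outward_path[OF g o], of i] by (simp add: mult.commute mult.left_commute)
      qed
      show ?thesis
        using new[of m] new[of l] m l mono(1)[of "Suc m" "Suc l"] by simp
    qed
    then show ?case by blast
  qed
  moreover obtain k where k: "B < c ^ k" using real_arch_pow[OF assms] by blast
  ultimately obtain n where n: "\<And>\<phi>. geometric \<phi> \<Longrightarrow> outward \<phi> (X 0) (Y 0) \<Longrightarrow> \<phi> (X 0) \<ge> 2 * c \<Longrightarrow> \<phi> (Y 0) \<ge> 2 * c
    \<Longrightarrow> \<phi> (X n) \<ge> c ^ k \<and> \<phi> (Y n) \<ge> c ^ k" by blast
  show ?thesis
  proof (rule that[of n])
    fix \<phi> m assume a: "geometric \<phi>" "outward \<phi> (X 0) (Y 0)" "\<phi> (X 0) \<ge> 2 * c" "\<phi> (Y 0) \<ge> 2 * c" "m \<ge> n"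
    show "\<phi> (X m) \<ge> B \<and> \<phi> (Y m) \<ge> B"
      using n[OF a(1-4)] outward_mono[OF a(1,2,5)] k by linarith
  qed
qed

text \<open>If \<open>\<phi>\<close> decreased along the whole path, then it would decrease geometrically: the values on
  the path are bounded away from 2 because \<open>4 (2 - K) < (x\<^sup>2 - 4) (y\<^sup>2 - 4)\<close> on every edge.\<close>

lemma outward_somewhere:
  assumes g: "geometric \<phi>" obtains n where "outward \<phi> (X n) (Y n)"
proof (rule ccontr)
  assume "\<not> thesis"
  then have inw: "\<not> outward \<phi> (X n) (Y n)" for n using that by blast
  interpret geometric_markoff \<phi> by unfold_locales fact
  define M where "M n = max (\<phi> (X n)) (\<phi> (Y n))" for n
  have g2: "\<phi> (X n) > 2" "\<phi> (Y n) > 2" for n using greater_2 prim_X prim_Y by auto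
  have z: "\<phi> (X n - Y n) > \<phi> (X n) * \<phi> (Y n) / 2" for n
    using inw[of n] markoff_add[OF markoff basis, of n] by (simp add: outward_def)
  \<comment> \<open>The vector behind the new edge is, up to sign, one of the two vectors of the old
    edge.\<close>
  have z': "\<phi> (X (Suc n)) * \<phi> (Y (Suc n)) / 2 < M n" for n
    using step[of n] z[of "Suc n"] by (auto simp: M_def)
  have M2: "M n > 2" for n using g2[of n] by (auto simp: M_def)
  have dec: "M (Suc n) * l \<le> M n" if "\<phi> (X (Suc n)) \<ge> 2 * l" "\<phi> (Y (Suc n)) \<ge> 2 * l" for n l
  proof -
    have "\<phi> (X (Suc n)) * (2 * l) \<le> \<phi> (X (Suc n)) * \<phi> (Y (Suc n))"
      "(2 * l) * \<phi> (Y (Suc n)) \<le> \<phi> (X (Suc n)) * \<phi> (Y (Suc n))"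
      using that g2[of "Suc n"] by (intro mult_left_mono mult_right_mono; simp)+
    then have "\<phi> (X (Suc n)) * l \<le> M n" "\<phi> (Y (Suc n)) * l \<le> M n"
      using z'[of n] by (simp_all add: mult.commute mult.left_commute)
    then show ?thesis by (simp add: M_def[of "Suc n"] max_def)
  qed
  have "M (Suc n) \<le> M n" for n using dec[of 1 n] g2[of "Suc n"] by simp
  then have M0: "M n \<le> M 0" for n using lift_Suc_antimono_le[of M 0 n] by simp
  \<comment> \<open>Chosen so that the inequality on the edge, with \<open>y \<le> M 0\<close>,
    gives \<open>e \<le> x\<^sup>2 - 4\<close>; hence all values are at least \<open>2 * l\<close>
    with \<open>l > 1\<close>.\<close>
  define e where "e = 4 * (2 - kappa \<phi> (X 0) (Y 0)) / (M 0)\<^sup>2"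
  have e: "e > 0" unfolding e_def using kappa_less[OF basis, of 0] M2[of 0] by simp
  define l where "l = sqrt (4 + e) / 2"
  have l: "l > 1"
  proof -
    have "sqrt (4 + e) > sqrt 4" using e by (intro real_sqrt_less_mono) simp
    then show ?thesis by (simp add: l_def)
  qed
  have bound: "\<phi> u \<ge> 2 * l" if b: "basis u v" and v: "\<phi> v \<le> M 0" and k: "kappa \<phi> u v = kappa \<phi> (X 0) (Y 0)" for u v
  proof -
    have g2': "\<phi> u > 2" "\<phi> v > 2" using greater_2 basis_prim[OF b] by auto
    define x y z where "x = \<phi> u" and "y = \<phi> v" and "z = \<phi> (u - v)"
    \<comment> \<open>A discriminant: \<open>kappa\<close> is quadratic in \<open>z\<close>, and
      completing the square gives the inequality on the edge.\<close>
    have "(x\<^sup>2 - 4) * (y\<^sup>2 - 4) - 4 * (2 - kappa \<phi> u v) = (2 * z - x * y)\<^sup>2"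
      unfolding kappa_def x_def[symmetric] y_def[symmetric] z_def[symmetric]
      by (simp add: power2_eq_square algebra_simps)
    then have "4 * (2 - kappa \<phi> u v) \<le> (x\<^sup>2 - 4) * (y\<^sup>2 - 4)" by (smt (verit) zero_le_power2)
    also have "\<dots> \<le> (x\<^sup>2 - 4) * (M 0)\<^sup>2"
    proof (rule mult_left_mono)
      have "y\<^sup>2 \<le> (M 0)\<^sup>2" using v g2' unfolding y_def by (intro power_mono) auto
      then show "y\<^sup>2 - 4 \<le> (M 0)\<^sup>2" by simp
      have "2\<^sup>2 \<le> x\<^sup>2" using g2' unfolding x_def by (intro power_mono) auto
      then show "0 \<le> x\<^sup>2 - 4" by simp
    qed
    finally have "e \<le> x\<^sup>2 - 4" unfolding e_def k using M2[of 0] by (simp add: divide_le_eq)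
    then have "sqrt (4 + e) \<le> x" using g2' unfolding x_def by (intro real_le_lsqrt) auto
    then show ?thesis by (simp add: l_def x_def)
  qed
  have xy: "\<phi> (X n) \<ge> 2 * l" "\<phi> (Y n) \<ge> 2 * l" for n
    using bound[OF basis, of n] bound[of "Y n" "X n"] basis[of n] M0[of n]
      kappa_eq[OF markoff basis[of 0] basis[of n]] kappa_eq[OF markoff basis[of 0], of "Y n" "X n"]
    by (auto simp: M_def basis_commute)
  have "M n * l ^ n \<le> M 0" for n
  proof (induction n)
    case (Suc n)
    have "M (Suc n) * l ^ Suc n = (M (Suc n) * l) * l ^ n" by simp
    also have "\<dots> \<le> M n * l ^ n" using dec[OF xy, of n] l by (intro mult_right_mono) auto
    finally show ?case using Suc by simp
  qed simp
  moreover obtain n where "M 0 < l ^ n" using real_arch_pow[OF l] by blast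
  moreover have "1 * l ^ n \<le> M n * l ^ n" using M2[of n] l by (intro mult_right_mono) auto
  ultimately show False by (metis less_le_trans mult_1 not_le order_trans)
qed

text \<open>From the first outward edge on, both values are at least \<open>2 * c\<close> for some
  \<open>c > 1\<close>, so \<open>growth_uniform\<close> applies to the shifted path.\<close>

lemma far_edge:
  assumes g: "geometric \<phi>"
  obtains n where "\<And>m. m \<ge> n \<Longrightarrow> outward \<phi> (X m) (Y m) \<and> \<phi> (X m) \<ge> B \<and> \<phi> (Y m) \<ge> B"
proof -
  interpret geometric_markoff \<phi> by unfold_locales fact
  obtain k where k: "outward \<phi> (X k) (Y k)" using outward_somewhere[OF g] .
  interpret s: farey_path \<mu> "\<lambda>n. X (n + k)" "\<lambda>n. Y (n + k)" "\<lambda>n. p (n + k)" "\<lambda>n. q (n + k)"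
    by (rule shift)
  define c where "c = min (\<phi> (X k)) (\<phi> (Y k)) / 2"
  have "c > 1" using greater_2 prim_X prim_Y by (simp add: c_def)
  then obtain n where n: "\<And>\<phi> m. geometric \<phi> \<Longrightarrow> outward \<phi> (X (0 + k)) (Y (0 + k)) \<Longrightarrow> \<phi> (X (0 + k)) \<ge> 2 * c
    \<Longrightarrow> \<phi> (Y (0 + k)) \<ge> 2 * c \<Longrightarrow> m \<ge> n \<Longrightarrow> \<phi> (X (m + k)) \<ge> B \<and> \<phi> (Y (m + k)) \<ge> B"
    using s.growth_uniform[of c B] by blast
  show ?thesis
  proof (rule that[of "n + k"])
    fix m assume m: "m \<ge> n + k"
    then have "outward \<phi> (X (m - k + k)) (Y (m - k + k))" using s.outward_path[OF g, of "m - k"] k by simp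
    moreover have "\<phi> (X (m - k + k)) \<ge> B \<and> \<phi> (Y (m - k + k)) \<ge> B"
      using m k by (intro n g) (auto simp: c_def)
    ultimately show "outward \<phi> (X m) (Y m) \<and> \<phi> (X m) \<ge> B \<and> \<phi> (Y m) \<ge> B" using m by simp
  qed
qed

text \<open>The approximants are at least the norm and exceed it by at most
  \<open>q n * ln 2\<close>. Since \<open>q n * hlen \<phi> (Y n)\<close> stays bounded while the
  lengths tend to infinity, this error tends to \<open>0\<close>.\<close>

lemma stable_norm_limit:
  assumes g: "geometric \<phi>"
  shows "(\<lambda>n. p n * hlen \<phi> (X n) + q n * hlen \<phi> (Y n)) \<longlonglongrightarrow> stable_norm \<phi> \<mu>"
proof (rule LIMSEQ_I)
  interpret geometric_markoff \<phi> by unfold_locales fact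
  define L where "L = stable_norm \<phi> \<mu>"
  fix r :: real assume r: "r > 0"
  have up: "L \<le> p n * hlen \<phi> (X n) + q n * hlen \<phi> (Y n)" for n
    unfolding L_def by (subst combination[of n]) (use pos[of n] prim_X prim_Y in \<open>intro stable_norm_upper_cone, auto\<close>)
  \<comment> \<open>Values above this bound give \<open>hlen \<phi> (Y n) - ln 2 \<ge>
    (\<bar>L\<bar> + 1) * ln 2 / r\<close>, which forces \<open>q n * ln 2 < r\<close>.\<close>
  define B where "B = exp (2 * ln 2 + (\<bar>L\<bar> + 1) * ln 2 / r)"
  obtain N where N: "\<And>m. m \<ge> N \<Longrightarrow> outward \<phi> (X m) (Y m) \<and> \<phi> (X m) \<ge> B \<and> \<phi> (Y m) \<ge> B"
    using far_edge[OF g] by blast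
  show "\<exists>no. \<forall>n\<ge>no. norm (p n * hlen \<phi> (X n) + q n * hlen \<phi> (Y n) - stable_norm \<phi> \<mu>) < r"
  proof (intro exI[of _ N] allI impI)
    fix n assume "n \<ge> N"
    note N' = N[OF this]
    have lo: "p n * hlen \<phi> (X n) + q n * hlen \<phi> (Y n) - q n * ln 2 \<le> L"
      unfolding L_def using stable_norm_lower_cone[OF basis[of n], of "q n" "p n"] N' pos[of n]
      by (simp add: outward_def combination[of n, symmetric])
    have "exp (hlen \<phi> (Y n)) * 2 \<ge> \<phi> (Y n)"
      using phi_exp[OF prim_Y[of n]] hlen_pos[OF prim_Y[of n]] by (smt (verit) exp_le_cancel_iff)
    then have "exp (hlen \<phi> (Y n) + ln 2) \<ge> B" using N' by (simp add: exp_add)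
    then have "hlen \<phi> (Y n) - ln 2 \<ge> (\<bar>L\<bar> + 1) * ln 2 / r" by (simp add: B_def)
    then have "q n * ((\<bar>L\<bar> + 1) * ln 2 / r) \<le> q n * (hlen \<phi> (Y n) - ln 2)"
      using pos[of n] by (intro mult_left_mono) auto
    also have "\<dots> \<le> L"
      using lo mult_pos_pos[OF pos(1)[of n] hlen_pos[OF prim_X[of n]]] by (simp add: algebra_simps)
    finally have "(q n * ln 2 / r) * (\<bar>L\<bar> + 1) < 1 * (\<bar>L\<bar> + 1)" by (simp add: field_simps)
    then have "q n * ln 2 / r < 1" by (rule mult_right_less_imp_less) simp
    then have "q n * ln 2 < r" using r by simp
    then show "norm (p n * hlen \<phi> (X n) + q n * hlen \<phi> (Y n) - stable_norm \<phi> \<mu>) < r"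
      using up[of n] lo by (simp add: L_def)
  qed
qed

end

section \<open>Differentiating the stable norm\<close>

definition rho :: "(int \<times> int \<Rightarrow> real) \<Rightarrow> (int \<times> int \<Rightarrow> real) \<Rightarrow> int \<times> int \<Rightarrow> real" where
  "rho \<phi> f w = f w / \<phi> w"

text \<open>The derivative of \<open>hlen\<close> in the direction \<open>f\<close>. The estimates
  are made for \<open>rho\<close> instead, whose failure to be additive obeys an exact identity
  (\<open>defect_eq\<close>); far out the two agree up to a factor
  \<open>1 + 1 / \<phi> w\<close>.\<close>

definition tangent :: "(int \<times> int \<Rightarrow> real) \<Rightarrow> (int \<times> int \<Rightarrow> real) \<Rightarrow> int \<times> int \<Rightarrow> real" where
  "tangent \<phi> f w = f w / sqrt ((\<phi> w)\<^sup>2 - 4)"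

definition defect :: "(int \<times> int \<Rightarrow> real) \<Rightarrow> (int \<times> int \<Rightarrow> real) \<Rightarrow> int \<times> int \<Rightarrow> int \<times> int \<Rightarrow> real" where
  "defect \<phi> f u v = rho \<phi> f (u + v) - rho \<phi> f u - rho \<phi> f v"

text \<open>Under these bounds the logarithmic derivative \<open>rho\<close> is almost additive at all descendants
  of the edge, so that the derivative of the length can be enclosed between \<open>p rho X + q rho Y\<close> and
  a slight enlargement of it.\<close>

definition tame :: "(int \<times> int \<Rightarrow> real) \<Rightarrow> (int \<times> int \<Rightarrow> real) \<Rightarrow> int \<times> int \<Rightarrow> int \<times> int \<Rightarrow> bool" where
  "tame \<phi> f u v \<longleftrightarrow> basis u v \<and> 13 \<le> \<phi> u \<and> 13 \<le> \<phi> v \<and> outward \<phi> u v \<and> 0 \<le> rho \<phi> f u \<and> 0 \<le> rho \<phi> f v \<and>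
     0 \<le> defect \<phi> f u v \<and> defect \<phi> f u v \<le> rho \<phi> f u \<and> defect \<phi> f u v \<le> rho \<phi> f v \<and>
     defect \<phi> f u v \<le> (rho \<phi> f u / \<phi> u + rho \<phi> f v / \<phi> v) / 2"

text \<open>The numerical core of \<open>tame_step\<close>: \<open>x\<close>, \<open>y\<close>,
  \<open>n\<close> are the values at \<open>u\<close>, \<open>v\<close>, \<open>u + v\<close>,
  \<open>n'\<close> is the value at \<open>2 u + v\<close>, and \<open>d\<close>, \<open>d'\<close>
  are the old and new defects. The threshold \<open>13\<close> gives
  \<open>x * x / 2 - 1 \<ge> 6 * x\<close>, hence \<open>n' \<ge> 6 * x * y\<close>.\<close>

lemma tame_real:
  fixes x y n r d n' d' :: real
  assumes x: "x \<ge> 13" and y: "y \<ge> 13" and n: "n \<ge> x * y / 2" and d: "0 \<le> d" "d \<le> r"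
    and n': "n' = x * n - y" and d': "n' * d' = y * (2 * r + d)"
  shows "0 \<le> d'" "d' \<le> r / (2 * x)"
proof -
  have "x * x \<ge> 13 * x" using x by (intro mult_right_mono) auto
  then have "x * x / 2 - 1 \<ge> 6 * x" using x by linarith
  then have "y * (6 * x) \<le> y * (x * x / 2 - 1)" using y by (intro mult_left_mono) auto
  also have "\<dots> = x * (x * y / 2) - y" by (simp add: algebra_simps)
  also have "\<dots> \<le> n'" unfolding n' using n x by (intro diff_mono mult_left_mono) auto
  finally have le: "6 * x * y \<le> n'" by (simp add: mult.commute mult.left_commute)
  have xy: "x * y > 0" using x y by (intro mult_pos_pos) auto
  then have pos: "n' > 0" using le by linarith
  have "0 \<le> n' * d'" unfolding d' using y d by (intro mult_nonneg_nonneg) auto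
  then show d0: "0 \<le> d'" using pos by (simp add: zero_le_mult_iff)
  have "6 * x * y * d' \<le> n' * d'" using le d0 by (intro mult_right_mono)
  also have "\<dots> \<le> y * (3 * r)" unfolding d' using y d by (intro mult_left_mono) auto
  finally have "y * (6 * x * d') \<le> y * (3 * r)" by (simp add: mult.commute mult.left_commute)
  then have "6 * x * d' \<le> 3 * r" using y by simp
  then show "d' \<le> r / (2 * x)" using x by (simp add: field_simps)
qed

context geometric_markoff
begin

lemma phi_pos: "prim w \<Longrightarrow> \<phi> w > 0"
  using greater_2[of w] by simp

lemma rho_even: "deform_fun \<phi> f \<Longrightarrow> rho \<phi> f (- w) = rho \<phi> f w"
  by (simp add: rho_def)

text \<open>Substituting \<open>f = \<phi> * rho\<close> in the linearized relation and using
  \<open>\<phi> u * \<phi> v = \<phi> (u + v) + \<phi> (u - v)\<close> leaves only terms weighted by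
  \<open>\<phi> (u - v)\<close>, which far out is small compared with
  \<open>\<phi> (u + v)\<close>.\<close>

lemma defect_eq:
  assumes f: "deform_fun \<phi> f" and b: "basis u v"
  shows "\<phi> (u + v) * defect \<phi> f u v = \<phi> (u - v) * (rho \<phi> f u + rho \<phi> f v - rho \<phi> f (u - v))"
proof -
  have p: "prim u" "prim v" "prim (u + v)" "prim (u - v)"
    using basis_prim[OF b] basis_prim(1)[of "u + v" v] basis_prim(1)[of "u - v" v] b by simp_all
  have r: "f w = \<phi> w * rho \<phi> f w" if "prim w" for w
    using phi_pos[OF that] by (simp add: rho_def)
  have "\<phi> (u + v) * rho \<phi> f (u + v) = \<phi> u * \<phi> v * (rho \<phi> f u + rho \<phi> f v) - \<phi> (u - v) * rho \<phi> f (u - v)"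
    using deform_add[OF f b] unfolding r[OF p(1)] r[OF p(2)] r[OF p(3)] r[OF p(4)] by (simp add: algebra_simps)
  moreover have "\<phi> u * \<phi> v = \<phi> (u + v) + \<phi> (u - v)" using markoff_add[OF markoff b] by simp
  ultimately show ?thesis by (simp add: defect_def algebra_simps)
qed

lemma tame_commute: "tame \<phi> f u v \<longleftrightarrow> tame \<phi> f v u"
  unfolding tame_def defect_def basis_commute[of u v] outward_commute[of u v] add.commute[of u v]
  by (auto simp: algebra_simps)

text \<open>On the new edge the difference of the two vectors is \<open>- v\<close>, an old region,
  so \<open>defect_eq\<close> expresses the new defect by old data and bounds it by half of
  \<open>rho \<phi> f u / \<phi> u\<close>.\<close>

lemma tame_step:
  assumes f: "deform_fun \<phi> f" and t: "tame \<phi> f u v"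
  shows "tame \<phi> f u (u + v) \<and> tame \<phi> f (u + v) v"
proof -
  have *: "tame \<phi> f u (u + v)" if t: "tame \<phi> f u v" for u v
  proof -
    have b: "basis u v" and x: "\<phi> u \<ge> 13" and y: "\<phi> v \<ge> 13" and out: "outward \<phi> u v"
      and r: "0 \<le> rho \<phi> f u" "0 \<le> rho \<phi> f v" and d: "0 \<le> defect \<phi> f u v" "defect \<phi> f u v \<le> rho \<phi> f u"
      using t by (auto simp: tame_def)
    have b': "basis u (u + v)" using b by simp
    have "u - (u + v) = - v" by simp
    then have "\<phi> (u + (u + v)) * defect \<phi> f u (u + v) = \<phi> v * (2 * rho \<phi> f u + defect \<phi> f u v)"
      using defect_eq[OF f b'] rho_even[OF f, of v] even[of v] by (simp add: defect_def algebra_simps)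
    moreover have "\<phi> (u + (u + v)) = \<phi> u * \<phi> (u + v) - \<phi> v"
      using markoff_add[OF markoff b'] by simp
    moreover note outward_ge[OF b out]
    ultimately have d': "0 \<le> defect \<phi> f u (u + v)" "defect \<phi> f u (u + v) \<le> rho \<phi> f u / (2 * \<phi> u)"
      using tame_real[OF x y _ d] by blast+
    have n: "\<phi> (u + v) > \<phi> v" using outward_greater[OF b out] by simp
    have r': "rho \<phi> f (u + v) \<ge> rho \<phi> f u" using d r by (simp add: defect_def)
    have "rho \<phi> f u / (2 * \<phi> u) \<le> rho \<phi> f u / 1" using x r by (intro divide_left_mono) auto
    moreover have "rho \<phi> f (u + v) / \<phi> (u + v) \<ge> 0" using r r' n y by (intro divide_nonneg_pos) auto
    moreover have "rho \<phi> f u / (2 * \<phi> u) = (rho \<phi> f u / \<phi> u) / 2" by simp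
    ultimately have "defect \<phi> f u (u + v) \<le> rho \<phi> f u" "defect \<phi> f u (u + v) \<le> rho \<phi> f (u + v)"
      "defect \<phi> f u (u + v) \<le> (rho \<phi> f u / \<phi> u + rho \<phi> f (u + v) / \<phi> (u + v)) / 2"
      using d' r' by argo+
    then show ?thesis
      unfolding tame_def using b' x n y outward_step(1)[OF b out] r r' d' by simp
  qed
  have "tame \<phi> f v (v + u)" using * t tame_commute by blast
  then show ?thesis using *[OF t] tame_commute by (simp add: add.commute)
qed

lemma tangent_bounds:
  assumes "\<phi> w \<ge> 13" "rho \<phi> f w \<ge> 0"
  shows "rho \<phi> f w \<le> tangent \<phi> f w" "tangent \<phi> f w \<le> rho \<phi> f w * (1 + 1 / \<phi> w)"
proof -
  define x where "x = \<phi> w"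
  have x: "x \<ge> 13" using assms x_def by simp
  have "13\<^sup>2 \<le> x\<^sup>2" using x by (intro power_mono) auto
  then have s: "sqrt (x\<^sup>2 - 4) > 0" by simp
  have "sqrt (x\<^sup>2 - 4) \<le> sqrt (x\<^sup>2)" by (rule real_sqrt_le_mono) simp
  then have s1: "sqrt (x\<^sup>2 - 4) \<le> x" using x by simp
  have "x * x \<le> (x + 1) * sqrt (x\<^sup>2 - 4)"
  proof (rule power2_le_imp_le)
    \<comment> \<open>This is \<open>(x + 1)\<^sup>2 * (x\<^sup>2 - 4) - x ^ 4\<close>, divided
      successively by \<open>x - 13\<close> so that every term is visibly nonnegative.\<close>
    have "0 \<le> x\<^sup>2 * (x - 13) * 2 + x * (x - 13) * 23 + 291 * (x - 13) + 3779" using x by (intro add_nonneg_nonneg mult_nonneg_nonneg) auto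
    then have "(x * x)\<^sup>2 \<le> (x + 1)\<^sup>2 * (x\<^sup>2 - 4)"
      by (simp add: power2_eq_square algebra_simps)
    then show "(x * x)\<^sup>2 \<le> ((x + 1) * sqrt (x\<^sup>2 - 4))\<^sup>2"
      using \<open>13\<^sup>2 \<le> x\<^sup>2\<close> by (simp add: power_mult_distrib)
  qed (use x s in \<open>intro mult_nonneg_nonneg, auto\<close>)
  then have s2: "x / sqrt (x\<^sup>2 - 4) \<le> 1 + 1 / x" using s x by (simp add: field_simps)
  have t: "tangent \<phi> f w = rho \<phi> f w * (x / sqrt (x\<^sup>2 - 4))" using x by (simp add: tangent_def rho_def x_def)
  have "1 \<le> x / sqrt (x\<^sup>2 - 4)" using s s1 by (simp add: field_simps)
  then have "rho \<phi> f w * 1 \<le> rho \<phi> f w * (x / sqrt (x\<^sup>2 - 4))" using assms by (intro mult_left_mono) auto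
  then show "rho \<phi> f w \<le> tangent \<phi> f w" unfolding t by simp
  show "tangent \<phi> f w \<le> rho \<phi> f w * (1 + 1 / \<phi> w)"
    unfolding t x_def[symmetric] using s2 assms by (intro mult_left_mono) auto
qed

text \<open>This makes the upper bounds \<open>Vn\<close> decrease: one half of the correction terms
  \<open>rho / \<phi>\<close> of the old edge pays for the defect, the other half for the correction
  term at \<open>u + v\<close>.\<close>

lemma tame_upper:
  assumes "tame \<phi> f u v"
  shows "defect \<phi> f u v + rho \<phi> f (u + v) / \<phi> (u + v) \<le> rho \<phi> f u / \<phi> u + rho \<phi> f v / \<phi> v"
proof -
  have b: "basis u v" and x: "\<phi> u \<ge> 13" and y: "\<phi> v \<ge> 13" and out: "outward \<phi> u v"
    and r: "0 \<le> rho \<phi> f u" "0 \<le> rho \<phi> f v" and d: "defect \<phi> f u v \<le> rho \<phi> f u" "defect \<phi> f u v \<le> rho \<phi> f v"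
    "0 \<le> defect \<phi> f u v" "defect \<phi> f u v \<le> (rho \<phi> f u / \<phi> u + rho \<phi> f v / \<phi> v) / 2"
    using assms by (auto simp: tame_def)
  let ?x = "\<phi> u" and ?y = "\<phi> v" and ?r = "rho \<phi> f u" and ?s = "rho \<phi> f v"
  have xy: "?x * ?y > 0" using x y by (intro mult_pos_pos) auto
  have "rho \<phi> f (u + v) / \<phi> (u + v) \<le> (3 / 2 * (?r + ?s)) / (?x * ?y / 2)"
    using d r xy outward_ge[OF b out] by (intro frac_le) (auto simp: defect_def)
  also have "\<dots> = (3 / ?y) * (?r / ?x) + (3 / ?x) * (?s / ?y)"
    using x y by (simp add: field_simps)
  also have "\<dots> \<le> (1 / 2) * (?r / ?x) + (1 / 2) * (?s / ?y)"
    using x y r by (intro add_mono mult_right_mono) (auto simp: field_simps)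
  finally show ?thesis using d by simp
qed

end

lemma deform_on_deform_fun:
  assumes m: "markoff_fun \<phi>" and b: "basis U V"
  shows "deform_fun \<phi> (deform_on U V (\<phi> U, \<phi> V, \<phi> (U - V)) h)"
  unfolding deform_fun_def
proof (intro conjI allI impI)
  let ?\<tau> = "(\<phi> U, \<phi> V, \<phi> (U - V))"
  note d = deform_on_deform[OF b, of ?\<tau> h]
  fix u v
  show "deform_on U V ?\<tau> h (- u) = deform_on U V ?\<tau> h u" using d by simp
  assume uv: "basis u v"
  show "deform_on U V ?\<tau> h (u + v) + deform_on U V ?\<tau> h (u - v) =
      deform_on U V ?\<tau> h u * \<phi> v + \<phi> u * deform_on U V ?\<tau> h v"
    unfolding deform_add[OF d uv] markoff_eq_on[OF m b basis_prim(1)[OF uv]] markoff_eq_on[OF m b basis_prim(2)[OF uv]]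
    by simp
qed

lemma arcosh_half_derivative:
  fixes x :: real assumes "x > 2"
  shows "((\<lambda>x. arcosh (x / 2)) has_real_derivative 1 / sqrt (x\<^sup>2 - 4)) (at x)"
proof -
  have 1: "((\<lambda>x::real. x / 2) has_real_derivative 1 / 2) (at x)" by (rule DERIV_cdivide[OF DERIV_ident])
  have 2: "(arcosh has_real_derivative 1 / sqrt ((x / 2)\<^sup>2 - 1)) (at (x / 2))"
    using assms by (intro arcosh_real_has_field_derivative) simp
  have "sqrt ((x / 2)\<^sup>2 - 1) = sqrt ((x\<^sup>2 - 4) / 4)" by (simp add: power_divide diff_divide_distrib)
  also have "\<dots> = sqrt (x\<^sup>2 - 4) / 2" by (simp add: real_sqrt_divide)
  finally have eq: "sqrt ((x / 2)\<^sup>2 - 1) = sqrt (x\<^sup>2 - 4) / 2" .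
  show ?thesis using DERIV_chain2[OF 2 1] by (simp add: eq)
qed

lemma hlen_has_derivative:
  assumes "markoff_on U V \<tau> w > 2"
  shows "((\<lambda>\<tau>. hlen (markoff_on U V \<tau>) w) has_derivative
    (\<lambda>h. tangent (markoff_on U V \<tau>) (deform_on U V \<tau> h) w)) (at \<tau> within S)"
  using DERIV_compose_FDERIV[OF arcosh_half_derivative[OF assms]
      has_derivative_at_withinI[OF markoff_on_has_derivative]]
  by (simp add: hlen_def tangent_def)

lemma stable_norm_cong:
  assumes "\<And>w. prim w \<Longrightarrow> \<phi> w = \<psi> w" shows "stable_norm \<phi> = stable_norm \<psi>"
proof -
  have "dual_ball \<phi> = dual_ball \<psi>" using assms by (auto simp: dual_ball_def hlen_def)
  then show ?thesis by (simp add: stable_norm_def fun_eq_iff)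
qed

section \<open>Edges with three tame deformations\<close>

lemma geometric_on:
  assumes b: "basis U V" and "x > 2" "y > 2" "z > 2" "x\<^sup>2 + y\<^sup>2 + z\<^sup>2 - x * y * z - 2 < 2"
  shows "geometric (markoff_on U V (x, y, z))"
  using markoff_on_base[OF b, of x y z] assms
  by (intro geometric_of_triple[OF markoff_on_markoff[OF b] b]) (simp_all add: kappa_def)

text \<open>An open condition on the values at \<open>U\<close>, \<open>V\<close>,
  \<open>U - V\<close>. The last inequality says that \<open>z / (x * y - z)\<close> is less than
  \<open>(1 / x + 1 / y) / 2\<close>, which yields the last bound on the defect in
  \<open>tame\<close>.\<close>

definition entry :: "real \<times> real \<times> real \<Rightarrow> bool" where
  "entry \<tau> = (case \<tau> of (x, y, z) \<Rightarrow> 13 < x \<and> 13 < y \<and> 2 < z \<and> x\<^sup>2 + y\<^sup>2 + z\<^sup>2 - x * y * z - 2 < 2 \<and>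
     2 * z < x * y \<and> 2 * (z * (x * y)) < (x * y - z) * (x + y))"

lemma open_entry: "open {\<tau>. entry \<tau>}"
  unfolding entry_def case_prod_beta
  by (intro open_Collect_conj open_Collect_less continuous_intros)

text \<open>In these three independent directions \<open>rho\<close> takes the values
  \<open>(1, 1, 1)\<close>, \<open>(1, 1, 2)\<close>, \<open>(2, 1, 2)\<close> at \<open>U\<close>,
  \<open>V\<close>, \<open>U - V\<close>. By \<open>defect_eq\<close> the defects are
  \<open>k\<close>, \<open>0\<close>, \<open>k\<close> with
  \<open>k = z / (x * y - z) \<le> 1\<close>.\<close>

lemma tame_entry:
  assumes b: "basis U V" and e: "entry (x, y, z)" and f: "deform_fun (markoff_on U V (x, y, z)) f"
    and r: "(f U, f V, f (U - V)) \<in> {(x, y, z), (x, y, 2 * z), (2 * x, y, 2 * z)}"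
  shows "tame (markoff_on U V (x, y, z)) f U V"
proof -
  have e': "13 < x" "13 < y" "2 < z" "x\<^sup>2 + y\<^sup>2 + z\<^sup>2 - x * y * z - 2 < 2"
     "2 * z < x * y" "2 * (z * (x * y)) < (x * y - z) * (x + y)"
    using e by (auto simp: entry_def)
  let ?\<psi> = "markoff_on U V (x, y, z)"
  interpret geometric_markoff ?\<psi> using e' by unfold_locales (intro geometric_on b; simp)
  have v: "?\<psi> U = x" "?\<psi> V = y" "?\<psi> (U - V) = z" "?\<psi> (U + V) = x * y - z"
    using markoff_on_base[OF b, of x y z] markoff_add[OF markoff b] by simp_all
  have rs: "rho ?\<psi> f U = f U / x" "rho ?\<psi> f V = f V / y" "rho ?\<psi> f (U - V) = f (U - V) / z"
    unfolding rho_def v by simp_all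
  have n: "x * y - z > 0" using e' by simp
  define k where "k = z / (x * y - z)"
  have k: "0 \<le> k" "k \<le> 1" using e' n by (simp_all add: k_def)
  have k2: "k \<le> (1 / x + 1 / y) / 2"
  proof -
    have "(1 / x + 1 / y) / 2 = (x + y) / (2 * (x * y))" using e' by (simp add: field_simps)
    moreover have "x * y > 0" using e' by simp
    ultimately show ?thesis using e' n by (simp add: k_def divide_le_eq pos_le_divide_eq field_simps)
  qed
  have D: "defect ?\<psi> f U V = k * (f U / x + f V / y - f (U - V) / z)"
    using defect_eq[OF f b] n unfolding v rs k_def by (simp add: field_simps)
  have "1 / x \<ge> 0" "1 / y \<ge> 0" "1 / x \<le> 2 / x" using e' by (simp_all add: divide_right_mono)
  then show ?thesis
    unfolding tame_def D rs v outward_def using r e' b k k2 by auto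
qed

section \<open>Convergence of the derivatives along a path\<close>

context farey_path
begin

text \<open>The derivative of the \<open>n\<close>-th approximant
  \<open>p n * hlen \<phi> (X n) + q n * hlen \<phi> (Y n)\<close> of the norm. For tame
  \<open>f\<close> it is enclosed by the monotone sequences \<open>Sn\<close> and
  \<open>Vn\<close>.\<close>

definition Tn :: "(int \<times> int \<Rightarrow> real) \<Rightarrow> (int \<times> int \<Rightarrow> real) \<Rightarrow> nat \<Rightarrow> real" where
  "Tn \<phi> f n = p n * tangent \<phi> f (X n) + q n * tangent \<phi> f (Y n)"

definition Sn :: "(int \<times> int \<Rightarrow> real) \<Rightarrow> (int \<times> int \<Rightarrow> real) \<Rightarrow> nat \<Rightarrow> real" where
  "Sn \<phi> f n = p n * rho \<phi> f (X n) + q n * rho \<phi> f (Y n)"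

definition Vn :: "(int \<times> int \<Rightarrow> real) \<Rightarrow> (int \<times> int \<Rightarrow> real) \<Rightarrow> nat \<Rightarrow> real" where
  "Vn \<phi> f n = p n * (rho \<phi> f (X n) * (1 + 1 / \<phi> (X n))) + q n * (rho \<phi> f (Y n) * (1 + 1 / \<phi> (Y n)))"

lemma tame_path:
  assumes "geometric \<phi>" "deform_fun \<phi> f" "tame \<phi> f (X 0) (Y 0)"
  shows "tame \<phi> f (X n) (Y n)"
proof -
  interpret geometric_markoff \<phi> by unfold_locales fact
  show ?thesis by (rule path_invariant) (use assms tame_step in auto)
qed

text \<open>At each step \<open>Sn\<close> gains a weight times the defect, and \<open>Vn\<close>
  loses a weight times the slack in \<open>tame_upper\<close>; both are nonnegative.\<close>

lemma enclosure:
  assumes g: "geometric \<phi>" and f: "deform_fun \<phi> f" and t: "tame \<phi> f (X 0) (Y 0)"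
  shows "m \<le> n \<Longrightarrow> Sn \<phi> f m \<le> Sn \<phi> f n" "m \<le> n \<Longrightarrow> Vn \<phi> f n \<le> Vn \<phi> f m"
    "Sn \<phi> f n \<le> Tn \<phi> f n" "Tn \<phi> f n \<le> Vn \<phi> f n"
proof -
  interpret geometric_markoff \<phi> by unfold_locales fact
  note tn = tame_path[OF g f t]
  have d: "0 \<le> defect \<phi> f (X n) (Y n)" and r: "13 \<le> \<phi> (X n)" "13 \<le> \<phi> (Y n)" "0 \<le> rho \<phi> f (X n)" "0 \<le> rho \<phi> f (Y n)" for n
    using tn[of n] by (auto simp: tame_def)
  have S: "Sn \<phi> f n \<le> Sn \<phi> f (Suc n)" for n
  proof -
    have "Sn \<phi> f (Suc n) = Sn \<phi> f n + q n * defect \<phi> f (X n) (Y n) \<or> Sn \<phi> f (Suc n) = Sn \<phi> f n + p n * defect \<phi> f (X n) (Y n)"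
      using step[of n]
    proof (elim disjE conjE)
      assume s: "X (Suc n) = X n" "Y (Suc n) = X n + Y n" "p (Suc n) = p n - q n" "q (Suc n) = q n"
      show ?thesis unfolding Sn_def defect_def s by (simp add: algebra_simps)
    next
      assume s: "X (Suc n) = X n + Y n" "Y (Suc n) = Y n" "p (Suc n) = p n" "q (Suc n) = q n - p n"
      show ?thesis unfolding Sn_def defect_def s by (simp add: algebra_simps)
    qed
    then show ?thesis using d[of n] pos[of n] by (metis add_increasing2 less_imp_le mult_nonneg_nonneg order_refl)
  qed
  then show "m \<le> n \<Longrightarrow> Sn \<phi> f m \<le> Sn \<phi> f n" using lift_Suc_mono_le[of "Sn \<phi> f"] by blast
  have U: "Vn \<phi> f (Suc n) \<le> Vn \<phi> f n" for n
  proof -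
    let ?d = "rho \<phi> f (X n) / \<phi> (X n) + rho \<phi> f (Y n) / \<phi> (Y n) - defect \<phi> f (X n) (Y n) - rho \<phi> f (X n + Y n) / \<phi> (X n + Y n)"
    have "?d \<ge> 0" using tame_upper[OF tn, of n] by simp
    moreover have "Vn \<phi> f (Suc n) = Vn \<phi> f n - q n * ?d \<or> Vn \<phi> f (Suc n) = Vn \<phi> f n - p n * ?d"
      using step[of n]
    proof (elim disjE conjE)
      assume s: "X (Suc n) = X n" "Y (Suc n) = X n + Y n" "p (Suc n) = p n - q n" "q (Suc n) = q n"
      show ?thesis unfolding Vn_def defect_def s
        by (rule disjI1) (simp add: algebra_simps add_divide_distrib diff_divide_distrib)
    next
      assume s: "X (Suc n) = X n + Y n" "Y (Suc n) = Y n" "p (Suc n) = p n" "q (Suc n) = q n - p n"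
      show ?thesis unfolding Vn_def defect_def s
        by (rule disjI2) (simp add: algebra_simps add_divide_distrib diff_divide_distrib)
    qed
    moreover have "q n * ?d \<ge> 0" "p n * ?d \<ge> 0"
      using pos[of n] \<open>?d \<ge> 0\<close> by (intro mult_nonneg_nonneg; simp)+
    ultimately show ?thesis by linarith
  qed
  then show "m \<le> n \<Longrightarrow> Vn \<phi> f n \<le> Vn \<phi> f m" using lift_Suc_antimono_le[of "Vn \<phi> f"] by blast
  show "Sn \<phi> f n \<le> Tn \<phi> f n" "Tn \<phi> f n \<le> Vn \<phi> f n"
    unfolding Sn_def Tn_def Vn_def using tangent_bounds[of _ f] r[of n] pos[of n]
    by (intro add_mono mult_left_mono; simp)+
qed

text \<open>The width at \<open>N\<close> is the weighted sum of \<open>rho / \<phi>\<close>, hence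
  at most \<open>Sn \<phi> f N / B\<close>. By monotonicity \<open>Sn \<phi> f N\<close> is at most
  the initial \<open>Vn\<close>, and \<open>rho \<le> 2\<close> with
  \<open>1 + 1 / \<phi> \<le> 2\<close> bounds the latter by \<open>4 * (p 0 + q 0)\<close>.\<close>

lemma enclosure_width:
  assumes g: "geometric \<phi>" and f: "deform_fun \<phi> f" and t: "tame \<phi> f (X 0) (Y 0)"
    and r: "rho \<phi> f (X 0) \<le> 2" "rho \<phi> f (Y 0) \<le> 2"
    and B: "\<phi> (X N) \<ge> B" "\<phi> (Y N) \<ge> B" "B > 0" and mn: "N \<le> m" "N \<le> n"
  shows "\<bar>Tn \<phi> f m - Tn \<phi> f n\<bar> \<le> 4 * (p 0 + q 0) / B"
proof -
  note e = enclosure[OF g f t]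
  have r0: "13 \<le> \<phi> (X n)" "13 \<le> \<phi> (Y n)" "0 \<le> rho \<phi> f (X n)" "0 \<le> rho \<phi> f (Y n)" for n
    using tame_path[OF g f t, of n] by (auto simp: tame_def)
  have "\<bar>Tn \<phi> f m - Tn \<phi> f n\<bar> \<le> Vn \<phi> f N - Sn \<phi> f N"
    using e(1)[OF mn(1)] e(1)[OF mn(2)] e(2)[OF mn(1)] e(2)[OF mn(2)] e(3)[of m] e(3)[of n] e(4)[of m] e(4)[of n]
    by linarith
  also have "\<dots> = p N * (rho \<phi> f (X N) / \<phi> (X N)) + q N * (rho \<phi> f (Y N) / \<phi> (Y N))"
    by (simp add: Vn_def Sn_def algebra_simps)
  also have "\<dots> \<le> p N * (rho \<phi> f (X N) / B) + q N * (rho \<phi> f (Y N) / B)"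
    using pos[of N] B r0[of N] by (intro add_mono mult_left_mono divide_left_mono mult_pos_pos) auto
  also have "\<dots> = Sn \<phi> f N / B" by (simp add: Sn_def add_divide_distrib)
  also have "\<dots> \<le> Vn \<phi> f 0 / B"
    using e(1)[of N N] e(3)[of N] e(4)[of N] e(2)[of 0 N] B by (intro divide_right_mono) linarith+
  also have "Vn \<phi> f 0 \<le> p 0 * (2 * 2) + q 0 * (2 * 2)"
    unfolding Vn_def using r r0[of 0] pos[of 0]
    by (intro add_mono mult_left_mono mult_mono) (auto simp: field_simps)
  finally show ?thesis using B by (simp add: divide_right_mono algebra_simps)
qed

lemma uniform_Cauchy:
  assumes "\<epsilon> > 0"
  obtains N where "\<And>\<tau> h m n. entry \<tau> \<Longrightarrow> N \<le> m \<Longrightarrow> N \<le> n \<Longrightarrow>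
    \<bar>Tn (markoff_on (X 0) (Y 0) \<tau>) (deform_on (X 0) (Y 0) \<tau> h) m
      - Tn (markoff_on (X 0) (Y 0) \<tau>) (deform_on (X 0) (Y 0) \<tau> h) n\<bar> \<le> \<epsilon> * norm h"
proof -
  \<comment> \<open>\<open>36 = 4 * 9\<close>: the \<open>4\<close> comes from
    \<open>enclosure_width\<close>, the \<open>9\<close> bounds the coefficients of \<open>h\<close>
    in the three tame directions.\<close>
  define B where "B = 36 * (p 0 + q 0) / \<epsilon>"
  have B: "B > 0" using pos assms by (simp add: B_def add_pos_pos)
  obtain N where N: "\<And>\<phi> m. geometric \<phi> \<Longrightarrow> outward \<phi> (X 0) (Y 0) \<Longrightarrow> \<phi> (X 0) \<ge> 2 * (13 / 2) \<Longrightarrow> \<phi> (Y 0) \<ge> 2 * (13 / 2)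
    \<Longrightarrow> m \<ge> N \<Longrightarrow> \<phi> (X m) \<ge> B \<and> \<phi> (Y m) \<ge> B"
    using growth_uniform[of "13 / 2" B] by auto
  show ?thesis
  proof (rule that[of N])
    fix \<tau> h :: "real \<times> real \<times> real" and m n
    assume e: "entry \<tau>" and mn: "N \<le> m" "N \<le> n"
    obtain x y z where \<tau>: "\<tau> = (x, y, z)" by (metis prod_cases3)
    obtain h1 h2 h3 where h: "h = (h1, h2, h3)" by (metis prod_cases3)
    let ?U = "X 0" and ?V = "Y 0"
    let ?\<psi> = "markoff_on ?U ?V \<tau>" and ?F = "\<lambda>h. deform_on ?U ?V \<tau> h"
    note b = basis[of 0]
    have e': "13 < x" "13 < y" "2 < z" "x\<^sup>2 + y\<^sup>2 + z\<^sup>2 - x * y * z - 2 < 2" "2 * z < x * y"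
      using e by (auto simp: entry_def \<tau>)
    have g: "geometric ?\<psi>" unfolding \<tau> using e' by (intro geometric_on b) auto
    then interpret geometric_markoff ?\<psi> by unfold_locales
    have v: "?\<psi> ?U = x" "?\<psi> ?V = y" "?\<psi> (?U - ?V) = z"
      using markoff_on_base[OF b] by (simp_all add: \<tau>)
    have out: "outward ?\<psi> ?U ?V" unfolding outward_def markoff_add[OF markoff b] v using e' by simp
    have NB: "?\<psi> (X N) \<ge> B \<and> ?\<psi> (Y N) \<ge> B" using N[OF g out] v e' by simp
    have width: "\<bar>Tn ?\<psi> (?F r) m - Tn ?\<psi> (?F r) n\<bar> \<le> 4 * (p 0 + q 0) / B"
      if r: "r \<in> {(x, y, z), (x, y, 2 * z), (2 * x, y, 2 * z)}" for r
    proof -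
      obtain r1 r2 r3 where r': "r = (r1, r2, r3)" by (metis prod_cases3)
      have fr: "?F r ?U = r1" "?F r ?V = r2" "?F r (?U - ?V) = r3"
        unfolding r' using deform_on_base[OF b] by simp_all
      have d: "deform_fun ?\<psi> (?F r)" by (rule deform_on_deform[OF b])
      have "tame ?\<psi> (?F r) ?U ?V"
        using tame_entry[OF b e[unfolded \<tau>], of "?F r"] d r fr unfolding \<tau> r' by simp
      moreover have "rho ?\<psi> (?F r) ?U \<le> 2" "rho ?\<psi> (?F r) ?V \<le> 2"
        unfolding rho_def v fr using r e' unfolding r' by auto
      ultimately show ?thesis using enclosure_width[OF g d] NB B mn by blast
    qed
    \<comment> \<open>The coefficients of \<open>h\<close> in the three tame directions. The
      quotients \<open>h1 / x\<close>, \<open>h2 / y\<close>, \<open>h3 / z\<close> are at most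
      \<open>norm h\<close> in absolute value, so \<open>c1\<close>, \<open>c2\<close>,
      \<open>c3\<close> are at most \<open>5\<close>, \<open>2\<close>, \<open>2\<close> times
      \<open>norm h\<close>.\<close>
    define c3 c2 c1 where "c3 = h1 / x - h2 / y" and "c2 = h3 / z - h1 / x" and "c1 = h2 / y - c2 - c3"
    have nh: "\<bar>h1\<bar> \<le> norm h" "\<bar>h2\<bar> \<le> norm h" "\<bar>h3\<bar> \<le> norm h"
      unfolding h using norm_fst_le[of h1 "(h2, h3)"] norm_snd_le[of "(h2, h3)" h1] norm_fst_le[of h2 h3] norm_snd_le[of h3 h2]
      by (simp_all del: norm_Pair)
    have dv: "\<bar>k / w\<bar> \<le> norm h" if "\<bar>k\<bar> \<le> norm h" "w > 2" for k w
    proof -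
      have "\<bar>k / w\<bar> \<le> \<bar>k\<bar> / 1" unfolding abs_divide using that by (intro divide_left_mono) auto
      then show ?thesis using that by simp
    qed
    have "\<bar>h1 / x\<bar> \<le> norm h" "\<bar>h2 / y\<bar> \<le> norm h" "\<bar>h3 / z\<bar> \<le> norm h" using dv nh e' by auto
    then have c: "\<bar>c1\<bar> + \<bar>c2\<bar> + \<bar>c3\<bar> \<le> 9 * norm h" unfolding c1_def c2_def c3_def by linarith
    have "h = c1 *\<^sub>R (x, y, z) + c2 *\<^sub>R (x, y, 2 * z) + c3 *\<^sub>R (2 * x, y, 2 * z)"
    proof -
      have "h1 = (c1 + c2 + 2 * c3) * x" "h2 = (c1 + c2 + c3) * y" "h3 = (c1 + 2 * c2 + 2 * c3) * z"
        using e' by (simp_all add: c1_def c2_def c3_def)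
      then show ?thesis by (simp add: h algebra_simps)
    qed
    then have hh: "h = c1 *\<^sub>R (x, y, z) + c2 *\<^sub>R (x, y, 2 * z) + c3 *\<^sub>R (2 * x, y, 2 * z)" .
    have fw: "?F h w = 1 * (c1 * ?F (x, y, z) w + c2 * ?F (x, y, 2 * z) w) + c3 * ?F (2 * x, y, 2 * z) w" for w
      unfolding hh by (simp only: linear_add[OF deform_on_linear] linear_scale[OF deform_on_linear] real_scaleR_def mult_1)
    have Teq: "Tn ?\<psi> (?F h) k = c1 * Tn ?\<psi> (?F (x, y, z)) k + c2 * Tn ?\<psi> (?F (x, y, 2 * z)) k
        + c3 * Tn ?\<psi> (?F (2 * x, y, 2 * z)) k" for k
      unfolding Tn_def tangent_def fw by (simp add: algebra_simps add_divide_distrib)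
    define W where "W = 4 * (p 0 + q 0) / B"
    have le: "\<bar>c * t\<bar> \<le> \<bar>c\<bar> * W" if "\<bar>t\<bar> \<le> W" for c t
      using that by (simp add: abs_mult mult_left_mono)
    have "\<bar>Tn ?\<psi> (?F h) m - Tn ?\<psi> (?F h) n\<bar> \<le> \<bar>c1\<bar> * W + \<bar>c2\<bar> * W + \<bar>c3\<bar> * W"
    proof -
      let ?t = "\<lambda>r. Tn ?\<psi> (?F r) m - Tn ?\<psi> (?F r) n"
      have "?t h = c1 * ?t (x, y, z) + c2 * ?t (x, y, 2 * z) + c3 * ?t (2 * x, y, 2 * z)"
        unfolding Teq by (simp add: algebra_simps)
      moreover have "\<bar>c1 * ?t (x, y, z)\<bar> \<le> \<bar>c1\<bar> * W" "\<bar>c2 * ?t (x, y, 2 * z)\<bar> \<le> \<bar>c2\<bar> * W"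
        "\<bar>c3 * ?t (2 * x, y, 2 * z)\<bar> \<le> \<bar>c3\<bar> * W"
        by (rule le, rule width[folded W_def], simp)+
      ultimately show ?thesis by linarith
    qed
    also have "\<dots> = (\<bar>c1\<bar> + \<bar>c2\<bar> + \<bar>c3\<bar>) * W" by (simp add: algebra_simps)
    also have "\<dots> \<le> 9 * norm h * W" using c B pos[of 0] by (intro mult_right_mono) (auto simp: W_def)
    also have "\<dots> = \<epsilon> * norm h" using pos[of 0] assms by (simp add: W_def B_def field_simps)
    finally show "\<bar>Tn ?\<psi> (?F h) m - Tn ?\<psi> (?F h) n\<bar> \<le> \<epsilon> * norm h" .
  qed
qed

text \<open>The index in \<open>uniform_Cauchy\<close> depends neither on the triple nor on the
  direction, so on a ball of entry triples the derivatives of the approximants converge uniformly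
  and the limit may be differentiated.\<close>

lemma stable_norm_differentiable:
  assumes e: "entry \<tau>"
  obtains S g' where "open S" "\<tau> \<in> S" "\<And>\<sigma>. \<sigma> \<in> S \<Longrightarrow> entry \<sigma>"
    "((\<lambda>\<sigma>. stable_norm (markoff_on (X 0) (Y 0) \<sigma>) \<mu>) has_derivative g') (at \<tau>)"
    "\<And>h. (\<lambda>n. Tn (markoff_on (X 0) (Y 0) \<tau>) (deform_on (X 0) (Y 0) \<tau> h) n) \<longlonglongrightarrow> g' h"
proof -
  let ?\<psi> = "markoff_on (X 0) (Y 0)" and ?F = "deform_on (X 0) (Y 0)"
  note b = basis[of 0]
  obtain r where r: "r > 0" "ball \<tau> r \<subseteq> {\<tau>. entry \<tau>}"
    using open_entry e by (metis mem_Collect_eq openE)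
  define S where "S = ball \<tau> r"
  have S: "convex S" "open S" "\<tau> \<in> S" "\<And>\<sigma>. \<sigma> \<in> S \<Longrightarrow> entry \<sigma>" using r by (auto simp: S_def)
  have geo: "geometric (?\<psi> \<sigma>)" if "\<sigma> \<in> S" for \<sigma>
    using S(4)[OF that] unfolding entry_def by (cases \<sigma>) (auto intro!: geometric_on[OF b])
  define g' where "g' \<sigma> h = lim (\<lambda>n. Tn (?\<psi> \<sigma>) (?F \<sigma> h) n)" for \<sigma> h
  have conv: "(\<lambda>n. Tn (?\<psi> \<sigma>) (?F \<sigma> h) n) \<longlonglongrightarrow> g' \<sigma> h" if "\<sigma> \<in> S" for \<sigma> h
  proof -
    have "Cauchy (\<lambda>n. Tn (?\<psi> \<sigma>) (?F \<sigma> h) n)"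
    proof (rule CauchyI)
      fix \<epsilon> :: real assume "\<epsilon> > 0"
      define \<eta> where "\<eta> = \<epsilon> / (norm h + 1)"
      have n1: "norm h + 1 > 0" by (simp add: add_nonneg_pos)
      then have \<eta>: "\<eta> > 0" using \<open>\<epsilon> > 0\<close> by (simp add: \<eta>_def)
      obtain N where N: "\<And>\<tau> h m n. entry \<tau> \<Longrightarrow> N \<le> m \<Longrightarrow> N \<le> n \<Longrightarrow>
        \<bar>Tn (?\<psi> \<tau>) (?F \<tau> h) m - Tn (?\<psi> \<tau>) (?F \<tau> h) n\<bar> \<le> \<eta> * norm h"
        using uniform_Cauchy[OF \<eta>] by blast
      have "\<eta> * norm h < \<eta> * (norm h + 1)" using \<eta> by simp
      also have "\<dots> = \<epsilon>" using n1 by (simp add: \<eta>_def)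
      finally have "\<eta> * norm h < \<epsilon>" .
      then show "\<exists>M. \<forall>m\<ge>M. \<forall>n\<ge>M. norm (Tn (?\<psi> \<sigma>) (?F \<sigma> h) m - Tn (?\<psi> \<sigma>) (?F \<sigma> h) n) < \<epsilon>"
        using N[OF S(4)[OF that]] unfolding real_norm_def by (meson le_less_trans)
    qed
    then show ?thesis unfolding g'_def using Cauchy_convergent convergent_LIMSEQ_iff by blast
  qed
  have "\<exists>g. \<forall>\<sigma>\<in>S. (\<lambda>n. p n * hlen (?\<psi> \<sigma>) (X n) + q n * hlen (?\<psi> \<sigma>) (Y n)) \<longlonglongrightarrow> g \<sigma> \<and> (g has_derivative g' \<sigma>) (at \<sigma> within S)"
  proof (rule has_derivative_sequence[OF S(1)])
    show "((\<lambda>\<sigma>. p n * hlen (?\<psi> \<sigma>) (X n) + q n * hlen (?\<psi> \<sigma>) (Y n)) has_derivative (\<lambda>h. Tn (?\<psi> \<sigma>) (?F \<sigma> h) n)) (at \<sigma> within S)"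
      if "\<sigma> \<in> S" for n \<sigma>
    proof -
      interpret geometric_markoff "?\<psi> \<sigma>" using geo[OF that] by unfold_locales
      show ?thesis unfolding Tn_def
        by (intro has_derivative_add has_derivative_mult_right hlen_has_derivative greater_2 prim_X prim_Y)
    qed
    show "\<forall>\<^sub>F n in sequentially. \<forall>\<sigma>\<in>S. \<forall>h. norm (Tn (?\<psi> \<sigma>) (?F \<sigma> h) n - g' \<sigma> h) \<le> \<epsilon> * norm h" if \<epsilon>: "\<epsilon> > 0" for \<epsilon>
    proof -
      obtain N where N: "\<And>\<tau> h m n. entry \<tau> \<Longrightarrow> N \<le> m \<Longrightarrow> N \<le> n \<Longrightarrow>
        \<bar>Tn (?\<psi> \<tau>) (?F \<tau> h) m - Tn (?\<psi> \<tau>) (?F \<tau> h) n\<bar> \<le> \<epsilon> * norm h"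
        using uniform_Cauchy[OF \<epsilon>] by blast
      have "norm (Tn (?\<psi> \<sigma>) (?F \<sigma> h) n - g' \<sigma> h) \<le> \<epsilon> * norm h" if "n \<ge> N" "\<sigma> \<in> S" for n \<sigma> h
      proof (rule Lim_bounded)
        show "(\<lambda>m. norm (Tn (?\<psi> \<sigma>) (?F \<sigma> h) n - Tn (?\<psi> \<sigma>) (?F \<sigma> h) m)) \<longlonglongrightarrow> norm (Tn (?\<psi> \<sigma>) (?F \<sigma> h) n - g' \<sigma> h)"
          by (intro tendsto_intros conv that)
        show "\<forall>m\<ge>N. norm (Tn (?\<psi> \<sigma>) (?F \<sigma> h) n - Tn (?\<psi> \<sigma>) (?F \<sigma> h) m) \<le> \<epsilon> * norm h"
          using N[OF S(4)[OF that(2)] that(1)] by simp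
      qed
      then show ?thesis unfolding eventually_sequentially by blast
    qed
    show "\<tau> \<in> S" by (rule S(3))
    show "(\<lambda>n. p n * hlen (?\<psi> \<tau>) (X n) + q n * hlen (?\<psi> \<tau>) (Y n)) \<longlonglongrightarrow> stable_norm (?\<psi> \<tau>) \<mu>"
      by (rule stable_norm_limit[OF geo[OF S(3)]])
  qed
  then obtain g where g: "\<And>\<sigma>. \<sigma> \<in> S \<Longrightarrow> (\<lambda>n. p n * hlen (?\<psi> \<sigma>) (X n) + q n * hlen (?\<psi> \<sigma>) (Y n)) \<longlonglongrightarrow> g \<sigma>"
    "\<And>\<sigma>. \<sigma> \<in> S \<Longrightarrow> (g has_derivative g' \<sigma>) (at \<sigma> within S)" by blast
  have geq: "stable_norm (?\<psi> \<sigma>) \<mu> = g \<sigma>" if "\<sigma> \<in> S" for \<sigma>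
    using LIMSEQ_unique[OF stable_norm_limit[OF geo[OF that]] g(1)[OF that]] .
  have "((\<lambda>\<sigma>. stable_norm (?\<psi> \<sigma>) \<mu>) has_derivative g' \<tau>) (at \<tau> within S)"
    by (rule has_derivative_transform[OF S(3) geq g(2)[OF S(3)]])
  then have "((\<lambda>\<sigma>. stable_norm (?\<psi> \<sigma>) \<mu>) has_derivative g' \<tau>) (at \<tau>)"
    by (simp only: at_within_open[OF S(3,2)])
  then show ?thesis using that[OF S(2-4)] conv[OF S(3)] by blast
qed

text \<open>A path of Markoff functions is determined by its values on one triple. These form a
  curve in three-space that is differentiable at \<open>0\<close>, so the chain rule applies
  although differentiability of the path is assumed at \<open>0\<close> only.\<close>

lemma stable_norm_path_derivative_entry:
  assumes m: "\<And>t. markoff_fun (\<psi> t)" and e: "entry (\<phi> (X 0), \<phi> (Y 0), \<phi> (X 0 - Y 0))" and \<phi>: "markoff_fun \<phi>"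
    and \<psi>0: "\<And>w. prim w \<Longrightarrow> \<psi> 0 w = \<phi> w"
    and \<psi>': "\<And>w. prim w \<Longrightarrow> ((\<lambda>t. \<psi> t w) has_real_derivative f w) (at 0)" and f: "deform_fun \<phi> f"
  obtains D where "((\<lambda>t. stable_norm (\<psi> t) \<mu>) has_real_derivative D) (at 0)" "(\<lambda>n. Tn \<phi> f n) \<longlonglongrightarrow> D"
proof -
  note b = basis[of 0]
  define \<tau> where "\<tau> = (\<phi> (X 0), \<phi> (Y 0), \<phi> (X 0 - Y 0))"
  define h where "h = (f (X 0), f (Y 0), f (X 0 - Y 0))"
  define \<sigma> where "\<sigma> t = (\<psi> t (X 0), \<psi> t (Y 0), \<psi> t (X 0 - Y 0))" for t
  obtain S g' where S: "open S" "\<tau> \<in> S" "\<And>\<sigma>. \<sigma> \<in> S \<Longrightarrow> entry \<sigma>"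
    and g': "((\<lambda>\<sigma>. stable_norm (markoff_on (X 0) (Y 0) \<sigma>) \<mu>) has_derivative g') (at \<tau>)"
    and lim: "\<And>h. (\<lambda>n. Tn (markoff_on (X 0) (Y 0) \<tau>) (deform_on (X 0) (Y 0) \<tau> h) n) \<longlonglongrightarrow> g' h"
    using stable_norm_differentiable[OF e[folded \<tau>_def]] by blast
  have pr: "prim (X 0)" "prim (Y 0)" "prim (X 0 - Y 0)"
    using basis_prim[OF b] basis_prim(1)[of "X 0 - Y 0" "Y 0"] b by simp_all
  have \<sigma>0: "\<sigma> 0 = \<tau>" using \<psi>0 pr by (simp add: \<sigma>_def \<tau>_def)
  have "(\<sigma> has_derivative (\<lambda>s. (s * f (X 0), s * f (Y 0), s * f (X 0 - Y 0)))) (at 0)"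
    unfolding \<sigma>_def
    using \<psi>' pr by (intro has_derivative_Pair) (simp_all add: has_field_derivative_def mult_commute_abs)
  then have \<sigma>': "(\<sigma> has_derivative (\<lambda>s. s *\<^sub>R h)) (at 0)" by (simp add: h_def)
  have "((\<lambda>t. stable_norm (markoff_on (X 0) (Y 0) (\<sigma> t)) \<mu>) has_derivative (\<lambda>s. g' (s *\<^sub>R h))) (at 0)"
    by (rule has_derivative_compose[OF \<sigma>', unfolded \<sigma>0, OF g'])
  moreover have "g' (s *\<^sub>R h) = g' h * s" for s
    using linear_scale[OF has_derivative_linear[OF g']] by simp
  moreover have "stable_norm (markoff_on (X 0) (Y 0) (\<sigma> t)) = stable_norm (\<psi> t)" for t
    unfolding \<sigma>_def by (rule stable_norm_cong) (simp add: markoff_eq_on[OF m b, symmetric])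
  ultimately have "((\<lambda>t. stable_norm (\<psi> t) \<mu>) has_real_derivative g' h) (at 0)"
    by (simp add: has_field_derivative_def)
  moreover have "Tn (markoff_on (X 0) (Y 0) \<tau>) (deform_on (X 0) (Y 0) \<tau> h) n = Tn \<phi> f n" for n
    unfolding Tn_def tangent_def \<tau>_def h_def
    by (simp add: markoff_eq_on[OF \<phi> b, symmetric] deform_eq_on[OF f \<phi> b, symmetric] prim_X prim_Y)
  ultimately show ?thesis using that lim[of h] by simp
qed

lemma entry_exists:
  assumes g: "geometric \<phi>"
  obtains n where "entry (\<phi> (X n), \<phi> (Y n), \<phi> (X n - Y n))"
proof -
  interpret geometric_markoff \<phi> by unfold_locales fact
  obtain k where k: "\<And>m. m \<ge> k \<Longrightarrow> outward \<phi> (X m) (Y m) \<and> \<phi> (X m) \<ge> 14 \<and> \<phi> (Y m) \<ge> 14"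
    using far_edge[OF g] by blast
  \<comment> \<open>\<open>x\<close> is the value at the vector kept, \<open>n\<close> at the new
    one, and \<open>y\<close> at the one dropped, which becomes the third value. The threshold
    \<open>14\<close> leaves room for the strict \<open>13\<close> of \<open>entry\<close>.\<close>
  have *: "2 * y < x * n \<and> 2 * (y * (x * n)) < (x * n - y) * (x + n)"
    if x: "x \<ge> 14" and y: "y \<ge> 14" and n: "n \<ge> x * y / 2" for x y n :: real
  proof -
    have "x * y \<ge> 14 * y" using x y by (intro mult_right_mono) auto
    then have ny: "n \<ge> 7 * y" using n by simp
    have "x * n \<ge> 14 * n" using x ny y by (intro mult_right_mono) auto
    then have a: "2 * y < x * n" "x * n - y > 0" using ny y by linarith+
    have "2 * (y * (x * n)) \<le> 4 * (n * n)"
      using mult_right_mono[of "x * y" "2 * n" "2 * n"] n ny y by (simp add: algebra_simps)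
    also have "\<dots> < 13 * n * (n + x)"
    proof -
      have "n * n > 0" "n * x > 0" using ny y x by (intro mult_pos_pos; linarith)+
      then show ?thesis by (simp add: algebra_simps)
    qed
    also have "\<dots> \<le> (x * n - y) * (x + n)"
      using \<open>x * n \<ge> 14 * n\<close> ny y x by (subst add.commute) (intro mult_right_mono; linarith)
    finally show ?thesis using a by blast
  qed
  have n: "\<phi> (X k + Y k) \<ge> \<phi> (X k) * \<phi> (Y k) / 2" using outward_ge[OF basis] k by blast
  have kap: "kappa \<phi> (X (Suc k)) (Y (Suc k)) < 2" by (rule kappa_less[OF basis])
  have gt: "\<phi> (X k) > 2" "\<phi> (Y k) > 2" using greater_2 prim_X prim_Y by auto
  have k14: "\<phi> (X (Suc k)) \<ge> 14 \<and> \<phi> (Y (Suc k)) \<ge> 14" using k[of "Suc k"] by simp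
  have "entry (\<phi> (X (Suc k)), \<phi> (Y (Suc k)), \<phi> (X (Suc k) - Y (Suc k)))"
    using step[of k]
  proof (elim disjE conjE)
    assume s: "X (Suc k) = X k" "Y (Suc k) = X k + Y k"
    have "\<phi> (X (Suc k) - Y (Suc k)) = \<phi> (Y k)" by (simp add: s)
    then show ?thesis
      using kap k14 gt *[OF _ _ n] k[of k] unfolding entry_def kappa_def by (simp add: s)
  next
    assume s: "X (Suc k) = X k + Y k" "Y (Suc k) = Y k"
    have "\<phi> (X (Suc k) - Y (Suc k)) = \<phi> (X k)" by (simp add: s)
    moreover have "\<phi> (X k + Y k) \<ge> \<phi> (Y k) * \<phi> (X k) / 2" using n by (simp add: mult.commute)
    ultimately show ?thesis
      using kap k14 gt *[of "\<phi> (Y k)" "\<phi> (X k)" "\<phi> (X k + Y k)"] k[of k] unfolding entry_def kappa_def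
      by (simp add: s mult.commute add.commute)
  qed
  then show ?thesis using that by blast
qed

lemma stable_norm_path_derivative:
  assumes g: "geometric \<phi>" and m: "\<And>t. markoff_fun (\<psi> t)" and \<psi>0: "\<And>w. prim w \<Longrightarrow> \<psi> 0 w = \<phi> w"
    and \<psi>': "\<And>w. prim w \<Longrightarrow> ((\<lambda>t. \<psi> t w) has_real_derivative f w) (at 0)" and f: "deform_fun \<phi> f"
  obtains D where "((\<lambda>t. stable_norm (\<psi> t) \<mu>) has_real_derivative D) (at 0)" "(\<lambda>n. Tn \<phi> f n) \<longlonglongrightarrow> D"
proof -
  interpret geometric_markoff \<phi> by unfold_locales fact
  obtain k where k: "entry (\<phi> (X k), \<phi> (Y k), \<phi> (X k - Y k))" using entry_exists[OF g] .
  interpret s: farey_path \<mu> "\<lambda>n. X (n + k)" "\<lambda>n. Y (n + k)" "\<lambda>n. p (n + k)" "\<lambda>n. q (n + k)"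
    by (rule shift)
  obtain D where D: "((\<lambda>t. stable_norm (\<psi> t) \<mu>) has_real_derivative D) (at 0)" "(\<lambda>n. s.Tn \<phi> f n) \<longlonglongrightarrow> D"
    using s.stable_norm_path_derivative_entry[of \<psi> \<phi> f] m k \<psi>0 \<psi>' f markoff by auto
  have "s.Tn \<phi> f n = Tn \<phi> f (n + k)" for n by (simp add: s.Tn_def Tn_def)
  then have "(\<lambda>n. Tn \<phi> f n) \<longlonglongrightarrow> D" using D(2) LIMSEQ_offset[of "Tn \<phi> f" k] by simp
  then show ?thesis using that D(1) by blast
qed

text \<open>A comparison function for the interior of the cone: scaling the triple itself gives
  \<open>rho = 1\<close> at the entry edge, so the lower bounds \<open>Sn\<close> start at
  \<open>p k + q k\<close> and do not decrease.\<close>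

lemma positive_deformation:
  assumes g: "geometric \<phi>"
  obtains f c where "deform_fun \<phi> f" "c > 0" "\<forall>\<^sub>F n in sequentially. c \<le> Tn \<phi> f n"
proof -
  interpret geometric_markoff \<phi> by unfold_locales fact
  obtain k where k: "entry (\<phi> (X k), \<phi> (Y k), \<phi> (X k - Y k))" using entry_exists[OF g] .
  interpret s: farey_path \<mu> "\<lambda>n. X (n + k)" "\<lambda>n. Y (n + k)" "\<lambda>n. p (n + k)" "\<lambda>n. q (n + k)"
    by (rule shift)
  note b = basis[of k]
  let ?\<tau> = "(\<phi> (X k), \<phi> (Y k), \<phi> (X k - Y k))"
  let ?\<psi> = "markoff_on (X k) (Y k) ?\<tau>"
  define f where "f = deform_on (X k) (Y k) ?\<tau> ?\<tau>"
  have e': "\<phi> (X k) > 0" "\<phi> (Y k) > 0" using phi_pos prim_X prim_Y by auto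
  have g\<psi>: "geometric ?\<psi>" using k unfolding entry_def by (auto intro!: geometric_on[OF b])
  have d: "deform_fun ?\<psi> f" unfolding f_def by (rule deform_on_deform[OF b])
  have fb: "f (X k) = \<phi> (X k)" "f (Y k) = \<phi> (Y k)" "f (X k - Y k) = \<phi> (X k - Y k)"
    using deform_on_base[OF b] by (simp_all add: f_def)
  have t: "tame ?\<psi> f (X (0 + k)) (Y (0 + k))"
    using tame_entry[OF b k d] fb by simp
  have T: "s.Tn ?\<psi> f n = Tn \<phi> f (n + k)" for n
    by (simp add: s.Tn_def Tn_def tangent_def markoff_eq_on[OF markoff b, symmetric] prim_X prim_Y)
  have "p k + q k = s.Sn ?\<psi> f 0"
    using e' fb markoff_on_base[OF b, of "\<phi> (X k)" "\<phi> (Y k)" "\<phi> (X k - Y k)"] by (simp add: s.Sn_def rho_def)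
  then have "p k + q k \<le> Tn \<phi> f (n + k)" for n
    using s.enclosure(1)[OF g\<psi> d t, of 0 n] s.enclosure(3)[OF g\<psi> d t, of n] T[of n] by simp
  then have "\<forall>\<^sub>F n in sequentially. p k + q k \<le> Tn \<phi> f n"
    unfolding eventually_sequentially by (metis le_add_diff_inverse2)
  moreover have "deform_fun \<phi> f" unfolding f_def by (rule deform_on_deform_fun[OF markoff b])
  ultimately show ?thesis using that[of f "p k + q k"] pos[of k] by simp
qed

end

section \<open>The cone of nonnegative deformations\<close>

text \<open>The deformation with values \<open>v\<close> at the slopes \<open>\<infinity>\<close>, \<open>0\<close>, \<open>1\<close>, that is, at \<open>(1, 0)\<close>, \<open>\<plusminus>(0, 1)\<close>,
  \<open>(1, 1)\<close>; the basis is chosen so that its third vector \<open>U - V\<close> is \<open>(1, 1)\<close>.\<close>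

definition deform_at :: "(int \<times> int \<Rightarrow> real) \<Rightarrow> real ^ 3 \<Rightarrow> int \<times> int \<Rightarrow> real" where
  "deform_at \<phi> v w = deform_on (1, 0) (0, - 1) (\<phi> (1, 0), \<phi> (0, - 1), \<phi> (1, 1)) (v $ 1, v $ 2, v $ 3) w"

definition nonneg_cone :: "(int \<times> int \<Rightarrow> real) \<Rightarrow> (real ^ 3) set" where
  "nonneg_cone \<phi> = {v. \<forall>w. prim w \<longrightarrow> 0 \<le> deform_at \<phi> v w}"

text \<open>The strict form of \<open>grows\<close>, which is an open condition on the deformation
  for each fixed edge.\<close>

definition sgrows :: "(int \<times> int \<Rightarrow> real) \<Rightarrow> int \<times> int \<Rightarrow> int \<times> int \<Rightarrow> bool" where
  "sgrows f u v \<longleftrightarrow> basis u v \<and> 0 < f u \<and> 0 < f v \<and> f u < f (u + v) \<and> f v < f (u + v)"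

lemma deform_at_linear: "linear (\<lambda>v. deform_at \<phi> v w)"
proof -
  have "linear (\<lambda>v::real^3. (v $ 1, v $ 2, v $ 3))"
    by (rule linearI) auto
  then show ?thesis
    unfolding deform_at_def by (rule linear_compose[OF _ deform_on_linear, unfolded comp_def])
qed

lemmas deform_at_add = linear_add[OF deform_at_linear]
  and deform_at_diff = linear_diff[OF deform_at_linear]
  and deform_at_scaleR = linear_scale[OF deform_at_linear]
  and deform_at_neg = linear_neg[OF deform_at_linear]
  and deform_at_0 = linear_0[OF deform_at_linear]

lemma continuous_on_deform_at: "continuous_on S (\<lambda>v. deform_at \<phi> v w)"
  by (intro linear_continuous_on linear_conv_bounded_linear[THEN iffD1] deform_at_linear)

lemma closed_nonneg_cone: "closed (nonneg_cone \<phi>)"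
proof -
  have "closed {v. prim w \<longrightarrow> 0 \<le> deform_at \<phi> v w}" for w
    by (cases "prim w") (simp_all add: closed_Collect_le continuous_on_deform_at continuous_on_const)
  then show ?thesis unfolding nonneg_cone_def by (rule closed_Collect_all)
qed

lemma nonneg_cone_add: "u \<in> nonneg_cone \<phi> \<Longrightarrow> v \<in> nonneg_cone \<phi> \<Longrightarrow> u + v \<in> nonneg_cone \<phi>"
  by (simp add: nonneg_cone_def deform_at_add)

lemma nonneg_cone_scaleR: "v \<in> nonneg_cone \<phi> \<Longrightarrow> 0 \<le> t \<Longrightarrow> t *\<^sub>R v \<in> nonneg_cone \<phi>"
  by (simp add: nonneg_cone_def deform_at_scaleR)

lemma convex_nonneg_cone: "convex (nonneg_cone \<phi>)"
  by (rule convexI) (intro nonneg_cone_add nonneg_cone_scaleR)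

lemma interior_minus:
  fixes v x :: "real ^ 3"
  assumes "v \<in> interior S" obtains \<epsilon> where "\<epsilon> > 0" "v - \<epsilon> *\<^sub>R x \<in> S"
proof -
  obtain r where r: "r > 0" "ball v r \<subseteq> S" using assms mem_interior by blast
  define \<epsilon> where "\<epsilon> = r / (2 * (norm x + 1))"
  have n: "norm x + 1 > 0" by (simp add: add_nonneg_pos)
  have e: "\<epsilon> > 0" using r n by (simp add: \<epsilon>_def)
  have "\<epsilon> * norm x < \<epsilon> * (norm x + 1)" using e by simp
  also have "\<dots> = r / 2" unfolding \<epsilon>_def using n by (simp add: divide_simps)
  finally have "v - \<epsilon> *\<^sub>R x \<in> ball v r" using r e by (simp add: dist_norm)
  then show ?thesis using that e r by blast
qed

context geometric_markoff
begin

lemma basis_std: "basis (1, 0) (0, - 1)"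
  by (simp add: basis_def wedge_def)

lemma deform_at_deform: "deform_fun \<phi> (deform_at \<phi> v)"
  using deform_on_deform_fun[OF markoff basis_std] unfolding deform_at_def by simp

lemma deform_at_eq:
  assumes "deform_fun \<phi> f" "prim w" shows "deform_at \<phi> (vector [f (1, 0), f (0, 1), f (1, 1)]) w = f w"
proof -
  have "f (0, - 1) = f (0, 1)" using deform_even[OF assms(1), of "(0, 1)"] by simp
  then show ?thesis using deform_eq_on[OF assms(1) markoff basis_std assms(2)]
    unfolding deform_at_def by simp
qed

lemma deform_at_base:
  "deform_at \<phi> v (1, 0) = v $ 1" "deform_at \<phi> v (0, 1) = v $ 2" "deform_at \<phi> v (1, 1) = v $ 3"
proof -
  show "deform_at \<phi> v (0, 1) = v $ 2"
    using deform_on_base(2)[OF basis_std] deform_even[OF deform_at_deform, of v "(0, 1)"]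
    unfolding deform_at_def by simp
  show "deform_at \<phi> v (1, 0) = v $ 1" "deform_at \<phi> v (1, 1) = v $ 3"
    using deform_on_base(1,3)[OF basis_std] unfolding deform_at_def by simp_all
qed

lemma deform_grows_step:
  assumes "deform_fun \<phi> f" "grows f u v" shows "grows f u (u + v) \<and> grows f (u + v) v"
  by (rule grows_step[OF deform_even[OF assms(1)] deform_add[OF assms(1)] _ _ assms(2)])
    (auto intro: less_imp_le greater_2)

lemma sgrows_cone:
  assumes f: "deform_fun \<phi> f" and s: "sgrows f u v" and w: "w = scale p u + scale q v" "p \<ge> 0" "q \<ge> 0" "prim w"
  shows "f w > 0"
proof -
  have b: "basis u v" and pos: "f u > 0" "f v > 0" and g: "grows f u v"
    using s by (auto simp: sgrows_def grows_def)
  have co: "coprime p q" using w prim_combination[OF b] by simp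
  consider "q = 0" | "p = 0" | "p \<ge> 1" "q \<ge> 1" using w by linarith
  then show ?thesis
  proof cases
    case 1
    then have "p = 1" using co w by simp
    then show ?thesis using 1 w pos by simp
  next
    case 2
    then have "q = 1" using co w by simp
    then show ?thesis using 2 w pos by simp
  next
    case 3
    define E where "E u v = (grows f u v \<and> f u > 0 \<and> f v > 0)" for u v
    have st: "E u (u + v) \<and> E (u + v) v" if "E u v" for u v
      using that deform_grows_step[OF f, of u v] by (auto simp: E_def grows_def)
    have "E u v" using pos g by (simp add: E_def)
    then obtain u' v' where "E u' v'" "scale p u + scale q v = u' + v'"
      using cone_induct[where E=E and U=u and V=v and p=p and q=q, OF st] co 3 by blast
    then show ?thesis using w by (auto simp: E_def grows_def)
  qed
qed

lemma open_sgrows: "open {v. sgrows (deform_at \<phi> v) a b}"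
proof (cases "basis a b")
  case True
  then show ?thesis unfolding sgrows_def
    by (simp only: simp_thms) (intro open_Collect_conj open_Collect_less continuous_on_const continuous_on_deform_at)
qed (simp add: sgrows_def)

lemma interior_point: obtains v where "v \<in> interior (nonneg_cone \<phi>)"
proof -
  \<comment> \<open>The values at \<open>(1, 1)\<close> and \<open>(1, - 1)\<close> have the sum
    \<open>\<phi> (1, 0) + \<phi> (0, 1)\<close>; dividing it equally makes both exceed
    \<open>1\<close>, so the deformation grows strictly on both sides of the first edge.\<close>
  define v0 :: "real ^ 3" where "v0 = vector [1, 1, (\<phi> (1, 0) + \<phi> (0, 1)) / 2]"
  define N where "N = {v. sgrows (deform_at \<phi> v) (1, 0) (0, 1)} \<inter> {v. sgrows (deform_at \<phi> v) (1, 0) (0, - 1)}"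
  have "open N" unfolding N_def by (intro open_Int open_sgrows)
  moreover have "v0 \<in> N"
  proof -
    have p: "prim (1, 0)" "prim (0, 1)" by (simp_all add: prim_def)
    have b: "deform_at \<phi> v0 (1, 0) = 1" "deform_at \<phi> v0 (0, 1) = 1" "deform_at \<phi> v0 (1, 1) = (\<phi> (1, 0) + \<phi> (0, 1)) / 2"
      unfolding deform_at_base by (simp_all add: v0_def)
    moreover have "deform_at \<phi> v0 (1, - 1) = (\<phi> (1, 0) + \<phi> (0, 1)) / 2"
      using deform_add[OF deform_at_deform[of v0], of "(1, 0)" "(0, 1)"] b by (simp add: field_simps)
    moreover have "deform_at \<phi> v0 (0, - 1) = 1"
      using deform_even[OF deform_at_deform[of v0], of "(0, 1)"] b by simp
    ultimately show ?thesis using greater_2[OF p(1)] greater_2[OF p(2)] basis_std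
      by (simp add: N_def sgrows_def)
  qed
  moreover have "N \<subseteq> nonneg_cone \<phi>"
  proof
    fix v assume v: "v \<in> N"
    let ?f = "deform_at \<phi> v"
    have g: "grows ?f (1, 0) (0, 1)" "grows ?f (1, 0) (- (0, 1))"
      using v by (auto simp: N_def sgrows_def grows_def)
    have "0 \<le> ?f w" if w: "prim w" for w
    proof (rule tree_induct[of "grows ?f", OF _ _ g _ _ _ _ w])
      show "0 \<le> ?f (- w)" if "0 \<le> ?f w" for w using that deform_even[OF deform_at_deform] by simp
    qed (use g deform_grows_step[OF deform_at_deform] in \<open>auto simp: grows_def\<close>)
    then show "v \<in> nonneg_cone \<phi>" by (simp add: nonneg_cone_def)
  qed
  ultimately show ?thesis using that interiorI by blast
qed

lemma nonneg_cone_octant: assumes "v \<in> nonneg_cone \<phi>" shows "0 \<le> v $ i"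
proof -
  have "prim (1, 0)" "prim (0, 1)" "prim (1, 1)" by (simp_all add: prim_def)
  then have "0 \<le> v $ 1" "0 \<le> v $ 2" "0 \<le> v $ 3"
    using assms deform_at_base[of v] unfolding nonneg_cone_def by (metis mem_Collect_eq)+
  then show ?thesis using exhaust_3[of i] by auto
qed

text \<open>A linear functional that is nonnegative on the cone is positive at interior points
  unless it vanishes identically, and some deformation has the value \<open>1\<close> at
  \<open>w\<close>.\<close>

lemma interior_positive:
  assumes "v \<in> interior (nonneg_cone \<phi>)" "prim w" shows "deform_at \<phi> v w > 0"
proof -
  have "\<exists>x. deform_at \<phi> x w > 0"
  proof (rule ccontr)
    assume "\<not> ?thesis"
    then have le: "deform_at \<phi> x w \<le> 0" for x by (simp add: not_less)
    then have z: "deform_at \<phi> x w = 0" for x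
      using le[of x] le[of "- x"] unfolding deform_at_neg by linarith
    obtain u where b: "basis w u" using prim_basis[OF assms(2)] .
    define f where "f = deform_on w u (\<phi> w, \<phi> u, \<phi> (w - u)) (1, 0, 0)"
    have "deform_fun \<phi> f" unfolding f_def by (rule deform_on_deform_fun[OF markoff b])
    from deform_at_eq[OF this assms(2)] z have "f w = 0" by simp
    then show False using deform_on_base(1)[OF b] by (simp add: f_def)
  qed
  then obtain x where x: "deform_at \<phi> x w > 0" by blast
  obtain \<epsilon> where \<epsilon>: "\<epsilon> > 0" "v - \<epsilon> *\<^sub>R x \<in> nonneg_cone \<phi>" using interior_minus[OF assms(1)] by blast
  then have "0 \<le> deform_at \<phi> v w - \<epsilon> * deform_at \<phi> x w"
    using assms(2) by (auto simp: nonneg_cone_def deform_at_diff deform_at_scaleR)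
  moreover have "\<epsilon> * deform_at \<phi> x w > 0" using \<epsilon> x by simp
  ultimately show ?thesis by linarith
qed

text \<open>Along the neighbours of \<open>X\<close> the second differences of \<open>f\<close> are
  at least \<open>2 * f X > 0\<close>. So the increments eventually exceed \<open>f X\<close>, and
  then both inequalities of strict growth hold.\<close>

lemma sgrows_on_line:
  assumes f: "deform_fun \<phi> f" and pos: "\<And>w. prim w \<Longrightarrow> f w > 0" and b: "basis X V"
  obtains n where "sgrows f X (V + scale n X)"
proof -
  have bn: "basis X (V + scale n X)" for n using b by simp
  define g where "g n = f (V + scale (int n) X)" for n
  have g: "g n > 0" for n unfolding g_def using pos basis_prim(2)[OF bn] .
  have X: "f X > 0" "\<phi> X > 2" using pos greater_2 basis_prim(1)[OF b] by auto
  define d where "d n = g (Suc n) - g n" for n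
  have d: "d (Suc n) \<ge> d n + 2 * f X" for n
  proof -
    let ?W = "V + scale (int (Suc n)) X"
    have "basis ?W X" using bn basis_commute by blast
    then have 1: "f (?W + X) = f ?W * \<phi> X + \<phi> ?W * f X - f (?W - X)" by (rule deform_add[OF f])
    have 2: "?W + X = V + scale (int (Suc (Suc n))) X" "?W - X = V + scale (int n) X"
      by (simp_all add: scale_def prod_eq_iff algebra_simps)
    have eq: "g (Suc (Suc n)) = g (Suc n) * \<phi> X + \<phi> ?W * f X - g n"
      using 1 unfolding 2 g_def .
    have "g (Suc n) * \<phi> X \<ge> g (Suc n) * 2" using g[of "Suc n"] X by simp
    moreover have "\<phi> ?W * f X \<ge> 2 * f X" using greater_2[OF basis_prim(2)[OF bn]] X by (intro mult_right_mono) (simp_all add: less_imp_le)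
    ultimately show ?thesis using eq by (simp add: d_def)
  qed
  have dn: "d n \<ge> d 0 + real n * (2 * f X)" for n
  proof (induction n)
    case (Suc n) then show ?case using d[of n] by (simp add: algebra_simps)
  qed simp
  obtain n where n: "real n * (2 * f X) > f X - d 0"
    using reals_Archimedean3[of "2 * f X"] X by auto
  then have "d n > f X" using dn[of n] by linarith
  then have "g (Suc n) > g n + f X" by (simp add: d_def)
  moreover have S: "X + (V + scale (int n) X) = V + scale (int (Suc n)) X"
    by (simp add: scale_add algebra_simps)
  ultimately have "sgrows f X (V + scale (int n) X)"
    unfolding sgrows_def S using bn[of "int n"] X g[of n] unfolding g_def by linarith
  then show ?thesis using that by blast
qed

text \<open>The cones of the edges at which \<open>v\<close> grows strictly cover a neighbourhood of every direction,
  so by compactness finitely many of these edges force positivity at all slopes.\<close>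

lemma interior_criterion:
  assumes pos: "\<And>w. prim w \<Longrightarrow> deform_at \<phi> v w > 0"
    and irr: "\<And>\<mu>. irrational \<mu> \<Longrightarrow> \<exists>X Y p q n. farey_path \<mu> X Y p q \<and> sgrows (deform_at \<phi> v) (X n) (Y n)"
  shows "v \<in> interior (nonneg_cone \<phi>)"
proof -
  have coords: "\<exists>a c. w = scale a x + scale c y \<and> s = of_int a \<and> t = of_int c"
    if b: "basis x y" and eq: "rvec w = s *\<^sub>R rvec x + t *\<^sub>R rvec y" for w x y s t
  proof -
    obtain a c where w: "w = scale a x + scale c y" using basis_combination[OF b] by blast
    have e: "of_int a *\<^sub>R rvec x + of_int c *\<^sub>R rvec y = s *\<^sub>R rvec x + t *\<^sub>R rvec y" using eq w by simp
    have wn: "real_of_int (wedge x y) \<noteq> 0" using b by (auto simp: basis_def)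
    from arg_cong[OF e, of "\<lambda>z. cross z (rvec y)"] wn have "s = of_int a" by simp
    moreover from arg_cong[OF e, of "\<lambda>z. cross (rvec x) z"] wn have "t = of_int c" by simp
    ultimately show ?thesis using w by blast
  qed
  have open_cone: "open {\<nu>. cross \<nu> (rvec y) * wedge x y > 0 \<and> cross (rvec x) \<nu> * wedge x y > 0}" for x y
    unfolding cross_def by (intro open_Collect_conj open_Collect_less continuous_intros)
  have in_cone: "\<nu> = (cross \<nu> (rvec y) * wedge x y) *\<^sub>R rvec x + (cross (rvec x) \<nu> * wedge x y) *\<^sub>R rvec y"
    if "basis x y" for \<nu> x y
  proof -
    have "of_int (wedge x y * wedge x y) = (1::real)" using basis_squared[OF that] by simp
    then have d: "real_of_int (wedge x y) * real_of_int (wedge x y) = 1" by simp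
    have "fst \<nu> * (real_of_int (wedge x y) * real_of_int (wedge x y)) =
        cross \<nu> (rvec y) * wedge x y * fst (rvec x) + cross (rvec x) \<nu> * wedge x y * fst (rvec y)"
      "snd \<nu> * (real_of_int (wedge x y) * real_of_int (wedge x y)) =
        cross \<nu> (rvec y) * wedge x y * snd (rvec x) + cross (rvec x) \<nu> * wedge x y * snd (rvec y)"
      by (simp_all add: cross_def rvec_def wedge_def algebra_simps)
    then show ?thesis unfolding d by (simp add: prod_eq_iff)
  qed
  \<comment> \<open>The local statement to which compactness is applied: an open set of directions
    in which one neighbourhood \<open>N\<close> of \<open>v\<close> controls positivity.\<close>
  define good where "good O' N \<longleftrightarrow> open O' \<and> open N \<and> v \<in> N \<and>
    (\<forall>v'\<in>N. \<forall>w t. prim w \<longrightarrow> t > 0 \<longrightarrow> t *\<^sub>R rvec w \<in> O' \<longrightarrow> deform_at \<phi> v' w > 0)" for O' N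
  have "\<exists>O' N. \<mu> \<in> O' \<and> good O' N" if "\<mu> \<in> sphere 0 1" for \<mu> :: "real \<times> real"
  proof (cases "irrational \<mu>")
    case True
    then obtain X Y p q n where "farey_path \<mu> X Y p q" and s: "sgrows (deform_at \<phi> v) (X n) (Y n)"
      using irr by blast
    then interpret farey_path \<mu> X Y p q by simp
    let ?x = "X n" and ?y = "Y n"
    define O' where "O' = {\<nu>. cross \<nu> (rvec ?y) * wedge ?x ?y > 0 \<and> cross (rvec ?x) \<nu> * wedge ?x ?y > 0}"
    define N where "N = {v. sgrows (deform_at \<phi> v) ?x ?y}"
    have d: "real_of_int (wedge ?x ?y) * real_of_int (wedge ?x ?y) = 1"
      using basis_squared[OF basis[of n]] by (metis of_int_1 of_int_mult)
    have "cross \<mu> (rvec ?y) * wedge ?x ?y = p n" "cross (rvec ?x) \<mu> * wedge ?x ?y = q n"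
      by (subst combination[of n], simp add: mult.assoc d)+
    then have "\<mu> \<in> O'" using pos[of n] by (simp add: O'_def)
    moreover have "good O' N" unfolding good_def
    proof (intro conjI ballI allI impI)
      show "open O'" unfolding O'_def by (rule open_cone)
      show "open N" unfolding N_def by (rule open_sgrows)
      show "v \<in> N" using s by (simp add: N_def)
      fix v' w t assume v': "v' \<in> N" and w: "prim w" and t: "(t::real) > 0" "t *\<^sub>R rvec w \<in> O'"
      have c: "cross (rvec w) (rvec ?y) * wedge ?x ?y > 0" "cross (rvec ?x) (rvec w) * wedge ?x ?y > 0"
      proof -
        have "0 < t * (cross (rvec w) (rvec ?y) * wedge ?x ?y)" "0 < t * (cross (rvec ?x) (rvec w) * wedge ?x ?y)"
          using t(2) unfolding O'_def mem_Collect_eq cross_simps(3,4) by (simp_all only: mult.assoc)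
        then show "cross (rvec w) (rvec ?y) * wedge ?x ?y > 0" "cross (rvec ?x) (rvec w) * wedge ?x ?y > 0"
          using zero_less_mult_pos t(1) by blast+
      qed
      obtain a k where ak: "w = scale a ?x + scale k ?y" "cross (rvec w) (rvec ?y) * wedge ?x ?y = of_int a"
        "cross (rvec ?x) (rvec w) * wedge ?x ?y = of_int k"
        using coords[OF basis in_cone[OF basis]] by blast
      show "deform_at \<phi> v' w > 0"
        using sgrows_cone[OF deform_at_deform _ ak(1)] v' w c ak(2,3) unfolding N_def by simp
    qed
    ultimately show ?thesis by blast
  next
    case False
    then obtain c w0 where w0: "prim w0" and \<mu>0: "\<mu> = c *\<^sub>R rvec w0" using not_irrational by blast
    have "c \<noteq> 0" using that \<mu>0 by auto
    then obtain X t0 where X: "prim X" and t0: "t0 > 0" and \<mu>: "\<mu> = t0 *\<^sub>R rvec X"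
    proof (cases "c > 0")
      case True then show ?thesis using that w0 \<mu>0 by blast
    next
      case False then show ?thesis using that[of "- w0" "- c"] w0 \<mu>0 \<open>c \<noteq> 0\<close> by simp
    qed
    obtain V where b: "basis X V" using prim_basis[OF X] .
    then have b': "basis X (- V)" by simp
    obtain m where m: "sgrows (deform_at \<phi> v) X (V + scale m X)" using sgrows_on_line[OF deform_at_deform pos b] .
    obtain l where l: "sgrows (deform_at \<phi> v) X (- V + scale l X)" using sgrows_on_line[OF deform_at_deform pos b'] .
    \<comment> \<open>Near a rational direction two cones are needed, spanned by \<open>X\<close>
      and a neighbour on either side of it. \<open>A\<close> and \<open>C\<close> are the
      coordinates in the basis \<open>X\<close>, \<open>V\<close>, and the sector
      \<open>K * \<bar>C\<bar> < A\<close> lies in the union of these cones.\<close>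
    define K where "K = max 0 (max m l)"
    define A where "A \<nu> = cross \<nu> (rvec V) * wedge X V" for \<nu>
    define C where "C \<nu> = cross (rvec X) \<nu> * wedge X V" for \<nu>
    define O' where "O' = {\<nu>. of_int K * \<bar>C \<nu>\<bar> < A \<nu>}"
    define N where "N = {v. sgrows (deform_at \<phi> v) X (V + scale m X)} \<inter> {v. sgrows (deform_at \<phi> v) X (- V + scale l X)}"
    have d: "real_of_int (wedge X V) * real_of_int (wedge X V) = 1"
      using basis_squared[OF b] by (metis of_int_1 of_int_mult)
    have "\<mu> \<in> O'" using t0 by (simp add: O'_def A_def C_def \<mu> mult.assoc d)
    moreover have "good O' N" unfolding good_def
    proof (intro conjI ballI allI impI)
      show "open O'" unfolding O'_def A_def C_def cross_def by (intro open_Collect_less continuous_intros)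
      show "open N" unfolding N_def by (intro open_Int open_sgrows)
      show "v \<in> N" using m l by (simp add: N_def)
      fix v' w t assume v': "v' \<in> N" and w: "prim w" and t: "(t::real) > 0" "t *\<^sub>R rvec w \<in> O'"
      have "of_int K * (t * \<bar>C (rvec w)\<bar>) < t * A (rvec w)"
        using t by (simp add: O'_def A_def C_def abs_mult mult.assoc del: cross_simps(5))
      then have "t * (of_int K * \<bar>C (rvec w)\<bar>) < t * A (rvec w)" by (simp add: mult.left_commute)
      then have c: "of_int K * \<bar>C (rvec w)\<bar> < A (rvec w)" using t by simp
      obtain a k where ak: "w = scale a X + scale k V" "A (rvec w) = of_int a" "C (rvec w) = of_int k"
        using coords[OF b in_cone[OF b]] unfolding A_def C_def by blast
      have "real_of_int (K * \<bar>k\<bar>) < real_of_int a" using c ak(2,3) by simp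
      then have c': "K * \<bar>k\<bar> < a" by (simp only: of_int_less_iff)
      show "deform_at \<phi> v' w > 0"
      proof (cases "k \<ge> 0")
        case True
        \<comment> \<open>The coordinates in the cone of \<open>X\<close> and
          \<open>V + m X\<close>; the first is nonnegative because
          \<open>m * k \<le> K * \<bar>k\<bar> < a\<close>.\<close>
        have "w = scale (a - m * k) X + scale k (V + scale m X)" using ak(1) by (simp add: scale_def prod_eq_iff algebra_simps)
        moreover have "m * k \<le> K * k" using True by (intro mult_right_mono) (auto simp: K_def)
        ultimately show ?thesis using sgrows_cone[OF deform_at_deform, of v' X "V + scale m X" w] v' w c' True
          by (simp add: N_def)
      next
        case False
        have "w = scale (a - l * (- k)) X + scale (- k) (- V + scale l X)" using ak(1) by (simp add: scale_def prod_eq_iff algebra_simps)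
        moreover have "l * (- k) \<le> K * (- k)" using False by (intro mult_right_mono) (auto simp: K_def)
        moreover have "K * \<bar>k\<bar> = K * (- k)" using False by simp
        then have "0 \<le> a - l * (- k)" using c' calculation(2) by linarith
        ultimately show ?thesis using sgrows_cone[OF deform_at_deform, of v' X "- V + scale l X" w "a - l * (- k)" "- k"] v' w c' False
          by (simp add: N_def)
      qed
    qed
    ultimately show ?thesis by blast
  qed
  then obtain O' N where ON: "\<And>\<mu>. \<mu> \<in> sphere 0 1 \<Longrightarrow> \<mu> \<in> O' \<mu> \<and> good (O' \<mu>) (N \<mu>)" by metis
  have "compact (sphere 0 1 :: (real \<times> real) set)" by (rule compact_sphere)
  then obtain D where D: "D \<subseteq> sphere 0 1" "finite D" "sphere 0 1 \<subseteq> (\<Union>\<mu>\<in>D. O' \<mu>)"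
    by (rule compactE_image[of _ "sphere 0 1" O']) (use ON in \<open>auto simp: good_def\<close>)
  have "open (\<Inter>\<mu>\<in>D. N \<mu>)" using D ON by (intro open_INT) (auto simp: good_def)
  moreover have "v \<in> (\<Inter>\<mu>\<in>D. N \<mu>)" using D ON by (auto simp: good_def)
  moreover have "(\<Inter>\<mu>\<in>D. N \<mu>) \<subseteq> nonneg_cone \<phi>"
  proof
    fix v' assume v': "v' \<in> (\<Inter>\<mu>\<in>D. N \<mu>)"
    have "deform_at \<phi> v' w > 0" if w: "prim w" for w
    proof -
      have "rvec w \<noteq> 0" using prim_nonzero[OF w] by (auto simp: rvec_def prod_eq_iff)
      then have n: "norm (rvec w) > 0" by simp
      then have "(1 / norm (rvec w)) *\<^sub>R rvec w \<in> sphere 0 1" by simp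
      then obtain \<mu> where \<mu>: "\<mu> \<in> D" "(1 / norm (rvec w)) *\<^sub>R rvec w \<in> O' \<mu>" using D(3) by blast
      moreover have "\<mu> \<in> sphere 0 1" using D(1) \<mu>(1) by blast
      ultimately have "good (O' \<mu>) (N \<mu>)" "v' \<in> N \<mu>" using ON v' by blast+
      then show ?thesis unfolding good_def using \<mu>(2) w n by (metis divide_pos_pos zero_less_one)
    qed
    then show "v' \<in> nonneg_cone \<phi>" by (simp add: nonneg_cone_def less_imp_le)
  qed
  ultimately show ?thesis using interiorI by blast
qed

text \<open>By \<open>interior_criterion\<close> there is an irrational direction whose paths have
  no strictly growing edge. Each new value is then at most the larger value on the preceding edge,
  so the maximum on the first edge bounds them all.\<close>

lemma boundary_bounded_path:
  assumes positive: "\<And>w. prim w \<Longrightarrow> deform_at \<phi> v w > 0" and v: "v \<notin> interior (nonneg_cone \<phi>)"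
  obtains \<mu> X Y p q M where "irrational \<mu>" "farey_path \<mu> X Y p q"
    "\<And>n. deform_at \<phi> v (X n) \<le> M \<and> deform_at \<phi> v (Y n) \<le> M"
proof -
  obtain \<mu> where \<mu>: "irrational \<mu>"
    and no: "\<And>X Y p q n. farey_path \<mu> X Y p q \<Longrightarrow> \<not> sgrows (deform_at \<phi> v) (X n) (Y n)"
    using interior_criterion[of v] positive v by blast
  obtain X Y p q where path: "farey_path \<mu> X Y p q" using farey_path_exists[OF \<mu>] .
  then interpret farey_path \<mu> X Y p q .
  let ?f = "deform_at \<phi> v"
  define M where "M = max (?f (X 0)) (?f (Y 0))"
  have le: "?f (X n + Y n) \<le> max (?f (X n)) (?f (Y n))" for n
    using no[OF path, of n] basis[of n] positive prim_X[of n] prim_Y[of n] unfolding sgrows_def by auto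
  have "?f (X n) \<le> M \<and> ?f (Y n) \<le> M" for n
  proof (induction n)
    case (Suc n)
    then show ?case using step[of n] le[of n] by auto
  qed (simp add: M_def)
  then show ?thesis using that \<mu> path by blast
qed

end

text \<open>The numerators are bounded, the denominators tend to infinity with
  \<open>\<phi>\<close>, and the weights do not increase.\<close>

lemma (in farey_path) bounded_Tn_limit:
  assumes g: "geometric \<phi>" and f: "\<And>w. prim w \<Longrightarrow> 0 \<le> f w" and M: "\<And>n. f (X n) \<le> M \<and> f (Y n) \<le> M"
  shows "(\<lambda>n. Tn \<phi> f n) \<longlonglongrightarrow> 0"
proof (rule LIMSEQ_I)
  fix r :: real assume r: "r > 0"
  have M0: "M \<ge> 0" using f[OF prim_X[of 0]] M[of 0] by linarith
  \<comment> \<open>The bound \<open>3\<close> makes the square root in \<open>tangent\<close> at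
    least half of \<open>\<phi> w\<close>; the other bound makes the weighted sum smaller than
    \<open>r\<close>.\<close>
  define B where "B = max 3 (2 * (M + 1) * (p 0 + q 0) / r)"
  obtain N where N: "\<And>m. m \<ge> N \<Longrightarrow> outward \<phi> (X m) (Y m) \<and> \<phi> (X m) \<ge> B \<and> \<phi> (Y m) \<ge> B"
    using far_edge[OF g] by blast
  have B: "B \<ge> 3" "B \<ge> 2 * (M + 1) * (p 0 + q 0) / r" by (auto simp: B_def)
  have t: "0 \<le> tangent \<phi> f w \<and> tangent \<phi> f w \<le> 2 * M / B" if "prim w" "f w \<le> M" "\<phi> w \<ge> B" for w
  proof -
    have "\<phi> w * \<phi> w \<ge> 3 * 3" using that B by (intro mult_mono) auto
    then have "(\<phi> w / 2)\<^sup>2 \<le> (\<phi> w)\<^sup>2 - 4" by (simp add: power2_eq_square)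
    then have "\<phi> w / 2 \<le> sqrt ((\<phi> w)\<^sup>2 - 4)" by (rule real_le_rsqrt)
    then have s: "B / 2 \<le> sqrt ((\<phi> w)\<^sup>2 - 4)" using that by linarith
    then have "f w / sqrt ((\<phi> w)\<^sup>2 - 4) \<le> M / (B / 2)"
      using that B f[OF that(1)] by (intro frac_le) auto
    moreover have "0 \<le> f w / sqrt ((\<phi> w)\<^sup>2 - 4)" using s B f[OF that(1)] by (intro divide_nonneg_nonneg; linarith)
    ultimately show ?thesis by (simp add: tangent_def mult.commute)
  qed
  show "\<exists>no. \<forall>n\<ge>no. norm (Tn \<phi> f n - 0) < r"
  proof (intro exI[of _ N] allI impI)
    fix n assume n: "n \<ge> N"
    have tX: "0 \<le> tangent \<phi> f (X n)" "tangent \<phi> f (X n) \<le> 2 * M / B" and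
      tY: "0 \<le> tangent \<phi> f (Y n)" "tangent \<phi> f (Y n) \<le> 2 * M / B"
      using t[OF prim_X[of n]] t[OF prim_Y[of n]] M[of n] N[OF n] by auto
    have T0: "0 \<le> Tn \<phi> f n" unfolding Tn_def using tX tY pos[of n] by (intro add_nonneg_nonneg mult_nonneg_nonneg) auto
    have "Tn \<phi> f n \<le> p 0 * (2 * M / B) + q 0 * (2 * M / B)"
      unfolding Tn_def using tX tY pos[of n] pos[of 0] weights_antimono[of 0 n]
      by (intro add_mono mult_mono) auto
    also have "\<dots> = 2 * M * (p 0 + q 0) / B" by (simp add: algebra_simps add_divide_distrib)
    also have "\<dots> < r"
    proof -
      have "2 * M * (p 0 + q 0) < 2 * (M + 1) * (p 0 + q 0)" using pos[of 0] by (simp add: algebra_simps)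
      also have "\<dots> \<le> B * r" using B(2) r by (simp add: divide_le_eq)
      finally show ?thesis using B(1) by (simp add: divide_less_eq mult.commute)
    qed
    finally show "norm (Tn \<phi> f n - 0) < r" using T0 by simp
  qed
qed

section \<open>Deformations that stay bounded along an irrational path\<close>

text \<open>The determinant of three deformations evaluated at three vectors. On triples
  \<open>u\<close>, \<open>v\<close>, \<open>u - v\<close> its absolute value is the same for all
  edges of a path, so it can be estimated far out.\<close>

definition det3 :: "(int \<times> int \<Rightarrow> real) \<Rightarrow> (int \<times> int \<Rightarrow> real) \<Rightarrow> (int \<times> int \<Rightarrow> real) \<Rightarrow>
    int \<times> int \<Rightarrow> int \<times> int \<Rightarrow> int \<times> int \<Rightarrow> real" where
  "det3 f g h x y z = f x * (g y * h z - g z * h y) - f y * (g x * h z - g z * h x) + f z * (g x * h y - g y * h x)"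

context farey_path
begin

text \<open>After a step changing \<open>Y\<close>, the first step that changes \<open>X\<close> is
  preceded by one changing \<open>Y\<close>. The determinant is evaluated at such turns, where
  \<open>X m + Y m\<close> has the two path neighbours \<open>X m\<close> and
  \<open>2 X m + Y m\<close>.\<close>

lemma turning_point: "\<exists>m\<ge>n. X (Suc m) = X m \<and> Y (Suc m) = X m + Y m \<and>
    X (Suc (Suc m)) = X m + (X m + Y m) \<and> Y (Suc (Suc m)) = X m + Y m"
proof -
  obtain k where k: "k \<ge> n" "X (Suc k) = X k" "Y (Suc k) = X k + Y k" using turns(2) by blast
  define B where "B l \<longleftrightarrow> X (Suc (Suc (k + l))) = X (Suc (k + l)) + Y (Suc (k + l)) \<and> Y (Suc (Suc (k + l))) = Y (Suc (k + l))" for l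
  obtain m where m: "m \<ge> Suc k" "X (Suc m) = X m + Y m" "Y (Suc m) = Y m" using turns(1) by blast
  then have "B (m - Suc k)" by (simp add: B_def)
  then have B: "B (LEAST l. B l)" by (rule LeastI)
  define l where "l = (LEAST l. B l)"
  have "X (Suc (k + l)) = X (k + l) \<and> Y (Suc (k + l)) = X (k + l) + Y (k + l)"
  proof (cases l)
    case (Suc j)
    then have "\<not> B j" using not_less_Least[of j B] by (simp add: l_def)
    then show ?thesis using step[of "Suc (k + j)"] Suc by (auto simp: B_def)
  qed (use k in simp)
  moreover have "B l" using B by (simp only: l_def)
  ultimately show ?thesis using k(1) unfolding B_def
    by (intro exI[of _ "k + l"]) auto
qed

text \<open>\<open>f (u + v)\<close> is \<open>- f (u - v)\<close> plus a combination of
  \<open>f u\<close> and \<open>f v\<close> whose coefficients are the same for all deformations, so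
  passing to the next edge changes the determinant at most by a sign.\<close>

lemma det3_invariant:
  assumes m: "markoff_fun \<phi>" and d: "deform_fun \<phi> f" "deform_fun \<phi> g" "deform_fun \<phi> h"
  shows "\<bar>det3 f g h (X n) (Y n) (X n - Y n)\<bar> = \<bar>det3 f g h (X 0) (Y 0) (X 0 - Y 0)\<bar>"
proof -
  define c where "c = \<bar>det3 f g h (X 0) (Y 0) (X 0 - Y 0)\<bar>"
  define E where "E u v \<longleftrightarrow> basis u v \<and> \<bar>det3 f g h u v (u - v)\<bar> = c" for u v
  have "E (X n) (Y n)"
  proof (rule path_invariant)
    show "E (X 0) (Y 0)" by (simp add: E_def c_def basis)
    fix u v assume e: "E u v"
    then have b: "basis u v" by (simp add: E_def)
    have s: "u - (u + v) = - v" "u + v - v = u" by simp_all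
    have "det3 f g h u (u + v) (- v) = det3 f g h u v (u - v)"
      unfolding det3_def deform_even[OF d(1)] deform_even[OF d(2)] deform_even[OF d(3)]
        deform_add[OF d(1) b] deform_add[OF d(2) b] deform_add[OF d(3) b]
      by (simp add: algebra_simps)
    moreover have "det3 f g h (u + v) v u = det3 f g h u v (u - v)"
      unfolding det3_def deform_add[OF d(1) b] deform_add[OF d(2) b] deform_add[OF d(3) b]
      by (simp add: algebra_simps)
    ultimately show "E u (u + v) \<and> E (u + v) v"
      using e unfolding E_def s by simp
  qed
  then show ?thesis by (simp add: E_def c_def)
qed

text \<open>A new \<open>rho\<close> is at most \<open>3 / 2 * (r + s)\<close>, so its square is at
  most \<open>9 / 2 * (r\<^sup>2 + s\<^sup>2)\<close>. The new value of \<open>\<phi>\<close> is at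
  least \<open>x * y / 2\<close>, which is at least \<open>9 / 2 * (x + y)\<close> once both values
  are at least \<open>18\<close>. So \<open>rho\<close> grows at most like the square root of
  \<open>\<phi>\<close>.\<close>

lemma tame_rho_bound:
  assumes g: "geometric \<phi>" and f: "deform_fun \<phi> f" and t: "tame \<phi> f (X 0) (Y 0)"
  obtains C N where "\<And>n. n \<ge> N \<Longrightarrow> (rho \<phi> f (X n))\<^sup>2 \<le> C * \<phi> (X n) \<and> (rho \<phi> f (Y n))\<^sup>2 \<le> C * \<phi> (Y n)"
proof -
  interpret geometric_markoff \<phi> by unfold_locales fact
  note tn = tame_path[OF g f t]
  obtain N where N: "\<And>m. m \<ge> N \<Longrightarrow> outward \<phi> (X m) (Y m) \<and> \<phi> (X m) \<ge> 18 \<and> \<phi> (Y m) \<ge> 18"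
    using far_edge[OF g] by blast
  define C where "C = max ((rho \<phi> f (X N))\<^sup>2 / \<phi> (X N)) ((rho \<phi> f (Y N))\<^sup>2 / \<phi> (Y N))"
  have "(rho \<phi> f (X (N + n)))\<^sup>2 \<le> C * \<phi> (X (N + n)) \<and> (rho \<phi> f (Y (N + n)))\<^sup>2 \<le> C * \<phi> (Y (N + n))" for n
  proof (induction n)
    case 0
    have "(rho \<phi> f (X N))\<^sup>2 / \<phi> (X N) \<le> C" "(rho \<phi> f (Y N))\<^sup>2 / \<phi> (Y N) \<le> C" by (simp_all add: C_def)
    then show ?case using phi_pos[OF prim_X[of N]] phi_pos[OF prim_Y[of N]] by (simp add: divide_le_eq)
  next
    case (Suc n)
    let ?x = "\<phi> (X (N + n))" and ?y = "\<phi> (Y (N + n))"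
    let ?r = "rho \<phi> f (X (N + n))" and ?s = "rho \<phi> f (Y (N + n))" and ?d = "defect \<phi> f (X (N + n)) (Y (N + n))"
    have r: "0 \<le> ?r" "0 \<le> ?s" "0 \<le> ?d" "?d \<le> ?r" "?d \<le> ?s" using tn[of "N + n"] by (auto simp: tame_def)
    have xy: "?x \<ge> 18" "?y \<ge> 18" using N[of "N + n"] by auto
    have new: "rho \<phi> f (X (N + n) + Y (N + n)) = ?r + ?s + ?d" by (simp add: defect_def)
    have "(?r + ?s + ?d)\<^sup>2 \<le> (3 / 2 * (?r + ?s))\<^sup>2" using r by (intro power_mono) auto
    also have "\<dots> \<le> 9 / 2 * (?r\<^sup>2 + ?s\<^sup>2)"
      using zero_le_power2[of "?r - ?s"] by (simp add: power2_eq_square algebra_simps)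
    also have "\<dots> \<le> 9 / 2 * (C * ?x + C * ?y)" using Suc by (intro mult_left_mono add_mono) auto
    also have "\<dots> = C * (9 / 2 * (?x + ?y))" by (simp add: algebra_simps)
    also have "\<dots> \<le> C * \<phi> (X (N + n) + Y (N + n))"
    proof (rule mult_left_mono)
      have "18 * ?y \<le> ?x * ?y" "?x * 18 \<le> ?x * ?y" using xy by (intro mult_right_mono mult_left_mono; simp)+
      then have "9 / 2 * (?x + ?y) \<le> ?x * ?y / 2" by simp
      also have "\<dots> \<le> \<phi> (X (N + n) + Y (N + n))" using outward_ge[OF basis] N[of "N + n"] by simp
      finally show "9 / 2 * (?x + ?y) \<le> \<phi> (X (N + n) + Y (N + n))" .
      have "0 \<le> (rho \<phi> f (X N))\<^sup>2 / \<phi> (X N)" using phi_pos[OF prim_X[of N]] by simp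
      then show "0 \<le> C" by (simp add: C_def)
    qed
    finally have "(rho \<phi> f (X (N + n) + Y (N + n)))\<^sup>2 \<le> C * \<phi> (X (N + n) + Y (N + n))" unfolding new .
    then show ?case using step[of "N + n"] Suc by auto
  qed
  then show ?thesis using that[of N C] by (metis le_Suc_ex)
qed

text \<open>At a turn the relation bounds sums of nonnegative terms by \<open>2 * M\<close>, so
  \<open>a\<close> and \<open>b\<close> are at most \<open>2 * M\<close> divided by a large value of
  \<open>\<phi>\<close>. The determinant is then at most a constant times
  \<open>rho / \<phi>\<close> at the turning vector; by \<open>tame_rho_bound\<close> this tends to
  \<open>0\<close>, while the absolute value of the determinant is constant.\<close>

lemma bounded_det3_zero:
  assumes g: "geometric \<phi>" and f: "deform_fun \<phi> f" and t: "tame \<phi> f (X 0) (Y 0)"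
    and d: "deform_fun \<phi> a" "deform_fun \<phi> b"
    and nn: "\<And>w. prim w \<Longrightarrow> 0 \<le> a w" "\<And>w. prim w \<Longrightarrow> 0 \<le> b w"
    and M: "\<And>n. a (X n) \<le> M \<and> a (Y n) \<le> M" "\<And>n. b (X n) \<le> M \<and> b (Y n) \<le> M"
  shows "det3 f a b (X 0) (Y 0) (X 0 - Y 0) = 0"
proof (rule ccontr)
  interpret geometric_markoff \<phi> by unfold_locales fact
  define D where "D = \<bar>det3 f a b (X 0) (Y 0) (X 0 - Y 0)\<bar>"
  assume "det3 f a b (X 0) (Y 0) (X 0 - Y 0) \<noteq> 0"
  then have D0: "D > 0" by (simp add: D_def)
  obtain C N0 where C: "\<And>n. n \<ge> N0 \<Longrightarrow> (rho \<phi> f (X n))\<^sup>2 \<le> C * \<phi> (X n) \<and> (rho \<phi> f (Y n))\<^sup>2 \<le> C * \<phi> (Y n)"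
    using tame_rho_bound[OF g f t] by blast
  \<comment> \<open>\<open>40 = 8 + 8 + 24\<close>, the constants of the three terms of the
    determinant. \<open>B\<close> is chosen to make \<open>D\<^sup>2 * B\<close> larger than
    \<open>W\<^sup>2 * \<bar>C\<bar>\<close>.\<close>
  define W where "W = 40 * M\<^sup>2"
  define B where "B = (W\<^sup>2 * \<bar>C\<bar> + 1) / D\<^sup>2"
  obtain N1 where N1: "\<And>m. m \<ge> N1 \<Longrightarrow> outward \<phi> (X m) (Y m) \<and> \<phi> (X m) \<ge> B \<and> \<phi> (Y m) \<ge> B"
    using far_edge[OF g] by blast
  obtain m where m: "m \<ge> max N0 N1" "X (Suc m) = X m" "Y (Suc m) = X m + Y m"
    "X (Suc (Suc m)) = X m + (X m + Y m)" "Y (Suc (Suc m)) = X m + Y m"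
    using turning_point by blast
  have M0: "M \<ge> 0" using nn(1)[OF prim_X[of 0]] M(1)[of 0] by linarith
  let ?x = "X m" and ?n = "X m + Y m" and ?k = "X m + (X m + Y m)"
  have b1: "basis ?x ?n" using basis[of m] by simp
  have b2: "basis ?k ?n" using basis[of "Suc (Suc m)"] m by simp
  have pr: "prim ?x" "prim ?n" "prim ?k" using basis_prim b1 b2 by blast+
  have px: "\<phi> ?x > 2" "\<phi> ?n > 2" "\<phi> ?k > 2" using greater_2 pr by auto
  have out: "outward \<phi> ?x ?n" using N1[of "Suc m"] m by simp
  have kn: "\<phi> ?k > \<phi> ?n" using outward_greater[OF b1 out] by simp
  have small: "c ?x \<le> 2 * M / \<phi> ?n" "c ?n \<le> 2 * M / \<phi> ?k" "c ?k \<le> 2 * M / \<phi> ?n" "0 \<le> c ?x" "0 \<le> c ?n" "0 \<le> c ?k"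
    if c: "deform_fun \<phi> c" and nn: "\<And>w. prim w \<Longrightarrow> 0 \<le> c w" and M: "\<And>n. c (X n) \<le> M \<and> c (Y n) \<le> M" for c
  proof -
    show nn': "0 \<le> c ?x" "0 \<le> c ?n" "0 \<le> c ?k" using nn pr by auto
    have "?x - ?n = - Y m" by simp
    then have "c ?k + c (Y m) = c ?x * \<phi> ?n + \<phi> ?x * c ?n"
      using deform_add[OF c b1] deform_even[OF c, of "Y m"] by simp
    moreover have "c ?k \<le> M" "c (Y m) \<le> M" using M[of "Suc (Suc m)"] M[of m] m by auto
    moreover have "0 \<le> \<phi> ?x * c ?n" using nn' px by simp
    ultimately have "c ?x * \<phi> ?n \<le> 2 * M" by linarith
    then show "c ?x \<le> 2 * M / \<phi> ?n" using px by (simp add: le_divide_eq)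
    have "?k - ?n = ?x" by simp
    then have "c (?k + ?n) + c ?x = c ?k * \<phi> ?n + \<phi> ?k * c ?n"
      using deform_add[OF c b2] by simp
    \<comment> \<open>Either branch of the next step puts \<open>?k + ?n\<close> on the
      path.\<close>
    moreover have "c (?k + ?n) \<le> M"
      using step[of "Suc (Suc m)"] M[of "Suc (Suc (Suc m))"] m by auto
    moreover have "c ?x \<le> M" using M[of m] by simp
    moreover have "0 \<le> \<phi> ?k * c ?n" "0 \<le> c ?k * \<phi> ?n" using nn' px by simp_all
    ultimately have "c ?k * \<phi> ?n \<le> 2 * M" "c ?n * \<phi> ?k \<le> 2 * M" by (simp_all add: mult.commute)
    then show "c ?k \<le> 2 * M / \<phi> ?n" "c ?n \<le> 2 * M / \<phi> ?k" using px by (simp_all add: le_divide_eq)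
  qed
  note sa = small[OF d(1) nn(1) M(1)] and sb = small[OF d(2) nn(2) M(2)]
  have minor: "\<bar>a u * b v - a v * b u\<bar> \<le> 2 * (P * Q)"
    if "0 \<le> a u" "a u \<le> P" "0 \<le> b u" "b u \<le> P" "0 \<le> a v" "a v \<le> Q" "0 \<le> b v" "b v \<le> Q" for u v P Q
  proof -
    have "0 \<le> a u * b v" "0 \<le> a v * b u" "a u * b v \<le> P * Q" "a v * b u \<le> Q * P"
      using that by (intro mult_nonneg_nonneg mult_mono; linarith)+
    moreover have "Q * P = P * Q" by simp
    ultimately show ?thesis by linarith
  qed
  have tm: "tame \<phi> f ?x ?n" "tame \<phi> f ?k ?n" using tame_path[OF g f t, of "Suc m"] tame_path[OF g f t, of "Suc (Suc m)"] m by auto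
  define rx rn rk where "rx = rho \<phi> f ?x" and "rn = rho \<phi> f ?n" and "rk = rho \<phi> f ?k"
  have r: "0 \<le> rx" "0 \<le> rn" "0 \<le> rk" using tm by (auto simp: tame_def rx_def rn_def rk_def)
  have "rn = rx + rho \<phi> f (Y m) + defect \<phi> f ?x (Y m)" by (simp add: rn_def rx_def defect_def)
  moreover have "0 \<le> rho \<phi> f (Y m)" "0 \<le> defect \<phi> f ?x (Y m)" using tame_path[OF g f t, of m] by (auto simp: tame_def)
  ultimately have rxn: "rx \<le> rn" by linarith
  have "rk = rx + rn + defect \<phi> f ?x ?n" by (simp add: rn_def rx_def rk_def defect_def)
  moreover have "defect \<phi> f ?x ?n \<le> rx" using tm(1) by (simp add: tame_def rx_def)
  ultimately have rkn: "rk \<le> 3 * rn" using rxn by linarith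
  have fr: "f ?x = \<phi> ?x * rx" "f ?n = \<phi> ?n * rn" "f ?k = \<phi> ?k * rk"
    using px by (simp_all add: rx_def rn_def rk_def rho_def)
  let ?N = "\<phi> ?n" and ?K = "\<phi> ?k"
  have xn: "\<phi> ?x \<le> \<phi> ?k" using outward_greater[OF b1 out] by simp
  have m1: "\<bar>a ?n * b ?k - a ?k * b ?n\<bar> \<le> 2 * ((2 * M / ?K) * (2 * M / ?N))"
    by (rule minor) (use sa sb in auto)
  have m2: "\<bar>a ?x * b ?k - a ?k * b ?x\<bar> \<le> 2 * ((2 * M / ?N) * (2 * M / ?N))"
    by (rule minor) (use sa sb in auto)
  have m3: "\<bar>a ?x * b ?n - a ?n * b ?x\<bar> \<le> 2 * ((2 * M / ?N) * (2 * M / ?K))"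
    by (rule minor) (use sa sb in auto)
  have "\<bar>f ?x * (a ?n * b ?k - a ?k * b ?n)\<bar> \<le> (?K * rn) * (2 * ((2 * M / ?K) * (2 * M / ?N)))"
    unfolding abs_mult using m1 fr r px rxn xn by (intro mult_mono) (auto simp: abs_mult intro!: mult_mono)
  also have "\<dots> = 8 * M\<^sup>2 * (rn / ?N)" using px by (simp add: field_simps power2_eq_square)
  finally have t1: "\<bar>f ?x * (a ?n * b ?k - a ?k * b ?n)\<bar> \<le> 8 * M\<^sup>2 * (rn / ?N)" .
  have "\<bar>f ?n * (a ?x * b ?k - a ?k * b ?x)\<bar> \<le> (?N * rn) * (2 * ((2 * M / ?N) * (2 * M / ?N)))"
    unfolding abs_mult using m2 fr r px by (intro mult_mono) (auto simp: abs_mult)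
  also have "\<dots> = 8 * M\<^sup>2 * (rn / ?N)" using px by (simp add: field_simps power2_eq_square)
  finally have t2: "\<bar>f ?n * (a ?x * b ?k - a ?k * b ?x)\<bar> \<le> 8 * M\<^sup>2 * (rn / ?N)" .
  have "\<bar>f ?k * (a ?x * b ?n - a ?n * b ?x)\<bar> \<le> (?K * (3 * rn)) * (2 * ((2 * M / ?N) * (2 * M / ?K)))"
    unfolding abs_mult using m3 fr r px rkn by (intro mult_mono) (auto simp: abs_mult)
  also have "\<dots> = 24 * M\<^sup>2 * (rn / ?N)" using px by (simp add: field_simps power2_eq_square)
  finally have t3: "\<bar>f ?k * (a ?x * b ?n - a ?n * b ?x)\<bar> \<le> 24 * M\<^sup>2 * (rn / ?N)" .
  have "\<bar>det3 f a b ?x ?n ?k\<bar> \<le> W * (rn / ?N)"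
    unfolding det3_def W_def using t1 t2 t3 by linarith
  moreover have "\<bar>det3 f a b ?x ?n ?k\<bar> = D"
  proof -
    have "det3 f a b ?x ?n (?x - ?n) = - det3 f a b ?x ?n ?k"
      unfolding det3_def deform_add[OF f b1] deform_add[OF d(1) b1] deform_add[OF d(2) b1]
      by (simp add: algebra_simps)
    then show ?thesis using det3_invariant[OF markoff f d, of "Suc m"] m by (simp add: D_def)
  qed
  ultimately have "D * ?N \<le> W * rn" using px by (simp add: field_simps)
  then have "(D * ?N)\<^sup>2 \<le> (W * rn)\<^sup>2" using D0 px by (intro power_mono) auto
  also have "\<dots> = W\<^sup>2 * rn\<^sup>2" by (simp add: power_mult_distrib)
  also have "\<dots> \<le> W\<^sup>2 * (\<bar>C\<bar> * ?N)"
  proof (rule mult_left_mono)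
    have "rn\<^sup>2 \<le> C * ?N" using C[of "Suc m"] m by (simp add: rn_def)
    also have "\<dots> \<le> \<bar>C\<bar> * ?N" using px by (intro mult_right_mono) auto
    finally show "rn\<^sup>2 \<le> \<bar>C\<bar> * ?N" .
  qed simp
  also have "(D * ?N)\<^sup>2 = D\<^sup>2 * ?N * ?N" by (simp add: power2_eq_square)
  finally have "D\<^sup>2 * ?N * ?N \<le> W\<^sup>2 * \<bar>C\<bar> * ?N" by (simp only: mult.assoc)
  then have "D\<^sup>2 * ?N \<le> W\<^sup>2 * \<bar>C\<bar>" using px by simp
  moreover have "D\<^sup>2 * B \<le> D\<^sup>2 * ?N" using N1[of "Suc m"] m by (intro mult_left_mono) auto
  moreover have "D\<^sup>2 * B = W\<^sup>2 * \<bar>C\<bar> + 1" using D0 by (simp add: B_def)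
  ultimately show False by linarith
qed

text \<open>The determinant vanishes for three independent choices of \<open>f\<close>. Hence the
  two-by-two minors \<open>c1\<close>, \<open>c2\<close>, \<open>c3\<close> of \<open>a\<close> and
  \<open>b\<close> vanish, and the two triples of values are proportional.\<close>

lemma bounded_unique_entry:
  assumes g: "geometric \<phi>" and e: "entry (\<phi> (X 0), \<phi> (Y 0), \<phi> (X 0 - Y 0))"
    and d: "deform_fun \<phi> a" "deform_fun \<phi> b"
    and nn: "\<And>w. prim w \<Longrightarrow> 0 \<le> a w" "\<And>w. prim w \<Longrightarrow> 0 \<le> b w"
    and M: "\<And>n. a (X n) \<le> M \<and> a (Y n) \<le> M" "\<And>n. b (X n) \<le> M \<and> b (Y n) \<le> M"
  obtains s t where "s \<noteq> 0 \<or> t \<noteq> 0" "\<And>w. prim w \<Longrightarrow> s * a w + t * b w = 0"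
proof -
  interpret geometric_markoff \<phi> by unfold_locales fact
  note bas = basis[of 0]
  let ?x = "X 0" and ?y = "Y 0" and ?z = "X 0 - Y 0"
  let ?\<tau> = "(\<phi> ?x, \<phi> ?y, \<phi> ?z)"
  let ?\<psi> = "markoff_on ?x ?y ?\<tau>"
  have \<psi>: "\<phi> w = ?\<psi> w" if "prim w" for w using markoff_eq_on[OF markoff bas that] .
  have pr: "prim ?x" "prim ?y" "prim ?z" "prim (?x + ?y)"
    using basis_prim[OF bas] basis_prim(1)[of "?x - ?y" "?y"] basis_prim(1)[of "?x + ?y" "?y"] bas by simp_all
  have pos: "\<phi> ?x > 2" "\<phi> ?y > 2" "\<phi> ?z > 2" using greater_2 pr by auto
  have det: "det3 (deform_on ?x ?y ?\<tau> r) a b ?x ?y ?z = 0"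
    if r: "r \<in> {(\<phi> ?x, \<phi> ?y, \<phi> ?z), (\<phi> ?x, \<phi> ?y, 2 * \<phi> ?z), (2 * \<phi> ?x, \<phi> ?y, 2 * \<phi> ?z)}" for r
  proof (rule bounded_det3_zero[OF g _ _ d nn M])
    let ?f = "deform_on ?x ?y ?\<tau> r"
    show "deform_fun \<phi> ?f" by (rule deform_on_deform_fun[OF markoff bas])
    obtain r1 r2 r3 where r': "r = (r1, r2, r3)" by (metis prod_cases3)
    have "tame ?\<psi> ?f ?x ?y"
      by (rule tame_entry[OF bas e deform_on_deform[OF bas]]) (use r deform_on_base[OF bas] in \<open>simp add: r'\<close>)
    then show "tame \<phi> ?f ?x ?y"
      unfolding tame_def defect_def rho_def outward_def \<psi>[OF pr(1), symmetric] \<psi>[OF pr(2), symmetric]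
        \<psi>[OF pr(3), symmetric] \<psi>[OF pr(4), symmetric] .
  qed
  define c1 c2 c3 where "c1 = a ?y * b ?z - a ?z * b ?y" and "c2 = a ?x * b ?z - a ?z * b ?x" and "c3 = a ?x * b ?y - a ?y * b ?x"
  have eq: "r1 * c1 - r2 * c2 + r3 * c3 = 0"
    if "(r1, r2, r3) \<in> {(\<phi> ?x, \<phi> ?y, \<phi> ?z), (\<phi> ?x, \<phi> ?y, 2 * \<phi> ?z), (2 * \<phi> ?x, \<phi> ?y, 2 * \<phi> ?z)}" for r1 r2 r3
    using det[OF that] deform_on_base[OF bas] by (simp add: det3_def c1_def c2_def c3_def)
  have e1: "\<phi> ?x * c1 - \<phi> ?y * c2 + \<phi> ?z * c3 = 0" by (rule eq) simp
  have e2: "\<phi> ?x * c1 - \<phi> ?y * c2 + (2 * \<phi> ?z) * c3 = 0" by (rule eq) simp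
  have e3: "(2 * \<phi> ?x) * c1 - \<phi> ?y * c2 + (2 * \<phi> ?z) * c3 = 0" by (rule eq) simp
  have "\<phi> ?z * c3 = 0" "\<phi> ?x * c1 = 0" using e1 e2 e3 by linarith+
  then have c: "c1 = 0" "c3 = 0" using pos by auto
  then have "c2 = 0" using e1 pos by simp
  note c = c this
  have "\<exists>s t. (s \<noteq> 0 \<or> t \<noteq> 0) \<and> s * a ?x + t * b ?x = 0 \<and> s * a ?y + t * b ?y = 0 \<and> s * a ?z + t * b ?z = 0"
  proof -
    consider "a ?x = 0" "a ?y = 0" "a ?z = 0" | "a ?x \<noteq> 0" | "a ?y \<noteq> 0" | "a ?z \<noteq> 0" by blast
    then show ?thesis
    proof cases
      case 1 then show ?thesis by (intro exI[of _ 1] exI[of _ 0]) simp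
    next
      case 2 then show ?thesis using c by (intro exI[of _ "b ?x"] exI[of _ "- a ?x"]) (simp add: c1_def c2_def c3_def mult.commute)
    next
      case 3 then show ?thesis using c by (intro exI[of _ "b ?y"] exI[of _ "- a ?y"]) (simp add: c1_def c2_def c3_def mult.commute)
    next
      case 4 then show ?thesis using c by (intro exI[of _ "b ?z"] exI[of _ "- a ?z"]) (simp add: c1_def c2_def c3_def mult.commute)
    qed
  qed
  then obtain s t where st: "s \<noteq> 0 \<or> t \<noteq> 0" "s * a ?x + t * b ?x = 0" "s * a ?y + t * b ?y = 0" "s * a ?z + t * b ?z = 0" by blast
  have z: "deform_fun \<phi> (\<lambda>_. 0)" by (simp add: deform_fun_def)
  have "s * a w + t * b w = 0" if "prim w" for w
    by (rule deform_unique[OF deform_combination[OF d] z bas _ _ _ that]) (use st in simp_all)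
  then show ?thesis using that st(1) by blast
qed

lemma bounded_unique:
  assumes g: "geometric \<phi>" and d: "deform_fun \<phi> a" "deform_fun \<phi> b"
    and nn: "\<And>w. prim w \<Longrightarrow> 0 \<le> a w" "\<And>w. prim w \<Longrightarrow> 0 \<le> b w"
    and M: "\<And>n. a (X n) + b (X n) \<le> M \<and> a (Y n) + b (Y n) \<le> M"
  obtains s t where "s \<noteq> 0 \<or> t \<noteq> 0" "\<And>w. prim w \<Longrightarrow> s * a w + t * b w = 0"
proof -
  obtain k where k: "entry (\<phi> (X k), \<phi> (Y k), \<phi> (X k - Y k))" using entry_exists[OF g] .
  interpret s: farey_path \<mu> "\<lambda>n. X (n + k)" "\<lambda>n. Y (n + k)" "\<lambda>n. p (n + k)" "\<lambda>n. q (n + k)"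
    by (rule shift)
  have "a (X n) \<le> M \<and> a (Y n) \<le> M" "b (X n) \<le> M \<and> b (Y n) \<le> M" for n
    using M[of n] nn(1)[OF prim_X[of n]] nn(2)[OF prim_X[of n]] nn(1)[OF prim_Y[of n]] nn(2)[OF prim_Y[of n]] by auto
  then show ?thesis
    using s.bounded_unique_entry[OF g _ d nn, of M] k that by auto
qed

end

section \<open>Flat pieces of the boundary\<close>

context geometric_markoff
begin

lemma deform_at_inject:
  assumes "\<And>w. prim w \<Longrightarrow> deform_at \<phi> u w = deform_at \<phi> v w" shows "u = v"
proof -
  have "prim (1, 0)" "prim (0, 1)" "prim (1, 1)" by (simp_all add: prim_def)
  then have "u $ 1 = v $ 1" "u $ 2 = v $ 2" "u $ 3 = v $ 3" using assms deform_at_base by metis+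
  then show ?thesis by (simp add: vec_eq_iff forall_3)
qed

text \<open>Without a common zero \<open>u + v\<close> is positive at all slopes and, not being
  interior, is bounded along an irrational path. Then both summands are bounded there, since they
  are nonnegative, and \<open>bounded_unique\<close> makes them proportional.\<close>

lemma boundary_sum:
  assumes u: "u \<in> nonneg_cone \<phi>" and v: "v \<in> nonneg_cone \<phi>" and ind: "\<And>s t. s *\<^sub>R u + t *\<^sub>R v = 0 \<Longrightarrow> s = 0 \<and> t = 0"
    and b: "u + v \<notin> interior (nonneg_cone \<phi>)"
  shows "\<exists>w. prim w \<and> deform_at \<phi> u w = 0 \<and> deform_at \<phi> v w = 0"
proof (rule ccontr)
  assume no: "\<not> ?thesis"
  have nn: "0 \<le> deform_at \<phi> u w" "0 \<le> deform_at \<phi> v w" if "prim w" for w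
    using u v that by (auto simp: nonneg_cone_def)
  have pos: "deform_at \<phi> (u + v) w > 0" if "prim w" for w
    using no nn[OF that] that unfolding deform_at_add by (metis add_nonneg_eq_0_iff add_nonneg_nonneg order_le_less)
  obtain \<mu> X Y p q M where "farey_path \<mu> X Y p q"
    and M: "\<And>n. deform_at \<phi> (u + v) (X n) \<le> M \<and> deform_at \<phi> (u + v) (Y n) \<le> M"
    using boundary_bounded_path[OF pos b] by metis
  then interpret farey_path \<mu> X Y p q by simp
  obtain s t where st: "s \<noteq> 0 \<or> t \<noteq> 0" "\<And>w. prim w \<Longrightarrow> s * deform_at \<phi> u w + t * deform_at \<phi> v w = 0"
    using bounded_unique[OF geometric deform_at_deform[of u] deform_at_deform[of v] nn M[unfolded deform_at_add]] by blast
  have "s *\<^sub>R u + t *\<^sub>R v = 0"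
    by (rule deform_at_inject) (simp add: deform_at_add deform_at_scaleR deform_at_0 st)
  then show False using ind st(1) by blast
qed

section \<open>The faces of the cone\<close>

text \<open>As \<open>f X = 0\<close>, the linearized relation on the line of neighbours is the
  recurrence that \<open>\<phi>\<close> satisfies there; \<open>P\<close> and \<open>R\<close> solve
  \<open>P + R = f V\<close> and \<open>P * a + R / a = f (V + X)\<close>.\<close>

lemma deform_line:
  assumes f: "deform_fun \<phi> f" and b: "basis X V" and X: "f X = 0"
  defines "a \<equiv> exp (hlen \<phi> X)"
  defines "P \<equiv> (a * f (V + X) - f V) / (a * a - 1)" and "R \<equiv> a * (a * f V - f (V + X)) / (a * a - 1)"
  shows "f (V + scale n X) = P * exp (of_int n * hlen \<phi> X) + R * exp (- (of_int n * hlen \<phi> X))"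
proof -
  have a: "a > 1" using hlen_pos[OF basis_prim(1)[OF b]] by (simp add: a_def)
  then have a2: "a * a - 1 \<noteq> 0" "a \<noteq> 0" using less_1_mult[of a a] by auto
  show ?thesis
  proof (rule int_recurrence_unique[where c="\<phi> X"])
    fix n :: int
    have bn: "basis (V + scale n X) X" using b by (subst basis_commute) simp
    show "f (V + scale (n + 1) X) + f (V + scale (n - 1) X) = \<phi> X * f (V + scale n X)"
      using deform_add[OF f bn] X by (simp add: scale_add scale_diff algebra_simps)
    show "P * exp (of_int (n + 1) * hlen \<phi> X) + R * exp (- (of_int (n + 1) * hlen \<phi> X)) +
        (P * exp (of_int (n - 1) * hlen \<phi> X) + R * exp (- (of_int (n - 1) * hlen \<phi> X))) =
        \<phi> X * (P * exp (of_int n * hlen \<phi> X) + R * exp (- (of_int n * hlen \<phi> X)))"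
      unfolding phi_exp[OF basis_prim(1)[OF b]]
      by (simp add: ring_distribs exp_add exp_diff exp_minus field_simps)
  next
    show "f (V + scale 0 X) = P * exp (of_int 0 * hlen \<phi> X) + R * exp (- (of_int 0 * hlen \<phi> X))"
      using a2 by (simp add: P_def R_def divide_simps) (simp add: algebra_simps)
    have e: "exp (hlen \<phi> X) = a" "exp (- hlen \<phi> X) = 1 / a" by (simp_all add: a_def exp_minus inverse_eq_divide)
    have "f (V + X) = P * a + R * (1 / a)"
      using a2 by (simp add: P_def R_def divide_simps) (simp add: algebra_simps)
    then show "f (V + scale 1 X) = P * exp (of_int 1 * hlen \<phi> X) + R * exp (- (of_int 1 * hlen \<phi> X))"
      using e by simp
  qed
qed

lemma face_necessary:
  assumes f: "deform_fun \<phi> f" and b: "basis X V" and X: "f X = 0" and nn: "\<And>w. prim w \<Longrightarrow> 0 \<le> f w"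
  shows "f V \<le> exp (hlen \<phi> X) * f (V + X)" "f (V + X) \<le> exp (hlen \<phi> X) * f V"
proof -
  define h where "h = hlen \<phi> X"
  define a where "a = exp h"
  have h: "h > 0" unfolding h_def by (rule hlen_pos[OF basis_prim(1)[OF b]])
  then have a: "a > 1" by (simp add: a_def)
  then have a2: "a * a - 1 > 0" using less_1_mult[of a a] by auto
  define P R where "P = (a * f (V + X) - f V) / (a * a - 1)" and "R = a * (a * f V - f (V + X)) / (a * a - 1)"
  have line: "f (V + scale n X) = P * exp (of_int n * h) + R * exp (- (of_int n * h))" for n
    using deform_line[OF f b X] unfolding P_def R_def a_def h_def .
  have ge: "P * exp (of_int n * h) + R * exp (- (of_int n * h)) \<ge> 0" for n
    unfolding line[symmetric] using nn basis_prim(2)[of X "V + scale n X"] b by simp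
  \<comment> \<open>The growing exponential decides the sign for large \<open>n\<close>. This is
    applied to \<open>P\<close> in the positive and to \<open>R\<close> in the negative direction of
    the line.\<close>
  have key: "S \<ge> 0" if S: "\<And>n::nat. S * exp (real n * h) + T * exp (- (real n * h)) \<ge> 0" for S T
  proof (rule ccontr)
    assume "\<not> S \<ge> 0"
    then have S0: "S < 0" by simp
    obtain n :: nat where n: "real n * h > \<bar>T\<bar> / (- S)" using reals_Archimedean3[OF h] by blast
    have "exp (real n * h) > \<bar>T\<bar> / (- S)" using n exp_ge_add_one_self[of "real n * h"] by linarith
    then have "(- S) * exp (real n * h) > \<bar>T\<bar>" using S0 by (simp add: field_simps)
    moreover have "\<bar>T\<bar> * exp (- (real n * h)) \<le> \<bar>T\<bar> * 1" using h by (intro mult_left_mono) auto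
    moreover have "T * exp (- (real n * h)) \<le> \<bar>T\<bar> * exp (- (real n * h))" by (intro mult_right_mono) auto
    ultimately show False using S[of n] by simp
  qed
  have "P \<ge> 0" by (rule key[of P R]) (use ge[of "int _"] in simp)
  moreover have "R \<ge> 0"
  proof (rule key[of R P])
    fix n :: nat show "R * exp (real n * h) + P * exp (- (real n * h)) \<ge> 0" using ge[of "- int n"] by simp
  qed
  ultimately have "a * f (V + X) - f V \<ge> 0" "a * (a * f V - f (V + X)) \<ge> 0"
    unfolding P_def R_def using a2 by (simp_all add: zero_le_divide_iff)
  then show "f V \<le> exp (hlen \<phi> X) * f (V + X)" "f (V + X) \<le> exp (hlen \<phi> X) * f V"
    using a by (simp_all add: a_def h_def zero_le_mult_iff)
qed

text \<open>The inequalities say that \<open>P\<close> and \<open>R\<close> are nonnegative, so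
  \<open>f\<close> is nonnegative at all neighbours of \<open>X\<close>. Since \<open>f\<close>
  vanishes at the difference \<open>X\<close> of consecutive neighbours, their edges grow and
  \<open>pivot_induct\<close> reaches all other slopes. Strict inequalities make \<open>P\<close>
  and \<open>R\<close> positive and give positivity away from \<open>X\<close>.\<close>

lemma face_sufficient:
  assumes f: "deform_fun \<phi> f" and b: "basis X V" and X: "f X = 0"
    and le: "f V \<le> exp (hlen \<phi> X) * f (V + X)" "f (V + X) \<le> exp (hlen \<phi> X) * f V"
  shows "prim w \<Longrightarrow> 0 \<le> f w"
    and "f V < exp (hlen \<phi> X) * f (V + X) \<Longrightarrow> f (V + X) < exp (hlen \<phi> X) * f V \<Longrightarrow> prim w \<Longrightarrow>
      w \<noteq> X \<Longrightarrow> w \<noteq> - X \<Longrightarrow> 0 < f w"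
proof -
  define h where "h = hlen \<phi> X"
  define a where "a = exp h"
  have h: "h > 0" unfolding h_def by (rule hlen_pos[OF basis_prim(1)[OF b]])
  then have a: "a > 1" by (simp add: a_def)
  then have a2: "a * a - 1 > 0" using less_1_mult[of a a] by auto
  define P R where "P = (a * f (V + X) - f V) / (a * a - 1)" and "R = a * (a * f V - f (V + X)) / (a * a - 1)"
  have line: "f (V + scale n X) = P * exp (of_int n * h) + R * exp (- (of_int n * h))" for n
    using deform_line[OF f b X] unfolding P_def R_def a_def h_def .
  have PR: "P \<ge> 0" "R \<ge> 0" using le a a2 by (simp_all add: P_def R_def a_def h_def)
  have fn: "f (V + scale n X) \<ge> 0" for n unfolding line using PR by simp
  have grow: "grows f (V + scale n X) (V + scale (n + 1) X)" for n
  proof -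
    let ?u = "V + scale n X" and ?v = "V + scale (n + 1) X"
    have bas: "basis ?u ?v"
      using b by (metis add.assoc basis_commute basis_simps(3,9) scale_add scale_simps(2))
    have "?u - ?v = - X" by (simp add: scale_add)
    then have r: "f (?u + ?v) = f ?u * \<phi> ?v + \<phi> ?u * f ?v"
      using deform_add[OF f bas] X deform_even[OF f, of X] by simp
    have "f ?u * \<phi> ?v \<ge> f ?u * 2" "\<phi> ?u * f ?v \<ge> 2 * f ?v"
      using fn[of n] fn[of "n + 1"] greater_2[OF basis_prim(1)[OF bas]] greater_2[OF basis_prim(2)[OF bas]]
      by (intro mult_left_mono mult_right_mono; simp)+
    then show ?thesis
      unfolding grows_def using r bas fn[of n] fn[of "n + 1"] by linarith
  qed
  show "0 \<le> f w" if w: "prim w"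
    using _ b grow _ fn _ _ w
  proof (rule pivot_induct)
    show "grows f u v \<Longrightarrow> grows f u (u + v) \<and> grows f (u + v) v" for u v
      by (rule deform_grows_step[OF f])
    show "grows f u v \<Longrightarrow> 0 \<le> f (u + v)" for u v unfolding grows_def by linarith
  qed (use X f in simp_all)
  assume lt: "f V < exp (hlen \<phi> X) * f (V + X)" "f (V + X) < exp (hlen \<phi> X) * f V"
  have PR: "P > 0" "R > 0" using lt a a2 by (simp_all add: P_def R_def a_def h_def)
  have fn: "f (V + scale n X) > 0" for n unfolding line using PR by (simp add: add_pos_pos)
  define E where "E u v \<longleftrightarrow> grows f u v \<and> f u > 0 \<and> f v > 0" for u v
  have "w = X \<or> w = - X \<or> 0 < f w" if w: "prim w"
    using _ b _ _ _ _ _ w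
  proof (rule pivot_induct[of E])
    show "E u v \<Longrightarrow> E u (u + v) \<and> E (u + v) v" for u v
      using deform_grows_step[OF f, of u v] by (auto simp: E_def grows_def)
    show "E (V + scale n X) (V + scale (n + 1) X)" for n using grow fn by (simp add: E_def)
    show "V + scale n X = X \<or> V + scale n X = - X \<or> 0 < f (V + scale n X)" for n using fn by blast
    show "- w = X \<or> - w = - X \<or> 0 < f (- w)" if "w = X \<or> w = - X \<or> 0 < f w" for w
      using that f by auto
    show "E u v \<Longrightarrow> u + v = X \<or> u + v = - X \<or> 0 < f (u + v)" for u v
      by (auto simp: E_def grows_def)
  qed simp
  then show "prim w \<Longrightarrow> w \<noteq> X \<Longrightarrow> w \<noteq> - X \<Longrightarrow> 0 < f w" by blast
qed

end

section \<open>Lengthening deformations\<close>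

lemma markoff_fun_cong:
  assumes "markoff_fun \<phi>" "\<And>u. \<psi> (- u) = \<psi> u" "\<And>w. prim w \<Longrightarrow> \<psi> w = \<phi> w"
  shows "markoff_fun \<psi>"
  unfolding markoff_fun_def
proof (intro conjI allI impI)
  fix u v :: "int \<times> int" assume b: "basis u v"
  then have "prim u" "prim v" "prim (u + v)" "prim (u - v)"
    using basis_prim[OF b] basis_prim(1)[of "u + v" v] basis_prim(1)[of "u - v" v] by simp_all
  then show "\<psi> (u + v) + \<psi> (u - v) = \<psi> u * \<psi> v"
    using assms(1,3) b by (simp add: markoff_fun_def)
qed (rule assms)

lemma deform_fun_cong:
  assumes "deform_fun \<phi> f" "\<And>u. g (- u) = g u" "\<And>w. prim w \<Longrightarrow> g w = f w"
  shows "deform_fun \<phi> g"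
  unfolding deform_fun_def
proof (intro conjI allI impI)
  fix u v :: "int \<times> int" assume b: "basis u v"
  then have "prim u" "prim v" "prim (u + v)" "prim (u - v)"
    using basis_prim[OF b] basis_prim(1)[of "u + v" v] basis_prim(1)[of "u - v" v] by simp_all
  then show "g (u + v) + g (u - v) = g u * \<phi> v + \<phi> u * g v"
    using assms(1,3) b by (simp add: deform_fun_def)
qed (rule assms)

text \<open>By \<open>geometric_of_triple\<close> four strict inequalities suffice, and these
  persist near \<open>0\<close>. This gives access to \<open>lamination_length_eq\<close>, which is
  stated for geometric functions.\<close>

lemma (in geometric_markoff) eventually_geometric:
  assumes m: "\<And>t::real. markoff_fun (\<psi> t)" and \<psi>0: "\<And>w. prim w \<Longrightarrow> \<psi> 0 w = \<phi> w"
    and \<psi>': "\<And>w. prim w \<Longrightarrow> ((\<lambda>t. \<psi> t w) has_real_derivative f w) (at 0)"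
  shows "\<forall>\<^sub>F t in nhds 0. geometric (\<psi> t)"
proof -
  have p: "prim (1, 0)" "prim (0, - 1)" "prim ((1, 0) - (0, - 1))" by (simp_all add: prim_def)
  have lim: "((\<lambda>t. \<psi> t w) \<longlongrightarrow> \<phi> w) (nhds 0)" if "prim w" for w
    using DERIV_isCont[OF \<psi>'[OF that]] \<psi>0[OF that] by (simp add: continuous_at tendsto_nhds_iff)
  have limk: "((\<lambda>t. kappa (\<psi> t) (1, 0) (0, - 1)) \<longlongrightarrow> kappa \<phi> (1, 0) (0, - 1)) (nhds 0)"
    unfolding kappa_def using lim[OF p(1)] lim[OF p(2)] lim[OF p(3)] by (intro tendsto_intros)
  have "\<forall>\<^sub>F t in nhds 0. \<psi> t (1, 0) > 2 \<and> \<psi> t (0, - 1) > 2 \<and> \<psi> t ((1, 0) - (0, - 1)) > 2 \<and> kappa (\<psi> t) (1, 0) (0, - 1) < 2"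
    using order_tendstoD(1)[OF lim[OF p(1)] greater_2[OF p(1)]] order_tendstoD(1)[OF lim[OF p(2)] greater_2[OF p(2)]]
      order_tendstoD(1)[OF lim[OF p(3)] greater_2[OF p(3)]] order_tendstoD(2)[OF limk kappa_less[OF basis_std]]
    by eventually_elim blast
  then show ?thesis
    by eventually_elim (rule geometric_of_triple[OF m basis_std]; blast)
qed

lemma hlen_path_derivative:
  assumes "((\<lambda>t. \<psi> t w) has_real_derivative f w) (at 0)" "\<psi> 0 w > 2"
  shows "((\<lambda>t. hlen (\<psi> t) w) has_real_derivative tangent (\<psi> 0) f w) (at 0)"
  using DERIV_chain2[OF arcosh_half_derivative[OF assms(2)] assms(1)]
  by (simp add: hlen_def tangent_def)

lemma deformation_coords_slope:
  assumes geo: "geometric (\<lambda>w. \<Phi> (slope_of w))" and d: "infinitesimal_deformation \<Phi> \<Phi>'"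
  shows "deform_at (\<lambda>w. \<Phi> (slope_of w)) (deformation_coords \<Phi>') (reduced_form s) = \<Phi>' s"
proof -
  interpret geometric_markoff "\<lambda>w. \<Phi> (slope_of w)" using geo by unfold_locales
  have "slope_of (1, 0) = None" "slope_of (0, 1) = Some 0" "slope_of (1, 1) = Some 1"
    by (simp_all add: slope_of_def rat_number_collapse)
  then show ?thesis
    using deform_at_eq[OF d[unfolded infinitesimal_deformation_iff] prim_reduced_form[of s]]
    by (simp add: deformation_coords_def)
qed

lemma deformation_coords_surj:
  assumes geo: "geometric (\<lambda>w. \<Phi> (slope_of w))"
  obtains \<Phi>' where "infinitesimal_deformation \<Phi> \<Phi>'" "deformation_coords \<Phi>' = v"
proof -
  interpret geometric_markoff "\<lambda>w. \<Phi> (slope_of w)" using geo by unfold_locales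
  let ?f = "deform_at (\<lambda>w. \<Phi> (slope_of w)) v"
  note f = deform_at_deform[of v]
  define \<Phi>' where "\<Phi>' s = ?f (reduced_form s)" for s
  have \<Phi>': "\<Phi>' (slope_of w) = ?f w" if "prim w" for w
    unfolding \<Phi>'_def using reduced_form_slope_of[OF that] by (elim disjE) (simp_all add: deform_even[OF f])
  have "infinitesimal_deformation \<Phi> \<Phi>'"
    unfolding infinitesimal_deformation_iff by (rule deform_fun_cong[OF f _ \<Phi>']) simp
  moreover have "slope_of (1, 0) = None" "slope_of (0, 1) = Some 0" "slope_of (1, 1) = Some 1"
    by (simp_all add: slope_of_def rat_number_collapse)
  then have "\<Phi>' None = v $ 1" "\<Phi>' (Some 0) = v $ 2" "\<Phi>' (Some 1) = v $ 3"
    using \<Phi>'[of "(1, 0)"] \<Phi>'[of "(0, 1)"] \<Phi>'[of "(1, 1)"] deform_at_base[of v]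
    by (simp_all add: prim_def)
  then have "deformation_coords \<Phi>' = v"
    by (simp add: deformation_coords_def vec_eq_iff forall_3)
  ultimately show ?thesis using that by blast
qed

lemma lengthening_cone_eq:
  assumes geo: "geometric (\<lambda>w. \<Phi> (slope_of w))"
  shows "lengthening_cone \<Phi> = interior (nonneg_cone (\<lambda>w. \<Phi> (slope_of w)))"
proof -
  define \<phi> where "\<phi> = (\<lambda>w. \<Phi> (slope_of w))"
  interpret geometric_markoff \<phi> using geo unfolding \<phi>_def by unfold_locales
  have slopes: "slope_of (1, 0) = None" "slope_of (0, 1) = Some 0" "slope_of (1, 1) = Some 1"
    by (simp_all add: slope_of_def rat_number_collapse)
  have path: "(\<forall>t. markoff_fun (\<lambda>w. \<Psi> t (slope_of w))) \<and> (\<forall>w. prim w \<longrightarrow> \<Psi> 0 (slope_of w) = \<phi> w)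
      \<and> (\<forall>w. ((\<lambda>t. \<Psi> t (slope_of w)) has_real_derivative \<Phi>' (slope_of w)) (at 0))"
    if "deformation_path \<Phi> \<Phi>' \<Psi>" for \<Psi> \<Phi>'
    using that unfolding deformation_path_def markoff_map_iff \<phi>_def by simp
  \<comment> \<open>A derivative at \<open>0\<close> depends only on \<open>t\<close> near
    \<open>0\<close>, where the deformed functions are geometric.\<close>
  have deriv_eq: "((\<lambda>t. lamination_length (\<Psi> t) \<mu>) has_real_derivative D) (at 0) \<longleftrightarrow>
      ((\<lambda>t. 2 * stable_norm (\<lambda>w. \<Psi> t (slope_of w)) \<mu>) has_real_derivative D) (at 0)"
    if "deformation_path \<Phi> \<Phi>' \<Psi>" for \<Psi> \<Phi>' \<mu> D
  proof (rule DERIV_cong_ev)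
    have "\<forall>\<^sub>F t in nhds 0. geometric (\<lambda>w. \<Psi> t (slope_of w))"
      using eventually_geometric[of "\<lambda>t w. \<Psi> t (slope_of w)" "\<lambda>w. \<Phi>' (slope_of w)"] path[OF that] by blast
    then show "\<forall>\<^sub>F t in nhds 0. lamination_length (\<Psi> t) \<mu> = 2 * stable_norm (\<lambda>w. \<Psi> t (slope_of w)) \<mu>"
      by eventually_elim (simp add: lamination_length_eq)
  qed simp_all
  have rat_deriv: "((\<lambda>t. 2 * stable_norm (\<lambda>w. \<Psi> t (slope_of w)) (c *\<^sub>R rvec w)) has_real_derivative
      2 * (\<bar>c\<bar> * tangent \<phi> (\<lambda>w. \<Phi>' (slope_of w)) w)) (at 0)"
    if dp: "deformation_path \<Phi> \<Phi>' \<Psi>" and w: "prim w" for \<Psi> \<Phi>' c w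
  proof -
    let ?\<psi> = "\<lambda>t w. \<Psi> t (slope_of w)"
    have "\<forall>\<^sub>F t in nhds 0. geometric (?\<psi> t)"
      using eventually_geometric[of ?\<psi> "\<lambda>w. \<Phi>' (slope_of w)"] path[OF dp] by blast
    then have ev: "\<forall>\<^sub>F t in nhds 0. 2 * stable_norm (?\<psi> t) (c *\<^sub>R rvec w) = 2 * (\<bar>c\<bar> * hlen (?\<psi> t) w)"
    proof eventually_elim
      case (elim t)
      then interpret g: geometric_markoff "?\<psi> t" by unfold_locales
      show ?case by (simp add: g.stable_norm_scale g.stable_norm_rvec[OF w])
    qed
    have "((\<lambda>t. hlen (?\<psi> t) w) has_real_derivative tangent (?\<psi> 0) (\<lambda>w. \<Phi>' (slope_of w)) w) (at 0)"
      using path[OF dp] greater_2[OF w] w by (intro hlen_path_derivative) auto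
    moreover have "tangent (?\<psi> 0) (\<lambda>w. \<Phi>' (slope_of w)) w = tangent \<phi> (\<lambda>w. \<Phi>' (slope_of w)) w"
      using path[OF dp] w by (simp add: tangent_def)
    ultimately have "((\<lambda>t. 2 * (\<bar>c\<bar> * hlen (?\<psi> t) w)) has_real_derivative 2 * (\<bar>c\<bar> * tangent \<phi> (\<lambda>w. \<Phi>' (slope_of w)) w)) (at 0)"
      by (intro DERIV_cmult) simp
    then show ?thesis using DERIV_cong_ev[OF refl ev refl] by blast
  qed
  have tpos: "tangent \<phi> f w > 0 \<longleftrightarrow> f w > 0" if "prim w" for f w
  proof -
    have "2\<^sup>2 < (\<phi> w)\<^sup>2" using greater_2[OF that] by (intro power_strict_mono) auto
    then have "sqrt ((\<phi> w)\<^sup>2 - 4) > 0" by simp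
    then show ?thesis by (simp add: tangent_def zero_less_divide_iff)
  qed
  show ?thesis unfolding \<phi>_def[symmetric]
  proof (intro set_eqI iffI)
    fix v assume "v \<in> lengthening_cone \<Phi>"
    then obtain \<Phi>' where v: "v = deformation_coords \<Phi>'" and L: "lengthening \<Phi> \<Phi>'" by (auto simp: lengthening_cone_def)
    define f where "f = (\<lambda>w. \<Phi>' (slope_of w))"
    have f: "deform_fun \<phi> f"
      using L unfolding lengthening_def infinitesimal_deformation_iff f_def \<phi>_def by blast
    have fv: "deform_at \<phi> v w = f w" if "prim w" for w
      using deform_at_eq[OF f that] by (simp add: v deformation_coords_def f_def slopes)
    \<comment> \<open>Lengthening quantifies over all paths, so extracting information from it
      requires one: the path that is affine in the values on the standard triple.\<close>
    define \<Psi> where "\<Psi> t s = markoff_on (1, 0) (0, - 1) ((\<phi> (1, 0), \<phi> (0, - 1), \<phi> (1, 1)) + t *\<^sub>R (v $ 1, v $ 2, v $ 3)) (reduced_form s)" for t s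
    have mo: "markoff_fun (markoff_on (1, 0) (0, - 1) \<tau>)" for \<tau> by (rule markoff_on_markoff[OF basis_std])
    have \<Psi>: "\<Psi> t (slope_of w) = markoff_on (1, 0) (0, - 1) ((\<phi> (1, 0), \<phi> (0, - 1), \<phi> (1, 1)) + t *\<^sub>R (v $ 1, v $ 2, v $ 3)) w"
      if "prim w" for t w
      unfolding \<Psi>_def using reduced_form_slope_of[OF that] by (elim disjE) (simp_all add: markoff_even[OF mo])
    have dp: "deformation_path \<Phi> \<Phi>' \<Psi>"
      unfolding deformation_path_def
    proof (intro conjI allI)
      show "markoff_map (\<Psi> t)" for t
        unfolding markoff_map_iff by (rule markoff_fun_cong[OF mo _ \<Psi>]) simp
      show "\<Psi> 0 = \<Phi>"
      proof
        fix s
        have "\<Psi> 0 (slope_of (reduced_form s)) = \<phi> (reduced_form s)"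
          using markoff_eq_on[OF markoff basis_std prim_reduced_form, of s]
          unfolding \<Psi>[OF prim_reduced_form] by simp
        then show "\<Psi> 0 s = \<Phi> s" by (simp add: \<phi>_def)
      qed
      fix s
      let ?w = "reduced_form s"
      let ?\<tau> = "(\<phi> (1, 0), \<phi> (0, - 1), \<phi> (1, 1))" and ?h = "(v $ 1, v $ 2, v $ 3)"
      have "((\<lambda>t. ?\<tau> + t *\<^sub>R ?h) has_derivative (\<lambda>t. t *\<^sub>R ?h)) (at 0)"
        by (auto intro!: derivative_eq_intros)
      then have "((\<lambda>t. markoff_on (1, 0) (0, - 1) (?\<tau> + t *\<^sub>R ?h) ?w) has_derivative
          (\<lambda>t. deform_on (1, 0) (0, - 1) (?\<tau> + 0 *\<^sub>R ?h) (t *\<^sub>R ?h) ?w)) (at 0)"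
        by (rule has_derivative_compose) (rule markoff_on_has_derivative)
      moreover have "deform_on (1, 0) (0, - 1) (?\<tau> + 0 *\<^sub>R ?h) (t *\<^sub>R ?h) ?w = deform_at \<phi> v ?w * t" for t
        unfolding deform_at_def
        by (simp only: linear_scale[OF deform_on_linear] scaleR_zero_left add_0_right real_scaleR_def mult.commute)
      ultimately have "((\<lambda>t. \<Psi> t s) has_real_derivative deform_at \<phi> v ?w) (at 0)"
        by (simp add: has_field_derivative_def \<Psi>_def)
      then show "((\<lambda>t. \<Psi> t s) has_real_derivative \<Phi>' s) (at 0)"
        using fv[OF prim_reduced_form] by (simp add: f_def)
    qed
    have D: "\<exists>D>0. ((\<lambda>t. 2 * stable_norm (\<lambda>w. \<Psi> t (slope_of w)) \<mu>) has_real_derivative D) (at 0)" if "\<mu> \<noteq> 0" for \<mu>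
      using L dp that deriv_eq[OF dp] unfolding lengthening_def by blast
    have positive: "deform_at \<phi> v w > 0" if w: "prim w" for w
    proof -
      have "rvec w \<noteq> 0" using prim_nonzero[OF w] by (auto simp: rvec_def prod_eq_iff)
      then obtain D where "D > 0" "((\<lambda>t. 2 * stable_norm (\<lambda>w. \<Psi> t (slope_of w)) (1 *\<^sub>R rvec w)) has_real_derivative D) (at 0)"
        using D[of "rvec w"] by auto
      then have "tangent \<phi> f w > 0" using DERIV_unique[OF _ rat_deriv[OF dp w]] unfolding f_def by fastforce
      then show ?thesis using tpos[OF w] fv[OF w] by simp
    qed
    show "v \<in> interior (nonneg_cone \<phi>)"
    proof (rule ccontr)
      assume "v \<notin> interior (nonneg_cone \<phi>)"
      then obtain \<mu> X Y p q M where \<mu>: "irrational \<mu>" and pa: "farey_path \<mu> X Y p q"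
        and M: "\<And>n. deform_at \<phi> v (X n) \<le> M \<and> deform_at \<phi> v (Y n) \<le> M"
        using boundary_bounded_path[OF positive] by metis
      interpret farey_path \<mu> X Y p q by (rule pa)
      obtain E where E: "((\<lambda>t. stable_norm (\<lambda>w. \<Psi> t (slope_of w)) \<mu>) has_real_derivative E) (at 0)"
        "(\<lambda>n. Tn \<phi> f n) \<longlonglongrightarrow> E"
        using stable_norm_path_derivative[OF geometric, of "\<lambda>t w. \<Psi> t (slope_of w)" f] path[OF dp] f
        unfolding f_def by blast
      have "(\<lambda>n. Tn \<phi> f n) \<longlonglongrightarrow> 0"
      proof (rule bounded_Tn_limit[OF geometric])
        show "0 \<le> f w" if "prim w" for w using positive[OF that] fv[OF that] by simp
        show "f (X n) \<le> M \<and> f (Y n) \<le> M" for n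
          using M[of n] fv[OF prim_X[of n]] fv[OF prim_Y[of n]] by simp
      qed
      then have "E = 0" using E(2) LIMSEQ_unique by blast
      then have "((\<lambda>t. 2 * stable_norm (\<lambda>w. \<Psi> t (slope_of w)) \<mu>) has_real_derivative 0) (at 0)"
        using DERIV_cmult[OF E(1), of 2] by simp
      moreover have "cross \<mu> (rvec (1, 0)) \<noteq> 0" using \<mu> unfolding irrational_def by (simp add: zero_prod_def)
      then have "\<mu> \<noteq> 0" by (auto simp: cross_def)
      ultimately show False using D[of \<mu>] DERIV_unique by fastforce
    qed
  next
    fix v assume v: "v \<in> interior (nonneg_cone \<phi>)"
    define f where "f = deform_at \<phi> v"
    have f: "deform_fun \<phi> f" unfolding f_def by (rule deform_at_deform)
    obtain \<Phi>' where inf: "infinitesimal_deformation \<Phi> \<Phi>'" and coords: "deformation_coords \<Phi>' = v"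
      using deformation_coords_surj[OF geo] by blast
    have \<Phi>': "\<Phi>' (slope_of w) = f w" if "prim w" for w
      using deformation_coords_slope[OF geo inf, of "slope_of w"] reduced_form_slope_of[OF that]
      unfolding coords \<phi>_def[symmetric] f_def[symmetric] by (elim disjE) (simp_all add: deform_even[OF f])
    have f': "deform_fun \<phi> (\<lambda>w. \<Phi>' (slope_of w))"
      using inf unfolding infinitesimal_deformation_iff \<phi>_def .
    have "lengthening \<Phi> \<Phi>'"
      unfolding lengthening_def
    proof (intro conjI allI impI)
      show "infinitesimal_deformation \<Phi> \<Phi>'" by (rule inf)
      fix \<Psi> and \<mu> :: "real \<times> real" assume dp: "deformation_path \<Phi> \<Phi>' \<Psi>" and \<mu>: "\<mu> \<noteq> 0"
      have "\<exists>D>0. ((\<lambda>t. 2 * stable_norm (\<lambda>w. \<Psi> t (slope_of w)) \<mu>) has_real_derivative D) (at 0)"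
      proof (cases "irrational \<mu>")
        case True
        then obtain X Y p q where pa: "farey_path \<mu> X Y p q" using farey_path_exists by blast
        interpret farey_path \<mu> X Y p q by (rule pa)
        obtain E where E: "((\<lambda>t. stable_norm (\<lambda>w. \<Psi> t (slope_of w)) \<mu>) has_real_derivative E) (at 0)"
          "(\<lambda>n. Tn \<phi> (\<lambda>w. \<Phi>' (slope_of w)) n) \<longlonglongrightarrow> E"
          using stable_norm_path_derivative[OF geometric, of "\<lambda>t w. \<Psi> t (slope_of w)" "\<lambda>w. \<Phi>' (slope_of w)"] path[OF dp] f'
          by blast
        \<comment> \<open>Positive approximants could still have the limit \<open>0\<close>.
          Subtracting a small multiple of a deformation with derivatives at least \<open>c\<close>
          stays in the cone, which yields a uniform lower bound.\<close>
        obtain r c where r: "deform_fun \<phi> r" "c > 0" "\<forall>\<^sub>F n in sequentially. c \<le> Tn \<phi> r n"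
          using positive_deformation[OF geometric] by blast
        define x :: "real ^ 3" where "x = vector [r (1, 0), r (0, 1), r (1, 1)]"
        have rx: "deform_at \<phi> x w = r w" if "prim w" for w unfolding x_def by (rule deform_at_eq[OF r(1) that])
        obtain \<epsilon> where \<epsilon>: "\<epsilon> > 0" "v - \<epsilon> *\<^sub>R x \<in> nonneg_cone \<phi>" using interior_minus[OF v] by blast
        have ge: "f w \<ge> \<epsilon> * r w" if "prim w" for w
          using \<epsilon>(2) that unfolding nonneg_cone_def by (simp add: deform_at_diff deform_at_scaleR rx f_def)
        have Tge: "Tn \<phi> (\<lambda>w. \<Phi>' (slope_of w)) n \<ge> \<epsilon> * Tn \<phi> r n" for n
        proof -
          have tge: "tangent \<phi> (\<lambda>w. \<Phi>' (slope_of w)) w \<ge> \<epsilon> * tangent \<phi> r w" if w: "prim w" for w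
          proof -
            have "2\<^sup>2 < (\<phi> w)\<^sup>2" using greater_2[OF w] by (intro power_strict_mono) auto
            then have "sqrt ((\<phi> w)\<^sup>2 - 4) > 0" by simp
            then show ?thesis using ge[OF w] \<Phi>'[OF w] by (simp add: tangent_def divide_right_mono)
          qed
          have "p n * (\<epsilon> * tangent \<phi> r (X n)) + q n * (\<epsilon> * tangent \<phi> r (Y n)) \<le> Tn \<phi> (\<lambda>w. \<Phi>' (slope_of w)) n"
            unfolding Tn_def using pos[of n] tge[OF prim_X[of n]] tge[OF prim_Y[of n]]
            by (intro add_mono mult_left_mono) auto
          then show ?thesis by (simp add: Tn_def algebra_simps)
        qed
        have "\<forall>\<^sub>F n in sequentially. \<epsilon> * c \<le> Tn \<phi> (\<lambda>w. \<Phi>' (slope_of w)) n"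
          using r(3)
        proof eventually_elim
          case (elim n)
          then have "\<epsilon> * c \<le> \<epsilon> * Tn \<phi> r n" using \<epsilon>(1) by simp
          then show ?case using Tge[of n] by linarith
        qed
        then have "\<epsilon> * c \<le> E" using tendsto_lowerbound[OF E(2)] by simp
        then have "E > 0" using \<epsilon>(1) r(2) by (smt (verit) mult_pos_pos)
        then show ?thesis using DERIV_cmult[OF E(1), of 2] by (intro exI[of _ "2 * E"]) simp
      next
        case False
        then obtain c w where w: "prim w" "\<mu> = c *\<^sub>R rvec w" using not_irrational by blast
        then have "c \<noteq> 0" using \<mu> by auto
        moreover have "tangent \<phi> (\<lambda>w. \<Phi>' (slope_of w)) w > 0"
          using tpos[OF w(1)] \<Phi>'[OF w(1)] interior_positive[OF v w(1)] by (simp add: f_def)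
        ultimately show ?thesis using rat_deriv[OF dp w(1), of c] unfolding w(2)
          by (intro exI[of _ "2 * (\<bar>c\<bar> * tangent \<phi> (\<lambda>w. \<Phi>' (slope_of w)) w)"]) simp
      qed
      then show "\<exists>D>0. ((\<lambda>t. lamination_length (\<Psi> t) \<mu>) has_real_derivative D) (at 0)"
        using deriv_eq[OF dp] by blast
    qed
    then show "v \<in> lengthening_cone \<Phi>" unfolding lengthening_cone_def using coords by blast
  qed
qed

section \<open>Closed convex cones in the octant and their projectivizations\<close>

lemma proj_eq_range: "proj v = range (\<lambda>c. c *\<^sub>R v)"
  by (simp add: proj_def span_singleton)

lemma mem_proj: "v \<in> proj v"
  by (simp add: proj_def span_base)

lemma zero_mem_proj: "0 \<in> proj v"
  by (simp add: proj_def span_zero)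

lemma mem_projectivization: "p \<in> projectivization S \<longleftrightarrow> (\<exists>v\<in>S. v \<noteq> 0 \<and> p = proj v)"
  by (auto simp: projectivization_def)

lemma mem_Union_projectivization: "v \<in> S \<Longrightarrow> v \<noteq> 0 \<Longrightarrow> x \<in> proj v \<Longrightarrow> x \<in> \<Union>(projectivization S)"
  by (auto simp: projectivization_def)

lemma proj_scaleR: "c \<noteq> 0 \<Longrightarrow> proj (c *\<^sub>R v) = proj v"
  unfolding proj_eq_range
proof (intro equalityI subsetI)
  fix x assume c: "c \<noteq> 0" and "x \<in> range (\<lambda>k. k *\<^sub>R v)"
  then obtain k where "x = k *\<^sub>R v" by blast
  then have "x = (k / c) *\<^sub>R (c *\<^sub>R v)" using c by simp
  then show "x \<in> range (\<lambda>k. k *\<^sub>R c *\<^sub>R v)" by blast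
next
  fix x assume "x \<in> range (\<lambda>k. k *\<^sub>R c *\<^sub>R v)"
  then obtain k where "x = (k * c) *\<^sub>R v" by auto
  then show "x \<in> range (\<lambda>k. k *\<^sub>R v)" by blast
qed

lemma proj_uminus: "proj (- v) = proj v"
  using proj_scaleR[of "- 1" v] by simp

lemma proj_eqD: "proj u = proj v \<Longrightarrow> \<exists>c. u = c *\<^sub>R v"
proof -
  assume "proj u = proj v"
  then have "u \<in> range (\<lambda>c. c *\<^sub>R v)" using mem_proj[of u] proj_eq_range[of v] by simp
  then show ?thesis by blast
qed

lemma independent_pair:
  fixes u v :: "real ^ 3"
  assumes "u \<noteq> v" "independent {u, v}" "s *\<^sub>R u + t *\<^sub>R v = 0"
  shows "s = 0" "t = 0"
proof -
  have "(\<Sum>x\<in>{u, v}. (if x = u then s else t) *\<^sub>R x) = 0" using assms by simp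
  then have "(if u = u then s else t) = 0" "(if v = u then s else t) = 0"
    using independentD[OF assms(2) _ order_refl, of "\<lambda>x. if x = u then s else t"] by blast+
  then show "s = 0" "t = 0" using assms(1) by auto
qed

lemma independent_pairI:
  fixes u v :: "real ^ 3"
  assumes "\<And>s t. s *\<^sub>R u + t *\<^sub>R v = 0 \<Longrightarrow> s = 0 \<and> t = 0"
  shows "u \<noteq> v" "independent {u, v}"
proof -
  show "u \<noteq> v" using assms[of 1 "- 1"] by auto
  have "v \<noteq> 0" using assms[of 0 1] by auto
  moreover have "u \<notin> span {v}"
  proof
    assume "u \<in> span {v}"
    then obtain k where "u = k *\<^sub>R v" by (auto simp: span_singleton)
    then show False using assms[of 1 "- k"] by simp
  qed
  ultimately show "independent {u, v}" by (simp add: independent_insert)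
qed

definition total :: "real ^ 3 \<Rightarrow> real" where
  "total v = vector [1, 1, 1] \<bullet> v"

lemma total_eq: "total v = v $ 1 + v $ 2 + v $ 3"
  by (simp add: total_def inner_vec_def sum_3)

lemma total_simps: "total (u + v) = total u + total v" "total (c *\<^sub>R v) = c * total v" "total (- v) = - total v"
  by (simp_all add: total_def inner_add_right)

lemma closed_segment_cone:
  assumes "independent {u, v}" "u \<noteq> v"
  shows "proj ` closed_segment u v = proj ` ({s *\<^sub>R u + t *\<^sub>R v |s t. 0 \<le> s \<and> 0 \<le> t} - {0})"
proof (intro equalityI subsetI)
  fix p assume "p \<in> proj ` closed_segment u v"
  then obtain k where k: "0 \<le> k" "k \<le> 1" "p = proj ((1 - k) *\<^sub>R u + k *\<^sub>R v)"
    by (auto simp: closed_segment_def)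
  have "(1 - k) *\<^sub>R u + k *\<^sub>R v \<noteq> 0"
    using independent_pair[OF assms(2,1), of "1 - k" k] by auto
  then show "p \<in> proj ` ({s *\<^sub>R u + t *\<^sub>R v |s t. 0 \<le> s \<and> 0 \<le> t} - {0})"
    unfolding k(3) by (intro imageI DiffI CollectI exI[of _ "1 - k"] exI[of _ k]) (use k in simp_all)
next
  fix p assume "p \<in> proj ` ({s *\<^sub>R u + t *\<^sub>R v |s t. 0 \<le> s \<and> 0 \<le> t} - {0})"
  then obtain s t where st: "0 \<le> s" "0 \<le> t" "s *\<^sub>R u + t *\<^sub>R v \<noteq> 0" and p: "p = proj (s *\<^sub>R u + t *\<^sub>R v)" by auto
  define r where "r = s + t"
  have r: "r > 0"
  proof -
    have "\<not> (s = 0 \<and> t = 0)" using st(3) by auto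
    then show ?thesis using st unfolding r_def by linarith
  qed
  have "s *\<^sub>R u + t *\<^sub>R v = r *\<^sub>R ((1 - t / r) *\<^sub>R u + (t / r) *\<^sub>R v)"
  proof -
    have "r * (1 - t / r) = s" "r * (t / r) = t" using r by (simp_all add: r_def field_simps)
    then show ?thesis by (simp only: scaleR_add_right scaleR_scaleR)
  qed
  then have "p = proj ((1 - t / r) *\<^sub>R u + (t / r) *\<^sub>R v)" unfolding p using proj_scaleR[of r] r by simp
  moreover have "0 \<le> t / r" "t / r \<le> 1" using st r by (simp_all add: r_def)
  ultimately show "p \<in> proj ` closed_segment u v"
    unfolding closed_segment_def by (intro image_eqI[of _ _ "(1 - t / r) *\<^sub>R u + (t / r) *\<^sub>R v"]) auto
qed

lemma uminus_image: fixes A :: "(real ^ 3) set" shows "uminus ` A = {v. - v \<in> A}"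
proof (intro equalityI subsetI)
  fix x assume "x \<in> {v. - v \<in> A}"
  then have "- (- x) \<in> uminus ` A" by (intro imageI) simp
  then show "x \<in> uminus ` A" by simp
qed auto

text \<open>The cone over \<open>octant_hull A\<close> with its apex added, so that membership can
  be checked by nonnegative combinations.\<close>

definition octant_cone_of :: "proj_point set \<Rightarrow> (real ^ 3) set" where
  "octant_cone_of A = insert 0 (convex hull {v. v \<noteq> 0 \<and> (\<forall>i. 0 \<le> v $ i) \<and> proj v \<in> A})"

lemma octant_cone_of_scaleR:
  assumes "v \<in> octant_cone_of A" "0 \<le> c" shows "c *\<^sub>R v \<in> octant_cone_of A"
proof (cases "c = 0 \<or> v = 0")
  case False
  then have c: "c > 0" using assms by simp
  let ?T = "{v. v \<noteq> 0 \<and> (\<forall>i. 0 \<le> v $ i) \<and> proj v \<in> A}"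
  have "(*\<^sub>R) c ` ?T \<subseteq> ?T" using c by (auto simp: proj_scaleR)
  then have "convex hull ((*\<^sub>R) c ` ?T) \<subseteq> convex hull ?T" by (rule hull_mono)
  moreover have "v \<in> convex hull ?T" using assms(1) False by (simp add: octant_cone_of_def)
  then have "c *\<^sub>R v \<in> convex hull ((*\<^sub>R) c ` ?T)" unfolding convex_hull_scaling by (rule imageI)
  ultimately show ?thesis by (auto simp: octant_cone_of_def)
qed (auto simp: octant_cone_of_def)

lemma octant_cone_of_add:
  assumes "u \<in> octant_cone_of A" "v \<in> octant_cone_of A" shows "u + v \<in> octant_cone_of A"
proof (cases "u = 0 \<or> v = 0")
  case False
  let ?H = "convex hull {v. v \<noteq> 0 \<and> (\<forall>i. 0 \<le> v $ i) \<and> proj v \<in> A}"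
  have "(1 / 2) *\<^sub>R u + (1 / 2) *\<^sub>R v \<in> ?H"
    using assms False by (intro convexD[OF convex_convex_hull]) (auto simp: octant_cone_of_def)
  then have "2 *\<^sub>R ((1 / 2) *\<^sub>R u + (1 / 2) *\<^sub>R v) \<in> octant_cone_of A"
    by (intro octant_cone_of_scaleR) (auto simp: octant_cone_of_def)
  then show ?thesis by (simp add: scaleR_add_right)
qed (use assms in auto)

lemma octant_cone_of_base:
  assumes "\<And>i. 0 \<le> v $ i" "proj v \<in> A" shows "v \<in> octant_cone_of A"
proof (cases "v = 0")
  case False
  then have "v \<in> {v. v \<noteq> 0 \<and> (\<forall>i. 0 \<le> v $ i) \<and> proj v \<in> A}" using assms by simp
  then show ?thesis unfolding octant_cone_of_def by (intro insertI2 hull_inc)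
qed (simp add: octant_cone_of_def)

lemma octant_hullI: "v \<in> octant_cone_of A \<Longrightarrow> v \<noteq> 0 \<Longrightarrow> proj v \<in> octant_hull A"
  by (auto simp: octant_cone_of_def octant_hull_def)

lemma octant_total_pos:
  assumes "v \<noteq> 0" "\<And>i. 0 \<le> v $ i" shows "total v > 0"
proof (rule ccontr)
  assume "\<not> total v > 0"
  then have "v $ 1 = 0" "v $ 2 = 0" "v $ 3 = 0"
    using assms(2)[of 1] assms(2)[of 2] assms(2)[of 3] by (simp_all add: total_eq)
  then show False using assms(1) by (simp add: vec_eq_iff forall_3)
qed

lemma octant_hull_subset:
  assumes "convex G" and T: "\<And>v. v \<noteq> 0 \<Longrightarrow> (\<And>i. 0 \<le> v $ i) \<Longrightarrow> proj v \<in> A \<Longrightarrow> v \<in> G"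
  shows "octant_hull A \<subseteq> proj ` (G - {0})"
proof -
  let ?T = "{v. v \<noteq> 0 \<and> (\<forall>i. 0 \<le> v $ i) \<and> proj v \<in> A}"
  have "convex hull ?T \<subseteq> G" using T assms(1) by (intro hull_minimal) auto
  \<comment> \<open>The coordinate sum keeps the hull away from \<open>0\<close>.\<close>
  moreover have "convex hull ?T \<subseteq> {v. 0 < total v}"
  proof (rule hull_minimal)
    show "?T \<subseteq> {v. 0 < total v}" using octant_total_pos by auto
    show "convex {v. 0 < total v}" unfolding total_def using convex_halfspace_gt[of 0 "vector [1, 1, 1] :: real ^ 3"] by simp
  qed
  ultimately have "convex hull ?T \<subseteq> G - {0}" by (auto simp: total_eq)
  then show ?thesis unfolding octant_hull_def by blast
qed

lemma octant_hull_pair: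
  assumes nn: "\<And>i. 0 \<le> u $ i" "\<And>i. 0 \<le> v $ i" and ind: "u \<noteq> v" "independent {u, v}"
  shows "octant_hull {proj u, proj v} = proj ` closed_segment u v"
proof -
  let ?C = "{s *\<^sub>R u + t *\<^sub>R v |s t. 0 \<le> s \<and> 0 \<le> t}"
  have nz: "u \<noteq> 0" "v \<noteq> 0" using independent_pair[OF ind, of 1 0] independent_pair[OF ind, of 0 1] by auto
  have conv: "convex ?C"
  proof (rule convexI)
    fix x y and a b :: real assume "x \<in> ?C" "y \<in> ?C" and ab: "0 \<le> a" "0 \<le> b"
    then obtain s t s' t' where st: "0 \<le> s" "0 \<le> t" "x = s *\<^sub>R u + t *\<^sub>R v" "0 \<le> s'" "0 \<le> t'" "y = s' *\<^sub>R u + t' *\<^sub>R v" by auto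
    have "a *\<^sub>R x + b *\<^sub>R y = (a * s + b * s') *\<^sub>R u + (a * t + b * t') *\<^sub>R v" by (simp add: st algebra_simps)
    moreover have "0 \<le> a * s + b * s'" "0 \<le> a * t + b * t'" using st ab by simp_all
    ultimately show "a *\<^sub>R x + b *\<^sub>R y \<in> ?C" by blast
  qed
  have sub: "x \<in> ?C" if x: "x \<noteq> 0" "\<And>i. 0 \<le> x $ i" and px: "proj x \<in> {proj u, proj v}" for x
  proof -
    from px obtain c y where c: "x = c *\<^sub>R y" "y = u \<or> y = v" using proj_eqD by blast
    then have "total y > 0" using octant_total_pos[of u] octant_total_pos[of v] nn nz by auto
    then have "c > 0" using octant_total_pos[OF x] unfolding c total_simps by (simp add: zero_less_mult_iff)
    then show "x \<in> ?C" using c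
      by (elim disjE) (rule CollectI, rule exI[of _ c], rule exI[of _ 0], simp,
        rule CollectI, rule exI[of _ 0], rule exI[of _ c], simp)
  qed
  have "octant_hull {proj u, proj v} \<subseteq> proj ` (?C - {0})"
    by (rule octant_hull_subset[OF conv sub])
  moreover have "proj ` (?C - {0}) \<subseteq> octant_hull {proj u, proj v}"
  proof
    fix p assume "p \<in> proj ` (?C - {0})"
    then obtain s t where "0 \<le> s" "0 \<le> t" "s *\<^sub>R u + t *\<^sub>R v \<noteq> 0" and p: "p = proj (s *\<^sub>R u + t *\<^sub>R v)"
      by auto
    then show "p \<in> octant_hull {proj u, proj v}"
      unfolding p using nn by (intro octant_hullI octant_cone_of_add octant_cone_of_scaleR octant_cone_of_base) auto
  qed
  ultimately show ?thesis unfolding closed_segment_cone[OF ind(2,1)] by blast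
qed

text \<open>Projective closure, interior and boundary are defined through unions of lines, that is,
  through \<open>G\<close> together with its negative. The octant condition makes
  \<open>total\<close> positive on \<open>G - {0}\<close>, which separates the two halves and brings
  everything back to \<open>G\<close>.\<close>

locale octant_cone =
  fixes G :: "(real ^ 3) set"
  assumes closed: "closed G"
    and add: "\<And>u v. u \<in> G \<Longrightarrow> v \<in> G \<Longrightarrow> u + v \<in> G"
    and scale: "\<And>v c. v \<in> G \<Longrightarrow> 0 \<le> c \<Longrightarrow> c *\<^sub>R v \<in> G"
    and octant: "\<And>v i. v \<in> G \<Longrightarrow> 0 \<le> v $ i"
    and interior_nonempty: "interior G \<noteq> {}"
begin

lemma convex: "convex G"
  by (rule convexI) (intro add scale)

lemma zero: "0 \<in> G"
proof -
  obtain e where "e \<in> G" using interior_nonempty interior_subset by blast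
  then show ?thesis using scale[of e 0] by simp
qed

lemma total_pos: "v \<in> G \<Longrightarrow> v \<noteq> 0 \<Longrightarrow> total v > 0"
  using octant_total_pos[of v] octant[of v] by simp

lemma zero_not_interior: "0 \<notin> interior G"
proof
  assume "0 \<in> interior G"
  then obtain \<epsilon> where "\<epsilon> > 0" "0 - \<epsilon> *\<^sub>R (vector [1, 1, 1] :: real ^ 3) \<in> G" by (rule interior_minus)
  then show False using octant[of _ 1] by fastforce
qed

lemma scale_interior: assumes "v \<in> interior G" "c > 0" shows "c *\<^sub>R v \<in> interior G"
proof (rule interiorI)
  show "open ((*\<^sub>R) c ` interior G)" using assms by (intro open_scaling) auto
  show "c *\<^sub>R v \<in> (*\<^sub>R) c ` interior G" using assms by blast
  show "(*\<^sub>R) c ` interior G \<subseteq> G" using assms(2) interior_subset[of G] by (auto intro!: scale)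
qed

lemma line_cases:
  assumes "proj z \<in> proj ` (G - {0})" shows "z \<in> G \<or> - z \<in> G"
proof -
  obtain g where g: "g \<in> G" "proj z = proj g" using assms by auto
  then obtain c where c: "z = c *\<^sub>R g" using proj_eqD by blast
  show ?thesis
  proof (cases "c \<ge> 0")
    case True then show ?thesis using scale g c by blast
  next
    case False
    then have "- z = (- c) *\<^sub>R g" "- c \<ge> 0" using c by simp_all
    then show ?thesis using scale[OF g(1), of "- c"] by simp
  qed
qed

definition PG :: "proj_point set" where
  "PG = proj ` (G - {0})"

definition lines :: "(real ^ 3) set" where
  "lines = {v. v \<in> G \<or> - v \<in> G}"

lemma Union_PG: "\<Union>PG = lines"
proof (intro equalityI subsetI)
  fix x assume "x \<in> \<Union>PG"
  then obtain g c where g: "g \<in> G" "x = c *\<^sub>R g" by (auto simp: PG_def proj_eq_range)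
  show "x \<in> lines"
  proof (cases "c \<ge> 0")
    case True then show ?thesis using scale g by (simp add: lines_def)
  next
    case False
    then have "- x = (- c) *\<^sub>R g" "- c \<ge> 0" using g by simp_all
    then show ?thesis using scale[OF g(1), of "- c"] by (simp add: lines_def)
  qed
next
  fix x assume x: "x \<in> lines"
  obtain e where e: "e \<in> interior G" using interior_nonempty by blast
  then have e': "e \<in> G" "e \<noteq> 0" using interior_subset zero_not_interior by auto
  show "x \<in> \<Union>PG"
  proof (cases "x = 0")
    case True
    then show ?thesis using e' zero_mem_proj[of e] by (auto simp: PG_def)
  next
    case False
    then have "proj x \<in> PG" using x proj_uminus[of x] unfolding lines_def PG_def
      by (metis (mono_tags, lifting) Diff_iff image_eqI mem_Collect_eq neg_equal_0_iff_equal singletonD)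
    then show ?thesis using mem_proj by blast
  qed
qed

lemma projectivization_lines: "projectivization lines = PG"
proof (intro equalityI subsetI)
  fix p assume "p \<in> projectivization lines"
  then obtain v where v: "v \<in> lines" "v \<noteq> 0" "p = proj v" by (auto simp: projectivization_def)
  then show "p \<in> PG" using proj_uminus[of v] unfolding lines_def PG_def
    by (metis (mono_tags, lifting) Diff_iff image_eqI mem_Collect_eq neg_equal_0_iff_equal singletonD)
qed (auto simp: PG_def projectivization_def lines_def)

lemma Union_interior: "\<Union>(projectivization (interior G)) = {v. v \<in> interior G \<or> - v \<in> interior G \<or> v = 0}"
proof (intro equalityI subsetI)
  fix x assume "x \<in> \<Union>(projectivization (interior G))"
  then obtain g c where g: "g \<in> interior G" "x = c *\<^sub>R g" by (auto simp: projectivization_def proj_eq_range)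
  consider "c > 0" | "c = 0" | "c < 0" by linarith
  then show "x \<in> {v. v \<in> interior G \<or> - v \<in> interior G \<or> v = 0}"
  proof cases
    case 1 then show ?thesis using scale_interior g by simp
  next
    case 2 then show ?thesis using g by simp
  next
    case 3 then show ?thesis using scale_interior[OF g(1), of "- c"] g by simp
  qed
next
  fix x assume x: "x \<in> {v. v \<in> interior G \<or> - v \<in> interior G \<or> v = 0}"
  obtain e where e: "e \<in> interior G" using interior_nonempty by blast
  consider "x \<in> interior G" | "- x \<in> interior G" | "x = 0" using x by blast
  then show "x \<in> \<Union>(projectivization (interior G))"
  proof cases
    case 1
    then show ?thesis using zero_not_interior mem_proj[of x] by (metis mem_Union_projectivization)
  next
    case 2
    then have "x \<in> proj (- x)" using mem_proj[of x] by (simp add: proj_uminus)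
    then show ?thesis using zero_not_interior 2 by (metis mem_Union_projectivization)
  next
    case 3
    then show ?thesis using zero_not_interior e zero_mem_proj by (metis mem_Union_projectivization)
  qed
qed

lemma closure_interior: "closure {v. v \<in> interior G \<or> - v \<in> interior G \<or> v = 0} = lines"
proof -
  have c: "closure (interior G) = G"
    using convex_closure_interior[OF convex interior_nonempty] closed by simp
  have eq: "{v. v \<in> interior G \<or> - v \<in> interior G \<or> v = 0} = interior G \<union> uminus ` interior G \<union> {0}"
    by (auto simp: uminus_image)
  have "closure (uminus ` interior G) = uminus ` G"
    using closure_injective_linear_image[OF linear_uminus, of "interior G"] c by (simp add: inj_on_def)
  then have "closure {v. v \<in> interior G \<or> - v \<in> interior G \<or> v = 0} = G \<union> uminus ` G \<union> {0}"
    unfolding eq by (simp only: closure_Un c closure_closed[OF closed_singleton])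
  also have "\<dots> = lines" using zero by (auto simp: lines_def uminus_image)
  finally show ?thesis .
qed

lemma proj_closure_eq: "proj_closure (projectivization (interior G)) = PG"
  unfolding proj_closure_def Union_interior closure_interior by (rule projectivization_lines)

lemma closed_lines: "closed lines"
  unfolding closure_interior[symmetric] by (rule closed_closure)

lemma continuous_on_total: "continuous_on S total"
  unfolding total_def by (intro continuous_intros)

lemma interior_lines: "interior lines = {v. v \<in> interior G \<or> - v \<in> interior G}"
proof (intro equalityI subsetI)
  \<comment> \<open>The half-space where \<open>total\<close> is positive removes the opposite
    half.\<close>
  have pos: "x \<in> interior G" if x: "x \<in> interior lines" "x \<in> G" "x \<noteq> 0" for x
  proof (rule interiorI)
    show "open (interior lines \<inter> {v. 0 < total v})"
      by (intro open_Int open_interior open_Collect_less continuous_on_const continuous_on_total)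
    show "x \<in> interior lines \<inter> {v. 0 < total v}" using x total_pos by simp
    show "interior lines \<inter> {v. 0 < total v} \<subseteq> G"
    proof
      fix v assume v: "v \<in> interior lines \<inter> {v. 0 < total v}"
      then have "v \<in> lines" "total v > 0" "v \<noteq> 0" using interior_subset by (auto simp: total_eq)
      then show "v \<in> G" using total_pos[of "- v"] by (auto simp: lines_def total_simps)
    qed
  qed
  have neg: "- x \<in> interior lines" if "x \<in> interior lines" for x
  proof -
    have "uminus ` lines = lines" by (auto simp: lines_def uminus_image)
    then show ?thesis using interior_negations[of lines] that by auto
  qed
  fix x assume x: "x \<in> interior lines"
  \<comment> \<open>A vector with coordinates of opposite signs lies in neither half, so
    \<open>0\<close> is not an interior point.\<close>
  have "x \<noteq> 0"
  proof
    assume "x = 0"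
    then obtain \<epsilon> where \<epsilon>: "\<epsilon> > 0" "0 - \<epsilon> *\<^sub>R (vector [1, - 1, 0] :: real ^ 3) \<in> lines" using x by (metis interior_minus)
    let ?v = "- \<epsilon> *\<^sub>R (vector [1, - 1, 0] :: real ^ 3)"
    have "?v $ 1 < 0" "(- ?v) $ 2 < 0" using \<epsilon> by simp_all
    then have "?v \<notin> G" "- ?v \<notin> G" using octant[of ?v 1] octant[of "- ?v" 2] by linarith+
    then show False using \<epsilon>(2) by (simp add: lines_def)
  qed
  moreover have "x \<in> lines" using x interior_subset by blast
  ultimately show "x \<in> {v. v \<in> interior G \<or> - v \<in> interior G}"
    using pos[of x] pos[of "- x"] neg[OF x] x by (auto simp: lines_def)
next
  fix x assume x: "x \<in> {v. v \<in> interior G \<or> - v \<in> interior G}"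
  have "uminus ` interior G \<subseteq> interior lines"
  proof (rule interior_maximal)
    show "uminus ` interior G \<subseteq> lines" using interior_subset[of G] by (auto simp: lines_def)
    show "open (uminus ` interior G)" by (rule open_negations) simp
  qed
  moreover have "interior G \<subseteq> interior lines" by (rule interior_mono) (auto simp: lines_def)
  ultimately show "x \<in> interior lines" using x by (auto simp: uminus_image)
qed

lemma proj_interior_eq: "proj_interior PG = projectivization (interior G)"
proof (intro equalityI subsetI)
  fix p assume "p \<in> proj_interior PG"
  then obtain v where v: "v \<in> interior lines" "v \<noteq> 0" "p = proj v"
    unfolding proj_interior_def Union_PG mem_projectivization by blast
  then have "v \<in> interior G \<or> - v \<in> interior G" by (simp add: interior_lines)
  then show "p \<in> projectivization (interior G)"
    unfolding v(3) mem_projectivization using v(2) proj_uminus[of v] by (metis neg_equal_0_iff_equal)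
next
  fix p assume "p \<in> projectivization (interior G)"
  then show "p \<in> proj_interior PG"
    unfolding proj_interior_def Union_PG mem_projectivization interior_lines by blast
qed

lemma mem_proj_boundary:
  assumes "v \<in> G" "v \<noteq> 0" shows "proj v \<in> proj_boundary PG \<longleftrightarrow> v \<notin> interior G"
proof
  assume "proj v \<in> proj_boundary PG"
  then obtain z where z: "z \<in> frontier lines" "z \<noteq> 0" "proj v = proj z"
    unfolding proj_boundary_def Union_PG mem_projectivization by blast
  then have zi: "z \<notin> interior G" "- z \<notin> interior G" "z \<in> lines"
    using closed_lines by (auto simp: frontier_def interior_lines)
  obtain c where c: "z = c *\<^sub>R v" using z(3) proj_eqD by metis
  show "v \<notin> interior G"
  proof
    assume v: "v \<in> interior G"
    have "c \<noteq> 0" using z(2) c by auto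
    then consider "c > 0" | "- c > 0" by linarith
    then show False
      using scale_interior[OF v, of c] scale_interior[OF v, of "- c"] zi c by cases auto
  qed
next
  assume v: "v \<notin> interior G"
  have "- v \<notin> interior G"
  proof
    assume "- v \<in> interior G"
    then have "total (- v) > 0" using total_pos[of "- v"] interior_subset assms(2) by auto
    then show False using total_pos[OF assms] by (simp add: total_simps)
  qed
  then have "v \<notin> interior lines" using v by (simp add: interior_lines)
  moreover have "v \<in> closure lines" using assms(1) closed_lines by (simp add: lines_def)
  ultimately have "v \<in> frontier lines" by (simp add: frontier_def)
  then show "proj v \<in> proj_boundary PG"
    using assms(2) unfolding proj_boundary_def Union_PG mem_projectivization by blast
qed

lemma proj_boundary_subset: "proj_boundary PG \<subseteq> PG"
proof
  fix p assume "p \<in> proj_boundary PG"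
  then obtain z where z: "z \<in> frontier lines" "z \<noteq> 0" "p = proj z"
    unfolding proj_boundary_def Union_PG mem_projectivization by blast
  then have "z \<in> lines" using closed_lines by (simp add: frontier_def)
  then show "p \<in> PG" using z projectivization_lines mem_projectivization by blast
qed

lemma projective_polygon_PG: "projective_polygon PG"
  unfolding projective_polygon_def
proof -
  let ?w = "vector [1, 1, 1] :: real ^ 3"
  have 1: "?w \<noteq> 0" by (simp add: vec_eq_iff forall_3)
  have 2: "PG \<subseteq> proj ` {v. ?w \<bullet> v = 1}"
  proof
    fix p assume "p \<in> PG"
    then obtain v where v: "v \<in> G" "v \<noteq> 0" "p = proj v" by (auto simp: PG_def)
    then have t: "total v > 0" using total_pos by blast
    have "?w \<bullet> ((1 / total v) *\<^sub>R v) = 1" using t unfolding total_def by simp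
    moreover have "p = proj ((1 / total v) *\<^sub>R v)" using proj_scaleR[of "1 / total v" v] t v by simp
    ultimately show "p \<in> proj ` {v. ?w \<bullet> v = 1}" by blast
  qed
  have "{v. ?w \<bullet> v = 1 \<and> proj v \<in> PG} = {v. ?w \<bullet> v = 1} \<inter> G"
  proof (intro equalityI subsetI)
    fix v assume v: "v \<in> {v. ?w \<bullet> v = 1 \<and> proj v \<in> PG}"
    then have "v \<in> G \<or> - v \<in> G" "total v = 1" using line_cases by (auto simp: PG_def total_def)
    moreover have "v \<noteq> 0" using v by auto
    ultimately show "v \<in> {v. ?w \<bullet> v = 1} \<inter> G" using total_pos[of "- v"] v by (auto simp: total_simps)
  next
    fix v assume v: "v \<in> {v. ?w \<bullet> v = 1} \<inter> G"
    then have "v \<noteq> 0" by auto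
    then show "v \<in> {v. ?w \<bullet> v = 1 \<and> proj v \<in> PG}" using v by (auto simp: PG_def)
  qed
  then have 3: "convex {v. ?w \<bullet> v = 1 \<and> proj v \<in> PG}"
    using convex by (simp add: convex_Int convex_hyperplane)
  obtain e where "e \<in> interior G" using interior_nonempty by blast
  then have "proj e \<in> proj_interior PG"
    unfolding proj_interior_eq mem_projectivization using zero_not_interior by (intro bexI[of _ e]) auto
  then show "(\<exists>w. w \<noteq> 0 \<and> PG \<subseteq> proj ` {v. w \<bullet> v = 1} \<and> convex {v. w \<bullet> v = 1 \<and> proj v \<in> PG}) \<and>
      proj_interior PG \<noteq> {}"
    using 1 2 3 by blast
qed

text \<open>The given endpoints may lie in \<open>G\<close> or in its negative. They lie in the same
  half, since otherwise \<open>total\<close> vanishes at some point of the segment; if it is the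
  negative half, both signs are changed.\<close>

lemma segment_in_cone:
  assumes seg: "nondegenerate_segment S" and S: "S \<subseteq> PG"
  obtains u v where "u \<noteq> v" "independent {u, v}" "S = proj ` closed_segment u v" "u \<in> G" "v \<in> G"
proof -
  obtain u v where uv: "u \<noteq> v" "independent {u, v}" "S = proj ` closed_segment u v"
    using seg unfolding nondegenerate_segment_def by blast
  have mem: "z \<in> G \<or> - z \<in> G" if "z \<in> closed_segment u v" for z
    using that S uv(3) line_cases unfolding PG_def by blast
  have nz: "z \<noteq> 0" if z: "z \<in> closed_segment u v" for z
  proof
    assume "z = 0"
    moreover obtain k where "z = (1 - k) *\<^sub>R u + k *\<^sub>R v" using z unfolding closed_segment_def by blast
    ultimately have "(1 - k) *\<^sub>R u + k *\<^sub>R v = 0" by simp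
    from independent_pair[OF uv(1,2) this] show False by simp
  qed
  have u: "u \<noteq> 0" "v \<noteq> 0" using nz by simp_all
  have same: "\<not> total u * total v < 0"
  proof
    assume "total u * total v < 0"
    then have ne: "total u * (total u - total v) > 0" "total v * (total v - total u) > 0"
      using zero_le_square[of "total u"] zero_le_square[of "total v"]
      unfolding right_diff_distrib mult.commute[of "total v" "total u"] by linarith+
    then have d: "total u - total v \<noteq> 0" by auto
    \<comment> \<open>The zero of the affine function \<open>total\<close> on the segment.\<close>
    define k where "k = total u / (total u - total v)"
    have "k * (total u - total v) = total u" using d by (simp add: k_def)
    then have t: "total ((1 - k) *\<^sub>R u + k *\<^sub>R v) = 0" unfolding total_simps by (simp add: algebra_simps)
    have "0 \<le> k" using ne(1) unfolding k_def zero_less_mult_iff zero_le_divide_iff by auto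
    moreover have "1 - k = total v / (total v - total u)" using d by (simp add: k_def field_simps)
    then have "k \<le> 1" using ne(2) unfolding zero_less_mult_iff
      by (metis diff_ge_0_iff_ge less_imp_le zero_le_divide_iff)
    ultimately have z: "(1 - k) *\<^sub>R u + k *\<^sub>R v \<in> closed_segment u v" unfolding closed_segment_def by auto
    have "total x \<noteq> 0" if "x \<in> G \<or> - x \<in> G" "x \<noteq> 0" for x
      using that total_pos[of x] total_pos[of "- x"] by (auto simp: total_simps)
    then show False using t mem[OF z] nz[OF z] by blast
  qed
  have pm: "(u \<in> G \<and> total u > 0) \<or> (- u \<in> G \<and> total u < 0)" "(v \<in> G \<and> total v > 0) \<or> (- v \<in> G \<and> total v < 0)"
    using mem[of u] mem[of v] total_pos[of u] total_pos[of "- u"] total_pos[of v] total_pos[of "- v"] u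
    by (auto simp: total_simps)
  then consider "u \<in> G" "v \<in> G" | "- u \<in> G" "- v \<in> G"
    using same by (auto simp: mult_less_0_iff)
  then show ?thesis
  proof cases
    case 1 then show ?thesis using that uv by blast
  next
    case 2
    have ind: "s = 0 \<and> t = 0" if "s *\<^sub>R (- u) + t *\<^sub>R (- v) = 0" for s t
      using independent_pair[OF uv(1,2), of "- s" "- t"] that by simp
    have "closed_segment (- u) (- v) = uminus ` closed_segment u v"
      by (rule closed_segment_linear_image[OF linear_uminus])
    then have "proj ` closed_segment (- u) (- v) = S"
      unfolding uv(3) by (simp add: image_image proj_uminus)
    then show ?thesis using that[of "- u" "- v"] independent_pairI[of "- u" "- v"] ind 2 by blast
  qed
qed

end

section \<open>The sides of the polygon\<close>

sublocale geometric_markoff \<subseteq> cone: octant_cone "nonneg_cone \<phi>"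
proof
  show "interior (nonneg_cone \<phi>) \<noteq> {}" using interior_point by blast
qed (simp_all add: closed_nonneg_cone nonneg_cone_add nonneg_cone_scaleR nonneg_cone_octant)

context geometric_markoff
begin

definition face :: "int \<times> int \<Rightarrow> proj_point set" where
  "face X = proj ` ({v \<in> nonneg_cone \<phi>. deform_at \<phi> v X = 0} - {0})"

lemma face_uminus: "face (- X) = face X"
  by (simp add: face_def deform_even[OF deform_at_deform])

lemma proj_mem_face: "proj v \<in> face X \<Longrightarrow> deform_at \<phi> v X = 0"
proof -
  assume "proj v \<in> face X"
  then obtain z where z: "deform_at \<phi> z X = 0" "proj v = proj z" by (auto simp: face_def)
  then obtain c where "v = c *\<^sub>R z" using proj_eqD by blast
  then show ?thesis using z by (simp add: deform_at_scaleR)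
qed

text \<open>A deformation vanishing at \<open>X\<close> is given by its values \<open>x\<close> at
  \<open>V\<close> and \<open>y\<close> at \<open>V + X\<close>, and it belongs to the cone iff
  \<open>x \<le> a * y\<close> and \<open>y \<le> a * x\<close>. The extreme rays of this planar
  cone are \<open>(1, a)\<close> and \<open>(a, 1)\<close>.\<close>

lemma face_segment:
  assumes b: "basis X V" and a: "a = exp (hlen \<phi> X)"
    and v1: "deform_at \<phi> v1 X = 0" "deform_at \<phi> v1 V = 1" "deform_at \<phi> v1 (V + X) = a"
    and v2: "deform_at \<phi> v2 X = 0" "deform_at \<phi> v2 V = a" "deform_at \<phi> v2 (V + X) = 1"
  shows "v1 \<noteq> v2" "independent {v1, v2}" "v1 \<in> nonneg_cone \<phi>" "v2 \<in> nonneg_cone \<phi>"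
    "face X = proj ` closed_segment v1 v2"
    "prim w \<Longrightarrow> w \<noteq> X \<Longrightarrow> w \<noteq> - X \<Longrightarrow> 0 < deform_at \<phi> (v1 + v2) w"
proof -
  have a1: "a > 1" using hlen_pos[OF basis_prim(1)[OF b]] a by simp
  then have a2: "a * a > 1" by (rule less_1_mult) (rule a1)
  have ind: "s = 0 \<and> t = 0" if st: "s *\<^sub>R v1 + t *\<^sub>R v2 = 0" for s t
  proof -
    have "deform_at \<phi> (s *\<^sub>R v1 + t *\<^sub>R v2) V = 0" "deform_at \<phi> (s *\<^sub>R v1 + t *\<^sub>R v2) (V + X) = 0"
      unfolding st by (simp_all add: deform_at_0)
    then have e: "s + t * a = 0" "s * a + t = 0" by (simp_all add: deform_at_add deform_at_scaleR v1 v2)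
    have "t * (a * a - 1) = a * (s + t * a) - (s * a + t)" by (simp add: algebra_simps)
    then have "t * (a * a - 1) = 0" using e by simp
    then have "t = 0" using a2 by simp
    then show ?thesis using e by simp
  qed
  show ne: "v1 \<noteq> v2" and indep: "independent {v1, v2}" using independent_pairI[of v1 v2] ind by blast+
  have suff: "v \<in> nonneg_cone \<phi>" if "deform_at \<phi> v X = 0" "deform_at \<phi> v V \<le> a * deform_at \<phi> v (V + X)"
    "deform_at \<phi> v (V + X) \<le> a * deform_at \<phi> v V" for v
    using face_sufficient(1)[OF deform_at_deform b] that unfolding nonneg_cone_def a by blast
  show mem: "v1 \<in> nonneg_cone \<phi>" "v2 \<in> nonneg_cone \<phi>" using suff v1 v2 a2 by simp_all
  have "{v \<in> nonneg_cone \<phi>. deform_at \<phi> v X = 0} = {s *\<^sub>R v1 + t *\<^sub>R v2 |s t. 0 \<le> s \<and> 0 \<le> t}"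
  proof (intro equalityI subsetI)
    fix v assume v: "v \<in> {v \<in> nonneg_cone \<phi>. deform_at \<phi> v X = 0}"
    define x y where "x = deform_at \<phi> v V" and "y = deform_at \<phi> v (V + X)"
    have le: "x \<le> a * y" "y \<le> a * x"
      using face_necessary[OF deform_at_deform b, of v] v unfolding nonneg_cone_def a x_def y_def by blast+
    define s t where "s = (a * y - x) / (a * a - 1)" and "t = (a * x - y) / (a * a - 1)"
    have st: "0 \<le> s" "0 \<le> t" using le a2 by (simp_all add: s_def t_def)
    have e: "s + t * a = x" "s * a + t = y"
      using a2 by (simp_all add: s_def t_def divide_simps) (simp_all add: algebra_simps)
    let ?u = "s *\<^sub>R v1 + t *\<^sub>R v2"
    \<comment> \<open>The triple of this basis is \<open>V + X\<close>, \<open>X\<close> and their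
      difference \<open>V\<close>, the three vectors at which the values are known.\<close>
    have b': "basis (V + X) X" using b by (simp add: basis_commute)
    have "v = ?u"
    proof (rule deform_at_inject)
      fix w assume "prim w"
      then show "deform_at \<phi> v w = deform_at \<phi> ?u w"
        by (rule deform_unique[OF deform_at_deform deform_at_deform b', rotated 3])
          (use v e in \<open>simp_all add: deform_at_add deform_at_scaleR v1 v2 x_def y_def\<close>)
    qed
    then show "v \<in> {s *\<^sub>R v1 + t *\<^sub>R v2 |s t. 0 \<le> s \<and> 0 \<le> t}" using st by blast
  next
    fix v assume "v \<in> {s *\<^sub>R v1 + t *\<^sub>R v2 |s t. 0 \<le> s \<and> 0 \<le> t}"
    then obtain s t where "0 \<le> s" "0 \<le> t" "v = s *\<^sub>R v1 + t *\<^sub>R v2" by blast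
    then show "v \<in> {v \<in> nonneg_cone \<phi>. deform_at \<phi> v X = 0}"
      using mem by (simp add: nonneg_cone_add nonneg_cone_scaleR deform_at_add deform_at_scaleR v1 v2)
  qed
  then show "face X = proj ` closed_segment v1 v2"
    unfolding face_def closed_segment_cone[OF indep ne] by simp
  show "0 < deform_at \<phi> (v1 + v2) w" if "prim w" "w \<noteq> X" "w \<noteq> - X"
  proof (rule face_sufficient(2)[OF deform_at_deform b _ _ _ _ _ that])
    have "(1 + a) * 1 < (1 + a) * a" using a1 by (intro mult_strict_left_mono) auto
    then have lt: "1 + a < a * (a + 1)" "a + 1 < a * (1 + a)" by (simp_all add: algebra_simps)
    show "deform_at \<phi> (v1 + v2) X = 0" by (simp add: deform_at_add v1 v2)
    show "deform_at \<phi> (v1 + v2) V < exp (hlen \<phi> X) * deform_at \<phi> (v1 + v2) (V + X)"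
      "deform_at \<phi> (v1 + v2) (V + X) < exp (hlen \<phi> X) * deform_at \<phi> (v1 + v2) V"
      using lt by (simp_all add: deform_at_add v1 v2 a[symmetric])
    then show "deform_at \<phi> (v1 + v2) V \<le> exp (hlen \<phi> X) * deform_at \<phi> (v1 + v2) (V + X)"
      "deform_at \<phi> (v1 + v2) (V + X) \<le> exp (hlen \<phi> X) * deform_at \<phi> (v1 + v2) V"
      by simp_all
  qed
qed

lemma octant_hull_face:
  assumes "basis X V" "a = exp (hlen \<phi> X)"
    and "deform_at \<phi> v1 X = 0" "deform_at \<phi> v1 V = 1" "deform_at \<phi> v1 (V + X) = a"
    and "deform_at \<phi> v2 X = 0" "deform_at \<phi> v2 V = a" "deform_at \<phi> v2 (V + X) = 1"
  shows "octant_hull {proj v1, proj v2} = face X"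
proof -
  note seg = face_segment[OF assms]
  show ?thesis
    unfolding seg(5)
    by (rule octant_hull_pair[OF nonneg_cone_octant[OF seg(3)] nonneg_cone_octant[OF seg(4)] seg(1,2)])
qed

lemma face_vertices:
  assumes "prim X"
  obtains v1 v2 where "v1 \<noteq> v2" "independent {v1, v2}" "v1 \<in> nonneg_cone \<phi>" "v2 \<in> nonneg_cone \<phi>"
    "face X = proj ` closed_segment v1 v2"
    "\<And>w. prim w \<Longrightarrow> w \<noteq> X \<Longrightarrow> w \<noteq> - X \<Longrightarrow> 0 < deform_at \<phi> (v1 + v2) w"
proof -
  obtain V where b: "basis X V" using prim_basis[OF assms] .
  have b': "basis (V + X) X" using b by (simp add: basis_commute)
  have pr: "prim X" "prim V" "prim (V + X)" using basis_prim[OF b] basis_prim[OF b'] by auto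
  have ex: "\<exists>v. deform_at \<phi> v X = 0 \<and> deform_at \<phi> v V = x \<and> deform_at \<phi> v (V + X) = y" for x y
  proof -
    define f where "f = deform_on (V + X) X (\<phi> (V + X), \<phi> X, \<phi> (V + X - X)) (y, 0, x)"
    have "deform_fun \<phi> f" unfolding f_def by (rule deform_on_deform_fun[OF markoff b'])
    then have "deform_at \<phi> (vector [f (1, 0), f (0, 1), f (1, 1)]) w = f w" if "prim w" for w
      using that by (rule deform_at_eq)
    moreover have "f (V + X) = y" "f X = 0" "f V = x"
      using deform_on_base[OF b', of _ y 0 x] by (simp_all add: f_def)
    ultimately show ?thesis using pr by metis
  qed
  obtain v1 where v1: "deform_at \<phi> v1 X = 0" "deform_at \<phi> v1 V = 1" "deform_at \<phi> v1 (V + X) = exp (hlen \<phi> X)"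
    using ex by blast
  obtain v2 where v2: "deform_at \<phi> v2 X = 0" "deform_at \<phi> v2 V = exp (hlen \<phi> X)" "deform_at \<phi> v2 (V + X) = 1"
    using ex by blast
  show ?thesis using face_segment[OF b refl v1 v2] that by blast
qed

lemma face_nondegenerate: "prim X \<Longrightarrow> nondegenerate_segment (face X)"
  by (rule face_vertices, assumption) (unfold nondegenerate_segment_def, blast)

lemma face_boundary: assumes "prim X" shows "face X \<subseteq> proj_boundary cone.PG"
proof
  fix p assume "p \<in> face X"
  then obtain v where v: "v \<in> nonneg_cone \<phi>" "v \<noteq> 0" "deform_at \<phi> v X = 0" "p = proj v" by (auto simp: face_def)
  then have "v \<notin> interior (nonneg_cone \<phi>)" using interior_positive[of v X] assms by auto
  then show "p \<in> proj_boundary cone.PG" using cone.mem_proj_boundary v by blast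
qed

lemma segment_face:
  assumes seg: "S = proj ` closed_segment u v" "u \<noteq> v" "independent {u, v}" "u \<in> nonneg_cone \<phi>" "v \<in> nonneg_cone \<phi>"
    and z: "deform_at \<phi> u X = 0" "deform_at \<phi> v X = 0"
  shows "S \<subseteq> face X"
proof
  fix p assume "p \<in> S"
  then obtain s t where st: "0 \<le> s" "0 \<le> t" "s *\<^sub>R u + t *\<^sub>R v \<noteq> 0" "p = proj (s *\<^sub>R u + t *\<^sub>R v)"
    unfolding seg(1) closed_segment_cone[OF seg(3,2)] by blast
  have "s *\<^sub>R u + t *\<^sub>R v \<in> nonneg_cone \<phi>" using seg(4,5) st by (intro nonneg_cone_add nonneg_cone_scaleR)
  moreover have "deform_at \<phi> (s *\<^sub>R u + t *\<^sub>R v) X = 0" by (simp add: deform_at_add deform_at_scaleR z)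
  ultimately show "p \<in> face X" using st by (auto simp: face_def)
qed

text \<open>The endpoints of the face are independent combinations of the endpoints of
  \<open>T\<close>. Evaluation at \<open>X\<close> vanishes at the former, hence on the plane they
  span, and so at the latter.\<close>

lemma face_maximal:
  assumes X: "prim X" and T: "nondegenerate_segment T" "T \<subseteq> proj_boundary cone.PG" "face X \<subseteq> T"
  shows "T = face X"
proof -
  obtain v1 v2 where v: "v1 \<noteq> v2" "independent {v1, v2}" "v1 \<in> nonneg_cone \<phi>" "v2 \<in> nonneg_cone \<phi>"
    "face X = proj ` closed_segment v1 v2" by (rule face_vertices[OF X]) (rule that; assumption)
  have TP: "T \<subseteq> cone.PG" using T(2) cone.proj_boundary_subset by blast
  obtain x y where xy: "x \<noteq> y" "independent {x, y}" "T = proj ` closed_segment x y"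
    "x \<in> nonneg_cone \<phi>" "y \<in> nonneg_cone \<phi>" by (rule cone.segment_in_cone[OF T(1) TP]) (rule that; assumption)
  have coords: "\<exists>\<alpha> \<beta>. w = \<alpha> *\<^sub>R x + \<beta> *\<^sub>R y" if w: "proj w \<in> T" for w
  proof -
    obtain z where z: "z \<in> closed_segment x y" "proj w = proj z" using w unfolding xy(3) by blast
    obtain k where "z = (1 - k) *\<^sub>R x + k *\<^sub>R y" using z(1) unfolding closed_segment_def by blast
    moreover obtain c where "w = c *\<^sub>R z" using z(2) proj_eqD by blast
    ultimately have "w = (c * (1 - k)) *\<^sub>R x + (c * k) *\<^sub>R y" by (simp add: scaleR_add_right)
    then show ?thesis by blast
  qed
  have in_face: "proj v1 \<in> face X" "proj v2 \<in> face X" unfolding v(5) by simp_all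
  obtain \<alpha>1 \<beta>1 where c1: "v1 = \<alpha>1 *\<^sub>R x + \<beta>1 *\<^sub>R y" using coords[of v1] in_face T(3) by blast
  obtain \<alpha>2 \<beta>2 where c2: "v2 = \<alpha>2 *\<^sub>R x + \<beta>2 *\<^sub>R y" using coords[of v2] in_face T(3) by blast
  define D where "D = \<alpha>1 * \<beta>2 - \<alpha>2 * \<beta>1"
  have D: "D \<noteq> 0"
  proof
    assume D: "D = 0"
    have "\<beta>2 *\<^sub>R v1 + (- \<beta>1) *\<^sub>R v2 = D *\<^sub>R x"
      unfolding c1 c2 D_def by (simp add: algebra_simps)
    then have b: "\<beta>2 = 0" "- \<beta>1 = 0" using independent_pair[OF v(1,2), of \<beta>2 "- \<beta>1"] D by simp_all
    have "\<alpha>2 *\<^sub>R v1 + (- \<alpha>1) *\<^sub>R v2 = (- D) *\<^sub>R y"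
      unfolding c1 c2 D_def by (simp add: algebra_simps)
    then have "\<alpha>2 = 0" "- \<alpha>1 = 0" using independent_pair[OF v(1,2), of \<alpha>2 "- \<alpha>1"] D by simp_all
    then have "v1 = 0" using c1 b by simp
    then show False using independent_pair[OF v(1,2), of 1 0] by simp
  qed
  let ?f = "\<lambda>w. deform_at \<phi> w X"
  have f: "\<alpha>1 * ?f x + \<beta>1 * ?f y = 0" "\<alpha>2 * ?f x + \<beta>2 * ?f y = 0"
    using proj_mem_face[OF in_face(1)] proj_mem_face[OF in_face(2)] unfolding c1 c2
    by (simp_all add: deform_at_add deform_at_scaleR)
  have "D * ?f x = \<beta>2 * (\<alpha>1 * ?f x + \<beta>1 * ?f y) - \<beta>1 * (\<alpha>2 * ?f x + \<beta>2 * ?f y)"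
    "D * ?f y = \<alpha>1 * (\<alpha>2 * ?f x + \<beta>2 * ?f y) - \<alpha>2 * (\<alpha>1 * ?f x + \<beta>1 * ?f y)"
    by (simp_all add: D_def algebra_simps)
  then have "?f x = 0" "?f y = 0" unfolding f using D by simp_all
  then have "T \<subseteq> face X" using segment_face[OF xy(3,1,2,4,5)] by blast
  then show ?thesis using T(3) by blast
qed

lemma face_is_side: "prim X \<Longrightarrow> is_side cone.PG (face X)"
  unfolding is_side_def using face_nondegenerate face_boundary face_maximal by blast

text \<open>The midpoint of a side is a boundary point, so by \<open>boundary_sum\<close> the
  endpoints have a common zero \<open>w\<close>. The side is contained in the face of
  \<open>w\<close> and equals it by maximality.\<close>

lemma side_is_face:
  assumes S: "is_side cone.PG S" obtains X where "prim X" "S = face X"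
proof -
  have s: "nondegenerate_segment S" "S \<subseteq> proj_boundary cone.PG"
    and max: "\<And>T. nondegenerate_segment T \<Longrightarrow> T \<subseteq> proj_boundary cone.PG \<Longrightarrow> S \<subseteq> T \<Longrightarrow> T = S"
    using S unfolding is_side_def by blast+
  have SP: "S \<subseteq> cone.PG" using s(2) cone.proj_boundary_subset by blast
  obtain u v where uv: "u \<noteq> v" "independent {u, v}" "S = proj ` closed_segment u v"
    "u \<in> nonneg_cone \<phi>" "v \<in> nonneg_cone \<phi>" by (rule cone.segment_in_cone[OF s(1) SP]) (rule that; assumption)
  have ind: "s = 0 \<and> t = 0" if "s *\<^sub>R u + t *\<^sub>R v = 0" for s t
    using independent_pair[OF uv(1,2) that] by blast
  have nz: "u + v \<noteq> 0" using ind[of 1 1] by auto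
  have "(1 / 2) *\<^sub>R (u + v) = (1 - 1 / 2) *\<^sub>R u + (1 / 2) *\<^sub>R v" by (simp add: scaleR_add_right)
  then have "(1 / 2) *\<^sub>R (u + v) \<in> closed_segment u v"
    unfolding closed_segment_def by (intro CollectI exI[of _ "1 / 2"]) simp
  then have "proj ((1 / 2) *\<^sub>R (u + v)) \<in> S" unfolding uv(3) by (rule imageI)
  then have "proj (u + v) \<in> proj_boundary cone.PG" using s(2) proj_scaleR[of "1 / 2" "u + v"] by auto
  then have "u + v \<notin> interior (nonneg_cone \<phi>)"
    using cone.mem_proj_boundary[OF nonneg_cone_add[OF uv(4,5)] nz] by blast
  then obtain w where w: "prim w" "deform_at \<phi> u w = 0" "deform_at \<phi> v w = 0"
    using boundary_sum[OF uv(4,5) ind] by blast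
  then have "S \<subseteq> face w" using segment_face[OF uv(3,1,2,4,5)] by blast
  then have "face w = S" by (rule max[OF face_nondegenerate[OF w(1)] face_boundary[OF w(1)]])
  then show ?thesis using that w(1) by blast
qed

text \<open>The sum of the two endpoints satisfies the strict inequalities of
  \<open>face_sufficient\<close>, so it vanishes at a single slope. This identifies the slope of a
  side.\<close>

lemma face_interior_point:
  assumes "prim X"
  obtains v where "v \<noteq> 0" "proj v \<in> face X" "\<And>w. prim w \<Longrightarrow> deform_at \<phi> v w = 0 \<Longrightarrow> w = X \<or> w = - X"
proof -
  obtain v1 v2 where v: "v1 \<noteq> v2" "independent {v1, v2}" "v1 \<in> nonneg_cone \<phi>" "v2 \<in> nonneg_cone \<phi>"
    "face X = proj ` closed_segment v1 v2" "\<And>w. prim w \<Longrightarrow> w \<noteq> X \<Longrightarrow> w \<noteq> - X \<Longrightarrow> 0 < deform_at \<phi> (v1 + v2) w"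
    by (rule face_vertices[OF assms]) (rule that; assumption)
  have nz: "v1 + v2 \<noteq> 0" using independent_pair[OF v(1,2), of 1 1] by auto
  have "v1 + v2 = 1 *\<^sub>R v1 + 1 *\<^sub>R v2" by simp
  then have "proj (v1 + v2) \<in> face X"
    unfolding v(5) closed_segment_cone[OF v(2,1)] using nz
    by (intro imageI DiffI CollectI exI[of _ 1] conjI) auto
  then show ?thesis using that nz v(6) by (metis less_irrefl)
qed

lemma exp_hlen: assumes "a > 1" "\<phi> X = a + inverse a" shows "a = exp (hlen \<phi> X)"
proof -
  have "\<phi> X / 2 = cosh (ln a)" using assms by (simp add: cosh_ln_real)
  then have "hlen \<phi> X = ln a" using assms by (simp add: hlen_def arcosh_cosh_real)
  then show ?thesis using assms by simp
qed

end

section \<open>The quadrilateral and the four explicit sides\<close>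

lemma vector_3_nonneg: "0 \<le> x \<Longrightarrow> 0 \<le> y \<Longrightarrow> 0 \<le> z \<Longrightarrow> 0 \<le> (vector [x, y, z] :: real ^ 3) $ i"
  using exhaust_3[of i] by auto

theorem theorem3p2:
  fixes \<Phi> :: "slope \<Rightarrow> real"
    and A B C D K a b c d :: real
    and \<alpha> \<beta> \<gamma> \<delta> Q P :: "proj_point set"
  assumes "markoff_map \<Phi>"
    and "\<forall>s. \<Phi> s > 2"
    and "A = \<Phi> None" and "B = \<Phi> (Some 0)" and "C = \<Phi> (Some 1)" and "D = \<Phi> (Some 2)"
    and "K = A^2 + B^2 + C^2 - A * B * C - 2" and "K < 2"
    and "a > 1" and "b > 1" and "c > 1" and "d > 1"
    and "A = a + inverse a" and "B = b + inverse b"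
    and "C = c + inverse c" and "D = d + inverse d"
    and "\<alpha> = octant_hull {hom_pt 0 1 a, hom_pt 0 a 1}"
    and "\<beta> = octant_hull {hom_pt 1 0 b, hom_pt b 0 1}"
    and "\<gamma> = octant_hull {hom_pt 1 c 0, hom_pt c 1 0}"
    and "\<delta> = octant_hull {hom_pt 1 (C + d * A) d, hom_pt d (A + d * C) 1}"
    and "Q = octant_hull {hom_pt 0 0 1, hom_pt 1 0 0, hom_pt 1 C 0, hom_pt 0 A 1}"
    and "P = proj_closure (projectivization (lengthening_cone \<Phi>))"
  shows "D = A * C - B
    \<and> projective_polygon P
    \<and> projectivization (lengthening_cone \<Phi>) = proj_interior P
    \<and> P \<subseteq> Q
    \<and> octant_hull (\<alpha> \<union> \<beta> \<union> \<gamma> \<union> \<delta>) \<subseteq> P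
    \<and> (\<forall>s. \<exists>!S. side_of_slope \<Phi> P s S)
    \<and> (\<forall>S. is_side P S \<longrightarrow> (\<exists>!s. side_of_slope \<Phi> P s S))
    \<and> side_of_slope \<Phi> P None \<alpha>
    \<and> side_of_slope \<Phi> P (Some 0) \<beta>
    \<and> side_of_slope \<Phi> P (Some 1) \<gamma>
    \<and> side_of_slope \<Phi> P (Some 2) \<delta>"
proof -
  define \<phi> where "\<phi> = (\<lambda>w. \<Phi> (slope_of w))"
  have slopes: "slope_of (1, 0) = None" "slope_of (0, 1) = Some 0" "slope_of (0, - 1) = Some 0"
    "slope_of (1, 1) = Some 1" "slope_of (2, 1) = Some 2"
    by (simp_all add: slope_of_def rat_number_collapse)
  have m: "markoff_fun \<phi>" unfolding \<phi>_def using assms(1) markoff_map_iff by blast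
  have v: "\<phi> (1, 0) = A" "\<phi> (0, 1) = B" "\<phi> (0, - 1) = B" "\<phi> (1, 1) = C" "\<phi> (2, 1) = D"
    using assms(3-6) by (simp_all add: \<phi>_def slopes)
  have std: "basis (1, 0) (0, - 1)" by (simp add: basis_def wedge_def)
  have geo: "geometric \<phi>"
  proof (rule geometric_of_triple[OF m std])
    show "\<phi> (1, 0) > 2" "\<phi> (0, - 1) > 2" "\<phi> ((1, 0) - (0, - 1)) > 2" using assms(2) by (simp_all add: \<phi>_def)
    show "kappa \<phi> (1, 0) (0, - 1) < 2" using assms(7,8) by (simp add: kappa_def v)
  qed
  interpret geometric_markoff \<phi> using geo by unfold_locales
  note geo' = geo[unfolded \<phi>_def]
  have cone_eq: "lengthening_cone \<Phi> = interior (nonneg_cone \<phi>)"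
    using lengthening_cone_eq[OF geo'] by (simp add: \<phi>_def)
  have P: "P = cone.PG" unfolding assms(22) cone_eq by (rule cone.proj_closure_eq)
  have b21: "basis (1, 0) (1, 1)" by (simp add: basis_def wedge_def)
  have D: "D = A * C - B" using markoff_add[OF m b21] by (simp add: v)
  \<comment> \<open>Slope \<open>2\<close> lies opposite to slope \<open>0\<close> across the edge
    between \<infinity> and \<open>1\<close>, which expresses its value by the three
    coordinates.\<close>
  have F21: "deform_at \<phi> w (2, 1) = w $ 1 * C + A * w $ 3 - w $ 2" for w
    using deform_add[OF deform_at_deform[of w] b21] deform_even[OF deform_at_deform[of w], of "(0, 1)"]
    by (simp add: v deform_at_base)
  have F10: "deform_at \<phi> w (- 1, 0) = w $ 1" for w
    using deform_even[OF deform_at_deform[of w], of "(1, 0)"] by (simp add: deform_at_base)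
  have pos: "A > 2" "B > 2" "C > 2" using assms(2-5) by auto
  have side: "side_of_slope \<Phi> P s (face (reduced_form s))" for s
    unfolding side_of_slope_def P
  proof (intro conjI allI impI)
    show "is_side cone.PG (face (reduced_form s))" by (rule face_is_side[OF prim_reduced_form])
    fix \<Phi>' assume "infinitesimal_deformation \<Phi> \<Phi>' \<and> deformation_coords \<Phi>' \<noteq> 0 \<and>
      proj (deformation_coords \<Phi>') \<in> face (reduced_form s)"
    then show "\<Phi>' s = 0" using proj_mem_face deformation_coords_slope[OF geo', of \<Phi>' s] by (simp add: \<phi>_def)
  qed
  have side_unique: "reduced_form s = X \<or> reduced_form s = - X"
    if X: "prim X" and s: "side_of_slope \<Phi> P s (face X)" for s X
  proof -
    obtain w where w: "w \<noteq> 0" "proj w \<in> face X" "\<And>x. prim x \<Longrightarrow> deform_at \<phi> w x = 0 \<Longrightarrow> x = X \<or> x = - X"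
      using face_interior_point[OF X] by blast
    obtain \<Phi>' where \<Phi>': "infinitesimal_deformation \<Phi> \<Phi>'" "deformation_coords \<Phi>' = w"
      using deformation_coords_surj[OF geo'] by blast
    then have "\<Phi>' s = 0" using s w unfolding side_of_slope_def by blast
    then have "deform_at \<phi> w (reduced_form s) = 0"
      using deformation_coords_slope[OF geo' \<Phi>'(1), of s] \<Phi>'(2) by (simp add: \<phi>_def)
    then show ?thesis using w(3) prim_reduced_form by blast
  qed
  have "\<exists>!S. side_of_slope \<Phi> P s S" for s
  proof (rule ex1I[of _ "face (reduced_form s)"])
    fix S assume S: "side_of_slope \<Phi> P s S"
    then obtain X where X: "prim X" "S = face X" using side_is_face unfolding side_of_slope_def P by blast
    then have "reduced_form s = X \<or> reduced_form s = - X" using side_unique S by blast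
    then show "S = face (reduced_form s)" using X(2) face_uminus[of X] by metis
  qed (rule side)
  moreover have "\<exists>!s. side_of_slope \<Phi> P s S" if "is_side P S" for S
  proof -
    obtain X where X: "prim X" "S = face X" using side_is_face \<open>is_side P S\<close> unfolding P by blast
    show ?thesis
    proof (rule ex1I[of _ "slope_of X"])
      have "face (reduced_form (slope_of X)) = S"
        using reduced_form_slope_of[OF X(1)] X(2) face_uminus[of X] by metis
      then show "side_of_slope \<Phi> P (slope_of X) S" using side[of "slope_of X"] by simp
      fix s assume "side_of_slope \<Phi> P s S"
      then have "reduced_form s = X \<or> reduced_form s = - X" using side_unique X by blast
      then show "s = slope_of X" using slope_of_reduced_form[of s] slope_of_uminus[of X] by metis
    qed
  qed
  moreover have \<alpha>: "\<alpha> = face (reduced_form None)"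
  proof -
    have b: "basis (1, 0) (0, 1)" by simp
    have e: "a = exp (hlen \<phi> (1, 0))" using assms(9,13) by (intro exp_hlen) (simp_all add: v)
    show ?thesis unfolding assms(17) reduced_form.simps quotient_of_number
      by (rule octant_hull_face[OF b e]) (simp_all add: deform_at_base)
  qed
  moreover have \<beta>: "\<beta> = face (reduced_form (Some 0))"
  proof -
    have b: "basis (0, 1) (1, 0)" by (simp add: basis_def wedge_def)
    have e: "b = exp (hlen \<phi> (0, 1))" using assms(10,14) by (intro exp_hlen) (simp_all add: v)
    show ?thesis unfolding assms(18) reduced_form.simps quotient_of_number
      by (rule octant_hull_face[OF b e]) (simp_all add: deform_at_base)
  qed
  moreover have \<gamma>: "\<gamma> = face (reduced_form (Some 1))"
  proof -
    \<comment> \<open>With the partner \<open>V = (- 1, 0)\<close> the sum \<open>V + X\<close> is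
      \<open>(0, 1)\<close>, so the required values \<open>(1, c)\<close> and \<open>(c, 1)\<close>
      are the first two coordinates of the given endpoints.\<close>
    have b: "basis (1, 1) (- 1, 0)" by (simp add: basis_def wedge_def)
    have e: "c = exp (hlen \<phi> (1, 1))" using assms(11,15) by (intro exp_hlen) (simp_all add: v)
    show ?thesis unfolding assms(19) reduced_form.simps quotient_of_number
      by (rule octant_hull_face[OF b e]) (simp_all add: deform_at_base F10)
  qed
  moreover have \<delta>: "\<delta> = face (reduced_form (Some 2))"
  proof -
    \<comment> \<open>Here \<open>V + X = (1, 1)\<close>, so \<open>(1, d)\<close> and
      \<open>(d, 1)\<close> are the first and third coordinates; the middle coordinate makes the
      value at slope \<open>2\<close> vanish.\<close>
    have b: "basis (2, 1) (- 1, 0)" by (simp add: basis_def wedge_def)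
    have e: "d = exp (hlen \<phi> (2, 1))" using assms(12,16) by (intro exp_hlen) (simp_all add: v)
    show ?thesis unfolding assms(20) reduced_form.simps quotient_of_number
      by (rule octant_hull_face[OF b e]) (simp_all add: deform_at_base F10 F21 mult.commute)
  qed
  moreover have "P \<subseteq> Q"
  proof
    fix p assume "p \<in> P"
    then obtain w where w: "w \<in> nonneg_cone \<phi>" "w \<noteq> 0" "p = proj w" by (auto simp: P cone.PG_def)
    define x y z where "x = w $ 1" and "y = w $ 2" and "z = w $ 3"
    have nn: "0 \<le> x" "0 \<le> y" "0 \<le> z" using nonneg_cone_octant[OF w(1)] by (simp_all add: x_def y_def z_def)
    \<comment> \<open>\<open>q - y\<close> is the value at slope \<open>2\<close>, so
      \<open>y \<le> q\<close> on the cone; this inequality cuts the quadrilateral out of the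
      octant.\<close>
    define q where "q = x * C + A * z"
    have "prim (2, 1)" by (simp add: prim_def)
    then have yq: "y \<le> q" using w(1) unfolding nonneg_cone_def q_def x_def y_def z_def by (force simp: F21)
    have "q > 0"
    proof (rule ccontr)
      assume "\<not> q > 0"
      moreover have "0 \<le> x * C" "0 \<le> A * z" using nn pos by simp_all
      ultimately have "x * C = 0" "A * z = 0" "y = 0" using nn yq unfolding q_def by linarith+
      then have "x = 0" "y = 0" "z = 0" using pos by auto
      then show False using w(2) by (simp add: x_def y_def z_def vec_eq_iff forall_3)
    qed
    \<comment> \<open>With \<open>x\<close> and \<open>z\<close> fixed, \<open>y = 0\<close> and
      \<open>y = q\<close> give points on two opposite sides of the quadrilateral; \<open>l\<close>
      interpolates between them.\<close>
    define l where "l = y / q"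
    have l: "0 \<le> l" "l \<le> 1" "l * q = y" using nn yq \<open>q > 0\<close> by (simp_all add: l_def)
    let ?A = "{hom_pt 0 0 1, hom_pt 1 0 0, hom_pt 1 C 0, hom_pt 0 A 1}"
    have base: "vector [0, 0, 1] \<in> octant_cone_of ?A" "vector [1, 0, 0] \<in> octant_cone_of ?A"
      "vector [1, C, 0] \<in> octant_cone_of ?A" "vector [0, A, 1] \<in> octant_cone_of ?A"
      using pos by (simp_all add: octant_cone_of_base vector_3_nonneg)
    have "w = ((1 - l) * z) *\<^sub>R vector [0, 0, 1] + ((1 - l) * x) *\<^sub>R vector [1, 0, 0]
        + (l * x) *\<^sub>R vector [1, C, 0] + (l * z) *\<^sub>R vector [0, A, 1]"
      using l(3) by (simp add: vec_eq_iff forall_3 x_def[symmetric] y_def[symmetric] z_def[symmetric] q_def algebra_simps)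
    then have "w \<in> octant_cone_of ?A"
      using base l nn by (metis octant_cone_of_add octant_cone_of_scaleR mult_nonneg_nonneg diff_ge_0_iff_ge)
    then show "p \<in> Q" unfolding w(3) assms(21) using w(2) by (rule octant_hullI)
  qed
  moreover have "octant_hull (\<alpha> \<union> \<beta> \<union> \<gamma> \<union> \<delta>) \<subseteq> P"
    unfolding P cone.PG_def
  proof (rule octant_hull_subset[OF convex_nonneg_cone])
    fix w :: "real ^ 3" assume w: "w \<noteq> 0" "\<And>i. 0 \<le> w $ i" and "proj w \<in> \<alpha> \<union> \<beta> \<union> \<gamma> \<union> \<delta>"
    then obtain X where "proj w \<in> face X" unfolding \<alpha> \<beta> \<gamma> \<delta> by blast
    then have "proj w \<in> proj ` (nonneg_cone \<phi> - {0})" unfolding face_def by blast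
    then have "w \<in> nonneg_cone \<phi> \<or> - w \<in> nonneg_cone \<phi>" by (rule cone.line_cases)
    moreover have "total w > 0" using octant_total_pos w by blast
    then have "- w \<notin> nonneg_cone \<phi>" using cone.total_pos[of "- w"] w(1) by (auto simp: total_simps)
    ultimately show "w \<in> nonneg_cone \<phi>" by blast
  qed
  moreover have "projective_polygon P" unfolding P by (rule cone.projective_polygon_PG)
  moreover have "projectivization (lengthening_cone \<Phi>) = proj_interior P"
    unfolding P cone_eq cone.proj_interior_eq ..
  moreover have "side_of_slope \<Phi> P None \<alpha>" "side_of_slope \<Phi> P (Some 0) \<beta>"
    "side_of_slope \<Phi> P (Some 1) \<gamma>" "side_of_slope \<Phi> P (Some 2) \<delta>"
    unfolding \<alpha> \<beta> \<gamma> \<delta> by (rule side)+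
  ultimately show ?thesis using D by blast
qed

end
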